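(* There are absolute constants $C_1,C_2>0$ such that the following holds. Let $\mathbf{X}=\{X_1,\dots,X_n\}$ be independent non-negative random variables and let $\varepsilon>0$. Then there exists a subset $\mathbf{X}'\subseteq\mathbf{X}$, obtained from $\mathbf{X}$ by removing at most $C_1(\varepsilon^{-1}\log(1/\varepsilon))^2$ of the variables, such that $$\mathsf{OPT}_{\mathsf{free}}(\mathbf{X}') \geq (\beta - C_2\varepsilon)\cdot \mathsf{MAX}(\mathbf{X}').$$ Moreover, such a subset $\mathbf{X}'$ and a policy achieving this guarantee can be constructed in polynomial time.
   Context: For a finite collection $\mathbf{X}$ of independent non-negative random variables with known distributions, $\mathsf{MAX}(\mathbf{X})=\mathbb{E}[\max_i X_i]$, and $\mathsf{OPT}_{\mathsf{free}}(\mathbf{X})$ is the largest expected reward of an online stopping policy that may choose the order in which it inspects the variables: after inspecting a variable it learns its realized value and irrevocably either stops and receives that value or discards it and continues. The Kertz constant $\beta\approx 0.745$ is the solution of $\int_0^1 [(\beta^{-1}-1) - y(\log y - 1)]^{-1}\,dy = 1$. *)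

theory Defs
  imports
    "HOL-Probability.Probability"
    "HOL-Library.Log_Nat"
    "HOL-Computational_Algebra.Polynomial"
begin

section \<open>The free-order prophet problem\<close>

definition kertz_const :: real where
  "kertz_const = (THE b. 0 < b \<and> b < 1 \<and>
     ((\<lambda>y. inverse ((inverse b - 1) - y * (ln y - 1))) has_integral 1) {0..1})"

text \<open>An instance is a family of laws \<open>D i\<close> indexed by a finite set \<open>J\<close>; the independent variables
  are the coordinates of the product space \<open>PiM J D\<close>. Working with laws rather than with random
  variables on an arbitrary space keeps all types concrete, so that constants quantified outside of
  \<open>D\<close> are absolute. The lemmas \<open>expected_max_indep_vars\<close> and \<open>expected_reward_indep_vars\<close> below
  transfer the notions to arbitrary probability spaces. Expectations are taken in \<open>ennreal\<close>, so
  infinite means are allowed.\<close>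

definition nonneg_law :: "real measure \<Rightarrow> bool" where
  "nonneg_law \<mu> \<longleftrightarrow> prob_space \<mu> \<and> sets \<mu> = sets borel \<and> (AE v in \<mu>. 0 \<le> v)"

definition expected_max :: "(nat \<Rightarrow> real measure) \<Rightarrow> nat set \<Rightarrow> ennreal" where
  "expected_max D J = (\<integral>\<^sup>+ x. (\<Squnion>i\<in>J. ennreal (x i)) \<partial>PiM J D)"

text \<open>A history lists the inspected indices with their observed values, most recent first.
  \<open>Stop\<close> accepts the most recently observed value; \<open>Inspect i\<close> irrevocably discards it and
  inspects variable \<open>i\<close>.\<close>

type_synonym history = "(nat \<times> real) list"

datatype action = Stop | Inspect nat

type_synonym policy = "history \<Rightarrow> action"

definition last_value :: "history \<Rightarrow> real" where
  "last_value h = (case h of [] \<Rightarrow> 0 | (i, v) # _ \<Rightarrow> v)"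

text \<open>\<open>payoff R \<pi> x h\<close> is the reward of \<open>\<pi>\<close> when the realized values are \<open>x\<close>, the history is \<open>h\<close>, and
  \<open>R\<close> is the set of variables not inspected so far. Asking for an unavailable variable ends the
  process with reward \<open>0\<close>; in particular this is how a policy may decline the last variable.\<close>

function payoff :: "nat set \<Rightarrow> policy \<Rightarrow> (nat \<Rightarrow> real) \<Rightarrow> history \<Rightarrow> real" where
  "payoff R \<pi> x h =
    (case \<pi> h of
       Stop \<Rightarrow> last_value h
     | Inspect i \<Rightarrow> if finite R \<and> i \<in> R then payoff (R - {i}) \<pi> x ((i, x i) # h) else 0)"
  by pat_completeness auto
termination
  by (relation "Wellfounded.measure (\<lambda>(R, _). card R)", simp, clarsimp)
     (metis One_nat_def card_Diff1_less card_Diff_singleton)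

declare payoff.simps [simp del]

definition measurable_policy :: "policy \<Rightarrow> bool" where
  "measurable_policy \<pi> \<longleftrightarrow>
    (\<forall>is. (\<lambda>x. \<pi> (map (\<lambda>i. (i, x i)) is))
       \<in> (\<Pi>\<^sub>M i\<in>(UNIV :: nat set). (borel :: real measure)) \<rightarrow>\<^sub>M count_space UNIV)"

definition expected_reward :: "(nat \<Rightarrow> real measure) \<Rightarrow> nat set \<Rightarrow> policy \<Rightarrow> ennreal" where
  "expected_reward D J \<pi> = (\<integral>\<^sup>+ x. ennreal (payoff J \<pi> x []) \<partial>PiM J D)"

definition opt_free :: "(nat \<Rightarrow> real measure) \<Rightarrow> nat set \<Rightarrow> ennreal" where
  "opt_free D J = (\<Squnion>\<pi>\<in>{\<pi>. measurable_policy \<pi>}. expected_reward D J \<pi>)"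

lemma payoff_cong:
  assumes "\<And>i. i \<in> R \<Longrightarrow> x i = y i"
  shows "payoff R \<pi> x h = payoff R \<pi> y h"
  using assms
proof (induction R \<pi> x h rule: payoff.induct)
  case (1 R \<pi> x h)
  show ?case
    using 1 by (subst (1 2) payoff.simps) (auto split: action.split)
qed

lemma measurable_payoff_aux:
  assumes "measurable_policy \<pi>" "finite R"
  shows "(\<lambda>x. payoff R \<pi> x (map (\<lambda>i. (i, x i)) is)) \<in> borel_measurable (\<Pi>\<^sub>M i\<in>UNIV. borel)"
  using assms(2)
proof (induction "card R" arbitrary: R "is" rule: less_induct)
  case less
  define F where "F a x =
    (case a of
       Stop \<Rightarrow> last_value (map (\<lambda>i. (i, x i)) is)
     | Inspect i \<Rightarrow> if i \<in> R then payoff (R - {i}) \<pi> x (map (\<lambda>i. (i, x i)) (i # is)) else 0)"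
    for a and x :: "nat \<Rightarrow> real"
  have eq: "payoff R \<pi> x (map (\<lambda>i. (i, x i)) is) = F (\<pi> (map (\<lambda>i. (i, x i)) is)) x" for x
    using less.prems by (subst payoff.simps) (simp add: F_def split: action.split)
  have "F a \<in> borel_measurable (\<Pi>\<^sub>M i\<in>UNIV. borel)" for a
  proof (cases a)
    case Stop
    then show ?thesis
      by (cases "is") (auto simp: F_def[abs_def] last_value_def)
  next
    case (Inspect i)
    show ?thesis
    proof (cases "i \<in> R")
      case True
      then have "card (R - {i}) < card R"
        using less.prems by (meson card_Diff1_less)
      from less.hyps[OF this, of "i # is"] less.prems Inspect True show ?thesis
        by (simp add: F_def[abs_def])
    qed (simp add: F_def[abs_def] Inspect)
  qed
  moreover have "countable (UNIV :: action set)"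
  proof -
    have "(UNIV :: action set) = insert Stop (range Inspect)"
      using action.exhaust by auto
    then show ?thesis
      by (metis countable_insert countable_image countableI_type)
  qed
  ultimately show ?case
    unfolding eq
    using measurable_compose_countable'[of UNIV F, OF _ assms(1)[unfolded measurable_policy_def, rule_format]]
    by blast
qed

lemma measurable_payoff:
  assumes "measurable_policy \<pi>" "finite J"
  shows "(\<lambda>x. payoff J \<pi> x []) \<in> borel_measurable (\<Pi>\<^sub>M i\<in>J. borel)"
proof -
  have "(\<lambda>x. payoff J \<pi> x []) \<in> borel_measurable (\<Pi>\<^sub>M i\<in>UNIV. borel)"
    using measurable_payoff_aux[OF assms, of "[]"] by simp
  moreover have "(\<lambda>x i. if i \<in> J then x i else 0) \<in> (\<Pi>\<^sub>M i\<in>J. borel) \<rightarrow>\<^sub>M (\<Pi>\<^sub>M i\<in>UNIV. (borel :: real measure))"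
  proof (rule measurable_PiM_single')
    show "(\<lambda>x. if i \<in> J then x i else 0) \<in> borel_measurable (\<Pi>\<^sub>M i\<in>J. (borel :: real measure))" for i
      by (cases "i \<in> J") simp_all
  qed auto
  ultimately have "(\<lambda>x. payoff J \<pi> (\<lambda>i. if i \<in> J then x i else 0) []) \<in> borel_measurable (\<Pi>\<^sub>M i\<in>J. borel)"
    by (rule measurable_compose[rotated])
  moreover have "payoff J \<pi> (\<lambda>i. if i \<in> J then x i else 0) [] = payoff J \<pi> x []" for x
    by (rule payoff_cong) auto
  ultimately show ?thesis by simp
qed

lemma (in prob_space) nn_integral_indep_vars:
  assumes "finite J" "indep_vars (\<lambda>_. borel) X J"
    and "f \<in> borel_measurable (\<Pi>\<^sub>M i\<in>J. (borel :: real measure))"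
  shows "(\<integral>\<^sup>+ x. f x \<partial>PiM J (\<lambda>i. distr M borel (X i))) = (\<integral>\<^sup>+ \<omega>. f (\<lambda>i\<in>J. X i \<omega>) \<partial>M)"
proof (cases "J = {}")
  case True
  have eq: "(\<lambda>i\<in>{}. X i \<omega>) = (\<lambda>_. undefined)" for \<omega>
    by (rule ext) (simp only: restrict_def empty_iff if_False)
  have "(\<integral>\<^sup>+ x. f x \<partial>PiM J (\<lambda>i. distr M borel (X i))) = f (\<lambda>_. undefined)"
    by (simp only: True PiM_empty) (simp add: nn_integral_count_space_finite)
  also have "\<dots> = (\<integral>\<^sup>+ \<omega>. f (\<lambda>_. undefined) \<partial>M)"
    by (simp add: emeasure_space_1)
  finally show ?thesis
    by (simp only: True eq)
next
  case False
  have rv: "random_variable borel (X i)" if "i \<in> J" for i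
    using assms(2) that by (auto simp: indep_vars_def2)
  have "(\<lambda>\<omega>. \<lambda>i\<in>J. X i \<omega>) \<in> M \<rightarrow>\<^sub>M (\<Pi>\<^sub>M i\<in>J. borel)"
    using rv by (intro measurable_restrict)
  moreover have "PiM J (\<lambda>i. distr M borel (X i)) = distr M (\<Pi>\<^sub>M i\<in>J. borel) (\<lambda>\<omega>. \<lambda>i\<in>J. X i \<omega>)"
    using indep_vars_iff_distr_eq_PiM'[where M' = "\<lambda>_. borel" and X = X, OF False] rv assms(2) by simp
  ultimately show ?thesis
    using assms(3) by (simp add: nn_integral_distr)
qed

lemma (in prob_space) expected_max_indep_vars:
  assumes "finite J" "indep_vars (\<lambda>_. borel) X J"
  shows "expected_max (\<lambda>i. distr M borel (X i)) J = (\<integral>\<^sup>+ \<omega>. (\<Squnion>i\<in>J. ennreal (X i \<omega>)) \<partial>M)"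
  unfolding expected_max_def
  by (subst nn_integral_indep_vars[OF assms])
     (use assms(1) in \<open>auto intro!: nn_integral_cong borel_measurable_SUP countable_finite\<close>)

lemma (in prob_space) expected_reward_indep_vars:
  assumes "finite J" "indep_vars (\<lambda>_. borel) X J" "measurable_policy \<pi>"
  shows "expected_reward (\<lambda>i. distr M borel (X i)) J \<pi> =
         (\<integral>\<^sup>+ \<omega>. ennreal (payoff J \<pi> (\<lambda>i. X i \<omega>) []) \<partial>M)"
  unfolding expected_reward_def
  by (subst nn_integral_indep_vars[OF assms(1,2)])
     (use measurable_payoff[OF assms(3,1)] in
       \<open>auto intro!: nn_integral_cong arg_cong[where f = ennreal] payoff_cong\<close>)

section \<open>Explicitly represented instances and policies\<close>

text \<open>A law with finite support is given as a list of (value, probability) pairs of rationals.\<close>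

type_synonym fin_law = "(rat \<times> rat) list"

abbreviation real_pairs :: "fin_law \<Rightarrow> (real \<times> real) list" where
  "real_pairs \<equiv> map (\<lambda>(v, p). (of_rat v, of_rat p))"

definition law_of :: "fin_law \<Rightarrow> real measure" where
  "law_of vps = distr (measure_pmf (pmf_of_list (real_pairs vps))) borel (\<lambda>v. v)"

definition valid_fin_law :: "fin_law \<Rightarrow> bool" where
  "valid_fin_law vps \<longleftrightarrow> pmf_of_list_wf (real_pairs vps) \<and> (\<forall>(v, p)\<in>set vps. 0 \<le> v)"

lemma nonneg_law_law_of:
  assumes "valid_fin_law vps"
  shows "nonneg_law (law_of vps)"
proof -
  have wf: "pmf_of_list_wf (real_pairs vps)" and nn: "\<forall>(v, p)\<in>set vps. 0 \<le> v"
    using assms by (auto simp: valid_fin_law_def)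
  have "0 \<le> v" if "v \<in> set_pmf (pmf_of_list (real_pairs vps))" for v
    using set_pmf_of_list[OF wf] that nn by (fastforce simp: zero_le_of_rat_iff)
  then have "AE v in measure_pmf (pmf_of_list (real_pairs vps)). 0 \<le> v"
    by (simp add: AE_measure_pmf_iff)
  then show ?thesis
    unfolding nonneg_law_def law_of_def
    by (auto simp: AE_distr_iff intro!: prob_space.prob_space_distr measure_pmf.prob_space_axioms)
qed

text \<open>A schedule lists indices with thresholds: the variables are inspected in this order and the
  first one whose value reaches its threshold is accepted. The last variable is accepted regardless
  of its threshold, which is never worse as values are nonnegative.\<close>

type_synonym schedule = "(nat \<times> rat) list"

definition schedule_policy :: "schedule \<Rightarrow> policy" where
  "schedule_policy sch h =
    (let k = length h in
     if k \<ge> length sch \<or> (k > 0 \<and> last_value h \<ge> of_rat (snd (sch ! (k - 1))))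
     then Stop else Inspect (fst (sch ! k)))"

lemma measurable_schedule_policy: "measurable_policy (schedule_policy sch)"
  unfolding measurable_policy_def
proof
  fix js :: "nat list"
  show "(\<lambda>x. schedule_policy sch (map (\<lambda>i. (i, x i)) js))
      \<in> (\<Pi>\<^sub>M i\<in>UNIV. (borel :: real measure)) \<rightarrow>\<^sub>M count_space UNIV"
    by (cases js) (simp_all add: schedule_policy_def last_value_def Let_def)
qed

lemma expected_reward_le_opt_free:
  "expected_reward D J (schedule_policy sch) \<le> opt_free D J"
  unfolding opt_free_def by (rule SUP_upper) (simp add: measurable_schedule_policy)

section \<open>Polynomial time\<close>

text \<open>Polynomial time is defined by a structured language over binary trees with integer leaves, with
  logarithmic cost: evaluating an expression costs the total bit size of all values that arise.
  As every value is charged by its full bit size (no sharing, no unit-cost arithmetic), this is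
  polynomially equivalent to Turing machine time.\<close>

datatype data = Atom int | Node data data

primrec bit_size :: "data \<Rightarrow> nat" where
  "bit_size (Atom k) = 1 + nat (bitlen \<bar>k\<bar>)"
| "bit_size (Node a b) = 1 + bit_size a + bit_size b"

primrec int_of :: "data \<Rightarrow> int" where
  "int_of (Atom k) = k"
| "int_of (Node a b) = 0"

datatype unop = Fst | Snd | Is_Atom

datatype binop = Plus | Minus | Times | Div | Less | Mk_Node

fun apply_unop :: "unop \<Rightarrow> data \<Rightarrow> data" where
  "apply_unop Fst (Node a b) = a"
| "apply_unop Fst (Atom k) = Atom 0"
| "apply_unop Snd (Node a b) = b"
| "apply_unop Snd (Atom k) = Atom 0"
| "apply_unop Is_Atom (Node a b) = Atom 0"
| "apply_unop Is_Atom (Atom k) = Atom 1"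

fun apply_binop :: "binop \<Rightarrow> data \<Rightarrow> data \<Rightarrow> data" where
  "apply_binop Plus a b = Atom (int_of a + int_of b)"
| "apply_binop Minus a b = Atom (int_of a - int_of b)"
| "apply_binop Times a b = Atom (int_of a * int_of b)"
| "apply_binop Div a b = Atom (int_of a div int_of b)"
| "apply_binop Less a b = Atom (if int_of a < int_of b then 1 else 0)"
| "apply_binop Mk_Node a b = Node a b"

datatype expr = Var nat | Lit int | Op1 unop expr | Op2 binop expr expr

type_synonym store = "nat \<Rightarrow> data"

primrec eval_expr :: "expr \<Rightarrow> store \<Rightarrow> data" where
  "eval_expr (Var r) s = s r"
| "eval_expr (Lit k) s = Atom k"
| "eval_expr (Op1 f e) s = apply_unop f (eval_expr e s)"
| "eval_expr (Op2 f e1 e2) s = apply_binop f (eval_expr e1 s) (eval_expr e2 s)"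

primrec expr_cost :: "expr \<Rightarrow> store \<Rightarrow> nat" where
  "expr_cost (Var r) s = bit_size (s r)"
| "expr_cost (Lit k) s = bit_size (Atom k)"
| "expr_cost (Op1 f e) s = expr_cost e s + bit_size (eval_expr (Op1 f e) s)"
| "expr_cost (Op2 f e1 e2) s =
     expr_cost e1 s + expr_cost e2 s + bit_size (eval_expr (Op2 f e1 e2) s)"

datatype com = Assign nat expr | Seq com com | If expr com com | While expr com

definition is_true :: "expr \<Rightarrow> store \<Rightarrow> bool" where
  "is_true e s \<longleftrightarrow> int_of (eval_expr e s) \<noteq> 0"

text \<open>\<open>exec c s t s'\<close>: started in store \<open>s\<close>, program \<open>c\<close> halts in store \<open>s'\<close> at cost \<open>t\<close>.\<close>

inductive exec :: "com \<Rightarrow> store \<Rightarrow> nat \<Rightarrow> store \<Rightarrow> bool" where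
  Assign: "exec (Assign r e) s (expr_cost e s) (s(r := eval_expr e s))"
| Seq: "exec c1 s t1 s1 \<Longrightarrow> exec c2 s1 t2 s2 \<Longrightarrow> exec (Seq c1 c2) s (t1 + t2) s2"
| If_True: "is_true e s \<Longrightarrow> exec c1 s t s1 \<Longrightarrow> exec (If e c1 c2) s (expr_cost e s + t) s1"
| If_False: "\<not> is_true e s \<Longrightarrow> exec c2 s t s1 \<Longrightarrow> exec (If e c1 c2) s (expr_cost e s + t) s1"
| While_True: "is_true e s \<Longrightarrow> exec c s t1 s1 \<Longrightarrow> exec (While e c) s1 t2 s2 \<Longrightarrow>
    exec (While e c) s (expr_cost e s + t1 + t2) s2"
| While_False: "\<not> is_true e s \<Longrightarrow> exec (While e c) s (expr_cost e s) s"

inductive_cases AssignE: "exec (Assign r e) s t s'"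
inductive_cases SeqE: "exec (Seq c1 c2) s t s'"
inductive_cases IfE: "exec (If e c1 c2) s t s'"
inductive_cases WhileE: "exec (While e c) s t s'"

lemma exec_deterministic:
  "exec c s t s1 \<Longrightarrow> exec c s t' s2 \<Longrightarrow> t = t' \<and> s1 = s2"
proof (induction arbitrary: t' s2 rule: exec.induct)
  case Assign
  then show ?case by (blast elim: AssignE)
next
  case Seq
  from Seq.prems show ?case by (elim SeqE) (metis Seq.IH)
next
  case (If_True e s c1 t s1 c2)
  from If_True.prems If_True.hyps(1) obtain u
    where "t' = expr_cost e s + u" "exec c1 s u s2" by (elim IfE) simp_all
  then show ?case using If_True.IH by blast
next
  case (If_False e s c2 t s1 c1)
  from If_False.prems If_False.hyps(1) obtain u
    where "t' = expr_cost e s + u" "exec c2 s u s2" by (elim IfE) simp_all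
  then show ?case using If_False.IH by blast
next
  case (While_True e s c t1 s1 t2 s3)
  from While_True.prems show ?case
  proof (rule WhileE)
    fix u1 s4 u2
    assume t': "t' = expr_cost e s + u1 + u2"
      and body: "exec c s u1 s4" and loop: "exec (While e c) s4 u2 s2"
    from While_True.IH(1)[OF body] have "u1 = t1" "s4 = s1" by simp_all
    with While_True.IH(2)[of u2 s2] loop t' show ?thesis by simp
  next
    assume "\<not> is_true e s"
    with While_True.hyps(1) show ?thesis by contradiction
  qed
next
  case (While_False e s c)
  from While_False.prems show ?case
  proof (rule WhileE)
    assume "is_true e s"
    with While_False.hyps show ?thesis by contradiction
  qed simp
qed

text \<open>The input is placed in register 0 and the output is read from it. The running time is bounded by
  a polynomial in the bit size of the encoded input.\<close>

definition poly_time_on :: "'a set \<Rightarrow> ('a \<Rightarrow> data) \<Rightarrow> ('b \<Rightarrow> data) \<Rightarrow> ('a \<Rightarrow> 'b) \<Rightarrow> bool" where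
  "poly_time_on A enc_in enc_out f \<longleftrightarrow>
    (\<exists>(c :: com) (p :: nat poly). \<forall>a\<in>A. \<exists>t s.
       exec c ((\<lambda>_. Atom 0)(0 := enc_in a)) t s \<and> s 0 = enc_out (f a) \<and>
       t \<le> poly p (bit_size (enc_in a)))"

definition enc_nat :: "nat \<Rightarrow> data" where
  "enc_nat n = Atom (int n)"

definition enc_rat :: "rat \<Rightarrow> data" where
  "enc_rat r = Node (Atom (fst (quotient_of r))) (Atom (snd (quotient_of r)))"

definition enc_prod :: "('a \<Rightarrow> data) \<Rightarrow> ('b \<Rightarrow> data) \<Rightarrow> 'a \<times> 'b \<Rightarrow> data" where
  "enc_prod f g = (\<lambda>(a, b). Node (f a) (g b))"

definition enc_list :: "('a \<Rightarrow> data) \<Rightarrow> 'a list \<Rightarrow> data" where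
  "enc_list f xs = foldr (\<lambda>x d. Node (f x) d) xs (Atom 0)"

definition enc_instance :: "fin_law list \<times> rat \<Rightarrow> data" where
  "enc_instance = enc_prod (enc_list (enc_list (enc_prod enc_rat enc_rat))) enc_rat"

definition enc_schedule :: "schedule \<Rightarrow> data" where
  "enc_schedule = enc_list (enc_prod enc_nat enc_rat)"

lemma inj_enc_nat: "inj enc_nat"
  by (auto simp: inj_def enc_nat_def)

lemma inj_enc_rat: "inj enc_rat"
  by (auto simp: inj_def enc_rat_def intro!: quotient_of_inject prod_eqI)

lemma inj_enc_prod: "inj f \<Longrightarrow> inj g \<Longrightarrow> inj (enc_prod f g)"
  by (auto simp: inj_def enc_prod_def)

lemma inj_enc_list:
  assumes "inj f"
  shows "inj (enc_list f)"
proof (rule injI)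
  fix xs ys assume "enc_list f xs = enc_list f ys"
  then show "xs = ys"
  proof (induction xs arbitrary: ys)
    case Nil
    then show ?case by (cases ys) (auto simp: enc_list_def)
  next
    case (Cons x xs)
    then show ?case using assms by (cases ys) (auto simp: enc_list_def dest: injD)
  qed
qed

lemma inj_enc_instance: "inj enc_instance"
  unfolding enc_instance_def by (intro inj_enc_prod inj_enc_list inj_enc_rat)

lemma inj_enc_schedule: "inj enc_schedule"
  unfolding enc_schedule_def by (intro inj_enc_prod inj_enc_list inj_enc_rat inj_enc_nat)

end

theory Submission
  imports Defs
begin

text \<open>Give every variable a random slot out of \<open>n\<close> and let the thresholds be the Euler iterates of
  \<open>W' = S W\<close>, where \<open>S w\<close> is the sum of the expected excesses over \<open>w\<close>. The reward is at least
  \<open>W n\<close> up to lower order terms as long as each variable is accepted with small probability, and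
  \<open>W n\<close> is at least \<open>kertz_const\<close> times the integral of \<open>1 - exp (S' x)\<close>, which is close to the
  expected maximum: bound \<open>exp\<close> below by tangents whose slopes \<open>y\<close> follow \<open>y' = c + y (1 - ln y)\<close> with
  \<open>c = 1 / kertz_const - 1\<close>, and the sum telescopes because this equation takes time exactly \<open>1\<close> to
  move from \<open>0\<close> to \<open>1\<close>.

  Acceptance probabilities are made small by only using the top \<open>\<delta>\<close> part of each law. What is lost is
  governed by the \<open>\<delta>\<close>-quantiles: it is negligible below a level with about \<open>ln (1/\<delta>) / \<delta>\<close> quantiles
  just below it. If no such level exists near the top, then the quantiles decay geometrically, and
  after removing about \<open>(ln (1/\<delta>) / \<delta>)\<^sup>2\<close> variables either the loss is negligible as well or a single
  removed variable, put back, dominates the rest.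

  The lower bound of the reward is multilinear in the choices of slot and threshold, so these can be
  made greedily, one variable at a time, which gives a polynomial-time algorithm.\<close>

text \<open>\<open>W k\<close> approximates the value of the game with \<open>k\<close> slots left:
  one more slot adds 1/n of the expected excess over the current value, which serves as the
  threshold. Slots are thus inspected from the largest to the smallest, at decreasing thresholds.
  The obstacle is a variable accepted with probability u bounded away from 0: only for small u do
  \<open>1 - u\<close> and \<open>exp (- u)\<close> agree up to a factor 1 + O(\<delta>) in the
  exponent. Why the removals bring all remaining quantiles below \<delta>^3 M, with M the largest
  one: the variable with quantile M has mean at least \<delta> M. If the Euler value W is at least
  \<delta>^2 M, then a loss of \<delta>^3 M is a \<delta>-fraction of W; otherwise W itself is at
  most a \<delta>-fraction of that mean. Lowering the quantiles by \<delta>^3 takes about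
  ln(1/\<delta>)/\<delta> steps by the factor 1 - \<delta>, and each step costs about
  ln(1/\<delta>)/\<delta> variables. The algorithm compares exact values: every quantity is an
  integer over a common denominator. The price is a proof that the iterated fractions keep
  polynomial length.\<close>

abbreviation fs :: "data \<Rightarrow> data" where
  "fs \<equiv> apply_unop Fst"

abbreviation sn :: "data \<Rightarrow> data" where
  "sn \<equiv> apply_unop Snd"

subsection \<open>Sizes\<close>

abbreviation isz :: "int \<Rightarrow> nat" where
  "isz k \<equiv> bit_size (Atom k)"

lemma isz_le:
  assumes "\<bar>k\<bar> < 2 ^ m"
  shows "isz k \<le> 1 + m"
  using assms by (simp add: bitlen_le_iff_power nat_le_iff)

lemma abs_less_isz: "\<bar>k\<bar> < 2 ^ (isz k - 1)"
proof (cases "k = 0")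
  case False
  then show ?thesis using bitlen_bounds[of "\<bar>k\<bar>"] by simp
qed simp

lemma isz_mono:
  assumes "\<bar>a\<bar> \<le> \<bar>b\<bar>"
  shows "isz a \<le> isz b"
proof -
  have "isz a \<le> 1 + (isz b - 1)"
    using assms abs_less_isz[of b] by (intro isz_le) linarith
  then show ?thesis by simp
qed

lemma isz_pos: "0 < isz k"
  by simp

text \<open>Each size contains a constant 1, and the second one pays for the carry bit.\<close>

lemma isz_add: "isz (a + b) \<le> isz a + isz b"
proof (cases "a = 0 \<or> b = 0")
  case False
  then have "isz a \<ge> 2" "isz b \<ge> 2"
    using abs_less_isz[of a] abs_less_isz[of b]
    by (metis One_nat_def Suc_1 Suc_leI abs_less_iff diff_is_0_eq' less_one linorder_not_less
        not_less_eq_eq power_0 zero_less_abs_iff int_one_le_iff_zero_less leD)+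
  then obtain p q where p: "isz a = p + 2" and q: "isz b = q + 2"
    by (metis add.commute le_Suc_ex)
  have "\<bar>a\<bar> < 2 ^ (p + 1)" "\<bar>b\<bar> < 2 ^ (q + 1)"
    using abs_less_isz[of a] abs_less_isz[of b] p q by simp_all
  moreover have "(2::int) ^ (p + 1) \<le> 2 ^ (p + q + 1)" "(2::int) ^ (q + 1) \<le> 2 ^ (p + q + 1)"
    by (intro power_increasing; simp)+
  moreover have "(2::int) ^ (p + q + 2) = 2 ^ (p + q + 1) + 2 ^ (p + q + 1)"
    by simp
  ultimately have "\<bar>a + b\<bar> < 2 ^ (p + q + 2)"
    by linarith
  from isz_le[OF this] p q show ?thesis by simp
qed auto

lemma isz_minus [simp]: "isz (- a) = isz a"
  by simp

lemma isz_diff: "isz (a - b) \<le> isz a + isz b"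
  using isz_add[of a "- b"] by simp

lemma isz_mult: "isz (a * b) \<le> isz a + isz b"
proof -
  have "\<bar>a * b\<bar> < 2 ^ (isz a - 1) * 2 ^ (isz b - 1)"
    unfolding abs_mult
    using abs_less_isz[of a] abs_less_isz[of b] by (intro mult_strict_mono') auto
  then have "\<bar>a * b\<bar> < 2 ^ ((isz a - 1) + (isz b - 1))"
    by (simp add: power_add)
  from isz_le[OF this] isz_pos[of a] isz_pos[of b] show ?thesis by linarith
qed

lemma abs_div_le: "\<bar>a div b\<bar> \<le> \<bar>a :: int\<bar>"
proof (cases "b = 0")
  case False
  have "\<bar>a div b\<bar> \<le> \<bar>a\<bar>" if "b > 0" for a b :: int
  proof (cases "a \<ge> 0")
    case True
    have "a div b \<le> a" using zdiv_mono2[of a 1 b] that True by simp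
    then show ?thesis using True that by (simp add: pos_imp_zdiv_nonneg_iff)
  next
    case F: False
    have "a div b \<ge> a" using zdiv_mono2_neg[of a 1 b] that F by simp
    moreover have "a div b < 0" using F that by (simp add: pos_imp_zdiv_neg_iff)
    ultimately show ?thesis by simp
  qed
  note * = this
  show ?thesis
    using *[of b a] *[of "- b" "- a"] False by (cases "b > 0") (auto simp: div_minus_minus)
qed simp

lemma isz_div: "isz (a div b) \<le> isz a"
  using isz_mono[OF abs_div_le] .

lemma isz_int_of: "isz (int_of d) \<le> bit_size d"
  by (cases d) simp_all

lemma bit_size_pos: "0 < bit_size d"
  by (cases d) simp_all

text \<open>A single power with a base of at least 2 stands in for a polynomial: constants, sums and
  products are absorbed by raising the exponent, and monotonicity in \<open>s\<close> allows bounds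
  to be composed.\<close>

definition pbounded :: "(nat \<Rightarrow> nat) \<Rightarrow> bool" where
  "pbounded f \<longleftrightarrow> (\<exists>d. \<forall>s. f s \<le> (s + 2) ^ d)"

named_theorems pbounded_intros

lemma pbounded_const [pbounded_intros]: "pbounded (\<lambda>_. c)"
proof -
  have "c \<le> (s + 2) ^ c" for s
  proof -
    have "c \<le> 2 ^ c" by (rule less_imp_le[OF less_exp])
    also have "\<dots> \<le> (s + 2) ^ c" by (rule power_mono) auto
    finally show ?thesis .
  qed
  then show ?thesis unfolding pbounded_def by blast
qed

lemma pbounded_id [pbounded_intros]: "pbounded (\<lambda>s. s)"
  unfolding pbounded_def by (rule exI[of _ 1]) simp

lemma pbounded_add [pbounded_intros]:
  assumes "pbounded f" "pbounded g"
  shows "pbounded (\<lambda>s. f s + g s)"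
proof -
  obtain a b where a: "\<And>s. f s \<le> (s + 2) ^ a" and b: "\<And>s. g s \<le> (s + 2) ^ b"
    using assms unfolding pbounded_def by metis
  have "f s + g s \<le> (s + 2) ^ (max a b + 1)" for s
  proof -
    have "f s \<le> (s + 2) ^ max a b" "g s \<le> (s + 2) ^ max a b"
      by (rule order_trans[OF a] order_trans[OF b], rule power_increasing; simp)+
    then have "f s + g s \<le> 2 * (s + 2) ^ max a b" by simp
    also have "\<dots> \<le> (s + 2) * (s + 2) ^ max a b" by (intro mult_right_mono) auto
    finally show ?thesis by simp
  qed
  then show ?thesis unfolding pbounded_def by blast
qed

lemma pbounded_mult [pbounded_intros]:
  assumes "pbounded f" "pbounded g"
  shows "pbounded (\<lambda>s. f s * g s)"
proof -
  obtain a b where a: "\<And>s. f s \<le> (s + 2) ^ a" and b: "\<And>s. g s \<le> (s + 2) ^ b"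
    using assms unfolding pbounded_def by metis
  have "f s * g s \<le> (s + 2) ^ (a + b)" for s
    using mult_mono[OF a b] by (simp add: power_add)
  then show ?thesis unfolding pbounded_def by blast
qed

lemma pbounded_power [pbounded_intros]:
  assumes "pbounded f"
  shows "pbounded (\<lambda>s. f s ^ k)"
proof -
  obtain a where a: "\<And>s. f s \<le> (s + 2) ^ a"
    using assms unfolding pbounded_def by metis
  have "f s ^ k \<le> (s + 2) ^ (a * k)" for s
    using power_mono[OF a, of s k] by (simp add: power_mult)
  then show ?thesis unfolding pbounded_def by blast
qed

lemma pbounded_Suc [pbounded_intros]: "pbounded f \<Longrightarrow> pbounded (\<lambda>s. Suc (f s))"
  using pbounded_add[OF _ pbounded_const[of 1], of f] by simp

subsection \<open>A calculus of polynomial-time functions\<close>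

text \<open>The registers from \<open>m\<close> on are preserved, so that programs can be combined by keeping
  intermediate values there. The bound on the size of the result is needed for composition.\<close>

definition ptime_by :: "com \<Rightarrow> nat \<Rightarrow> nat \<Rightarrow> (data \<Rightarrow> data) \<Rightarrow> bool" where
  "ptime_by c m d f \<longleftrightarrow> (\<forall>s. \<exists>t s'. exec c s t s' \<and> s' 0 = f (s 0) \<and> (\<forall>r\<ge>m. s' r = s r) \<and>
     t \<le> (bit_size (s 0) + 2) ^ d \<and> bit_size (f (s 0)) \<le> (bit_size (s 0) + 2) ^ d)"

definition ptime :: "(data \<Rightarrow> data) \<Rightarrow> bool" where
  "ptime f \<longleftrightarrow> (\<exists>c m d. ptime_by c m d f)"

lemma ptimeI:
  assumes "\<And>s. \<exists>t s'. exec c s t s' \<and> s' 0 = f (s 0) \<and> (\<forall>r\<ge>m. s' r = s r) \<and> t \<le> T (bit_size (s 0))"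
    and "\<And>x. bit_size (f x) \<le> Z (bit_size x)" and "pbounded T" "pbounded Z"
  shows "ptime f"
proof -
  obtain d where d: "\<And>s. T s + Z s \<le> (s + 2) ^ d"
    using pbounded_add[OF assms(3,4)] unfolding pbounded_def by blast
  have "ptime_by c m d f"
    unfolding ptime_by_def
  proof
    fix s
    obtain t s' where "exec c s t s'" "s' 0 = f (s 0)" "\<forall>r\<ge>m. s' r = s r" "t \<le> T (bit_size (s 0))"
      using assms(1) by blast
    moreover have "T (bit_size (s 0)) \<le> (bit_size (s 0) + 2) ^ d"
        "bit_size (f (s 0)) \<le> (bit_size (s 0) + 2) ^ d"
      using d[of "bit_size (s 0)"] assms(2)[of "s 0"] by linarith+
    ultimately show "\<exists>t s'. exec c s t s' \<and> s' 0 = f (s 0) \<and> (\<forall>r\<ge>m. s' r = s r) \<and>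
      t \<le> (bit_size (s 0) + 2) ^ d \<and> bit_size (f (s 0)) \<le> (bit_size (s 0) + 2) ^ d"
      by (meson le_trans)
  qed
  then show ?thesis unfolding ptime_def by blast
qed

lemma ptimeE:
  assumes "ptime f"
  obtains c m d where "0 < m"
    and "\<And>s. \<exists>t s'. exec c s t s' \<and> s' 0 = f (s 0) \<and> (\<forall>r\<ge>m. s' r = s r) \<and> t \<le> (bit_size (s 0) + 2) ^ d"
    and "\<And>x. bit_size (f x) \<le> (bit_size x + 2) ^ d"
proof -
  obtain c m d where *: "ptime_by c m d f"
    using assms unfolding ptime_def by blast
  \<comment> \<open>The register bound is raised by one, so that register \<open>m\<close> is never
    register 0 and can hold saved values.\<close>
  show thesis
  proof (rule that[of "Suc m" c d])
    show "\<exists>t s'. exec c s t s' \<and> s' 0 = f (s 0) \<and> (\<forall>r\<ge>Suc m. s' r = s r) \<and> t \<le> (bit_size (s 0) + 2) ^ d" for s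
      using *[unfolded ptime_by_def, rule_format, of s] by (meson Suc_leD)
    show "bit_size (f x) \<le> (bit_size x + 2) ^ d" for x
      using *[unfolded ptime_by_def, rule_format, of "\<lambda>_. x"] by blast
  qed simp
qed

lemma ptime_size:
  assumes "ptime f"
  obtains d where "\<And>x. bit_size (f x) \<le> (bit_size x + 2) ^ d"
  using assms by (elim ptimeE) blast

lemma ptime_assign:
  assumes "\<And>s. eval_expr e s = f (s 0)" "\<And>s. expr_cost e s \<le> T (bit_size (s 0))"
    and "\<And>x. bit_size (f x) \<le> Z (bit_size x)" "pbounded T" "pbounded Z"
  shows "ptime f"
proof (rule ptimeI[OF _ assms(3,4,5)])
  fix s
  have "exec (Assign 0 e) s (expr_cost e s) (s(0 := eval_expr e s))"
    by (rule exec.Assign)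
  then show "\<exists>t s'. exec (Assign 0 e) s t s' \<and> s' 0 = f (s 0) \<and> (\<forall>r\<ge>1. s' r = s r) \<and> t \<le> T (bit_size (s 0))"
    using assms(1,2)[of s] by (intro exI[of _ "expr_cost e s"] exI[of _ "s(0 := eval_expr e s)"]) auto
qed

named_theorems ptime_intros

lemma ptime_id [ptime_intros]: "ptime (\<lambda>x. x)"
  by (rule ptime_assign[of "Var 0" _ "\<lambda>s. s" "\<lambda>s. s"]) (auto intro: pbounded_intros)

lemma ptime_Atom [ptime_intros]: "ptime (\<lambda>_. Atom k)"
  by (rule ptime_assign[of "Lit k" _ "\<lambda>s. isz k" "\<lambda>s. isz k"]) (auto intro: pbounded_intros)

lemma bit_size_unop: "bit_size (apply_unop u d) \<le> bit_size d + 2"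
  by (cases "(u, d)" rule: apply_unop.cases) (auto simp: bitlen_alt_def)

lemma ptime_unop_base: "ptime (apply_unop u)"
  by (rule ptime_assign[of "Op1 u (Var 0)" _ "\<lambda>s. 2 * s + 2" "\<lambda>s. s + 2"])
     (use bit_size_unop in \<open>auto intro!: pbounded_intros simp: mult_2\<close>)

lemma bit_size_binop: "bit_size (apply_binop b x y) \<le> bit_size x + bit_size y + 2"
proof -
  have 1: "isz 1 \<le> 2" using isz_le[of 1 1] by simp
  show ?thesis
    using isz_add[of "int_of x" "int_of y"] isz_diff[of "int_of x" "int_of y"] isz_mult[of "int_of x" "int_of y"]
      isz_div[of "int_of x" "int_of y"] isz_int_of[of x] isz_int_of[of y] 1 bit_size_pos[of x] isz_le[of 0 0]
    by (cases b) (auto simp del: bit_size.simps(1))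
qed

text \<open>Functions have one argument throughout; several arguments are passed as nested
  pairs.\<close>

lemma ptime_binop_base: "ptime (\<lambda>x. apply_binop b (fs x) (sn x))"
proof (rule ptime_assign[of "Op2 b (Op1 Fst (Var 0)) (Op1 Snd (Var 0))" _ "\<lambda>s. 6 * s + 20" "\<lambda>s. 2 * s + 6"])
  have *: "bit_size (apply_binop b (fs x) (sn x)) \<le> 2 * bit_size x + 6" for x
    using bit_size_binop[of b "fs x" "sn x"]
      bit_size_unop[of Fst x] bit_size_unop[of Snd x] by linarith
  then show "bit_size (apply_binop b (fs x) (sn x)) \<le> 2 * bit_size x + 6" for x .
  show "expr_cost (Op2 b (Op1 Fst (Var 0)) (Op1 Snd (Var 0))) s \<le> 6 * bit_size (s 0) + 20" for s
    using *[of "s 0"] bit_size_unop[of Fst "s 0"] bit_size_unop[of Snd "s 0"] by simp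
qed (auto intro!: pbounded_intros)

lemma ptime_comp:
  assumes "ptime f" "ptime g"
  shows "ptime (\<lambda>x. f (g x))"
proof -
  obtain c1 m1 d1 where p1: "0 < m1" and 1: "\<And>s. \<exists>t s'. exec c1 s t s' \<and> s' 0 = f (s 0) \<and> (\<forall>r\<ge>m1. s' r = s r) \<and> t \<le> (bit_size (s 0) + 2) ^ d1"
    and s1: "\<And>x. bit_size (f x) \<le> (bit_size x + 2) ^ d1"
    by (rule ptimeE[OF assms(1)], erule that, assumption+)
  obtain c2 m2 d2 where p2: "0 < m2" and 2: "\<And>s. \<exists>t s'. exec c2 s t s' \<and> s' 0 = g (s 0) \<and> (\<forall>r\<ge>m2. s' r = s r) \<and> t \<le> (bit_size (s 0) + 2) ^ d2"
    and s2: "\<And>x. bit_size (g x) \<le> (bit_size x + 2) ^ d2"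
    by (rule ptimeE[OF assms(2)], erule that, assumption+)
  show ?thesis
  proof (rule ptimeI[of "Seq c2 c1" _ "max m1 m2" "\<lambda>s. (s + 2) ^ d2 + ((s + 2) ^ d2 + 2) ^ d1" "\<lambda>s. ((s + 2) ^ d2 + 2) ^ d1"])
    fix s
    obtain t s' where a: "exec c2 s t s'" "s' 0 = g (s 0)" "\<forall>r\<ge>m2. s' r = s r" "t \<le> (bit_size (s 0) + 2) ^ d2"
      using 2 by blast
    obtain t' s'' where b: "exec c1 s' t' s''" "s'' 0 = f (s' 0)" "\<forall>r\<ge>m1. s'' r = s' r" "t' \<le> (bit_size (s' 0) + 2) ^ d1"
      using 1 by blast
    have "(bit_size (s' 0) + 2) ^ d1 \<le> ((bit_size (s 0) + 2) ^ d2 + 2) ^ d1"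
      using a(2) s2[of "s 0"] by (intro power_mono) auto
    then show "\<exists>t s'. exec (Seq c2 c1) s t s' \<and> s' 0 = f (g (s 0)) \<and> (\<forall>r\<ge>max m1 m2. s' r = s r) \<and>
       t \<le> (bit_size (s 0) + 2) ^ d2 + ((bit_size (s 0) + 2) ^ d2 + 2) ^ d1"
      using a b exec.Seq[OF a(1) b(1)]
      by (intro exI[of _ "t + t'"] exI[of _ s'']) auto
  next
    fix x
    have "bit_size (f (g x)) \<le> (bit_size (g x) + 2) ^ d1" by (rule s1)
    also have "\<dots> \<le> ((bit_size x + 2) ^ d2 + 2) ^ d1"
      using s2[of x] by (intro power_mono) auto
    finally show "bit_size (f (g x)) \<le> ((bit_size x + 2) ^ d2 + 2) ^ d1" .
  qed (intro pbounded_intros)+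
qed

text \<open>The input has to survive the first program and the first result the second one: they are
  kept in registers \<open>m\<close> and \<open>m + 1\<close>, which neither program
  touches.\<close>

lemma ptime_Node [ptime_intros]:
  assumes "ptime f" "ptime g"
  shows "ptime (\<lambda>x. Node (f x) (g x))"
proof -
  obtain c1 m1 d1 where p1: "0 < m1" and 1: "\<And>s. \<exists>t s'. exec c1 s t s' \<and> s' 0 = f (s 0) \<and> (\<forall>r\<ge>m1. s' r = s r) \<and> t \<le> (bit_size (s 0) + 2) ^ d1"
    and s1: "\<And>x. bit_size (f x) \<le> (bit_size x + 2) ^ d1"
    by (rule ptimeE[OF assms(1)], erule that, assumption+)
  obtain c2 m2 d2 where p2: "0 < m2" and 2: "\<And>s. \<exists>t s'. exec c2 s t s' \<and> s' 0 = g (s 0) \<and> (\<forall>r\<ge>m2. s' r = s r) \<and> t \<le> (bit_size (s 0) + 2) ^ d2"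
    and s2: "\<And>x. bit_size (g x) \<le> (bit_size x + 2) ^ d2"
    by (rule ptimeE[OF assms(2)], erule that, assumption+)
  define m where "m = max m1 m2"
  have m: "m1 \<le> m" "m2 \<le> m" "0 < m" using p2 by (auto simp: m_def)
  define e where "e = Op2 Mk_Node (Var (m + 1)) (Var 0)"
  define c where "c = Seq (Assign m (Var 0)) (Seq c1 (Seq (Assign (m + 1) (Var 0)) (Seq (Assign 0 (Var m)) (Seq c2 (Assign 0 e)))))"
  show ?thesis
  proof (rule ptimeI[of c _ "m + 2" "\<lambda>s. 2 * s + 4 * (s + 2) ^ d1 + 4 * (s + 2) ^ d2 + 1" "\<lambda>s. 1 + (s + 2) ^ d1 + (s + 2) ^ d2"])
    fix s :: store
    let ?z = "bit_size (s 0)"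
    define s0 where "s0 = s(m := s 0)"
    have e0: "exec (Assign m (Var 0)) s ?z s0"
      using exec.Assign[of m "Var 0" s] by (simp add: s0_def)
    obtain t1 s1' where a: "exec c1 s0 t1 s1'" "s1' 0 = f (s0 0)" "\<forall>r\<ge>m1. s1' r = s0 r" "t1 \<le> (bit_size (s0 0) + 2) ^ d1"
      using 1 by blast
    define s2' where "s2' = s1'(m + 1 := s1' 0)"
    have e1: "exec (Assign (m + 1) (Var 0)) s1' (bit_size (s1' 0)) s2'"
      using exec.Assign[of "m + 1" "Var 0" s1'] by (simp add: s2'_def)
    define s3 where "s3 = s2'(0 := s2' m)"
    have e2: "exec (Assign 0 (Var m)) s2' (bit_size (s2' m)) s3"
      using exec.Assign[of 0 "Var m" s2'] by (simp add: s3_def)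
    obtain t2 s4 where b: "exec c2 s3 t2 s4" "s4 0 = g (s3 0)" "\<forall>r\<ge>m2. s4 r = s3 r" "t2 \<le> (bit_size (s3 0) + 2) ^ d2"
      using 2 by blast
    have e3: "exec (Assign 0 e) s4 (expr_cost e s4) (s4(0 := eval_expr e s4))"
      by (rule exec.Assign)
    have z: "s0 0 = s 0" "s1' m = s 0" "s2' m = s 0" "s3 0 = s 0" "s4 (m + 1) = f (s 0)" "s4 0 = g (s 0)"
      using a b m by (auto simp: s0_def s2'_def s3_def)
    have "exec c s (?z + (t1 + (bit_size (s1' 0) + (bit_size (s2' m) + (t2 + expr_cost e s4))))) (s4(0 := eval_expr e s4))"
      unfolding c_def by (intro exec.Seq[OF e0] exec.Seq[OF a(1)] exec.Seq[OF e1] exec.Seq[OF e2] exec.Seq[OF b(1)] e3)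
    moreover have "?z + (t1 + (bit_size (s1' 0) + (bit_size (s2' m) + (t2 + expr_cost e s4))))
        \<le> 2 * ?z + 4 * (?z + 2) ^ d1 + 4 * (?z + 2) ^ d2 + 1"
      using a b z s1[of "s 0"] s2[of "s 0"] by (simp add: e_def)
    moreover have "(s4(0 := eval_expr e s4)) 0 = Node (f (s 0)) (g (s 0))"
      using z by (simp add: e_def)
    moreover have "\<forall>r\<ge>m + 2. (s4(0 := eval_expr e s4)) r = s r"
      using a b m by (auto simp: s0_def s2'_def s3_def)
    ultimately show "\<exists>t s'. exec c s t s' \<and> s' 0 = Node (f (s 0)) (g (s 0)) \<and> (\<forall>r\<ge>m + 2. s' r = s r) \<and>
        t \<le> 2 * ?z + 4 * (?z + 2) ^ d1 + 4 * (?z + 2) ^ d2 + 1"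
      by blast
  next
    show "bit_size (Node (f x) (g x)) \<le> 1 + (bit_size x + 2) ^ d1 + (bit_size x + 2) ^ d2" for x
      using s1[of x] s2[of x] by simp
  qed (intro pbounded_intros)+
qed

lemma ptime_unop [ptime_intros]: "ptime f \<Longrightarrow> ptime (\<lambda>x. apply_unop u (f x))"
  by (rule ptime_comp[OF ptime_unop_base])

lemma ptime_binop:
  assumes "ptime f" "ptime g"
  shows "ptime (\<lambda>x. apply_binop b (f x) (g x))"
  using ptime_comp[OF ptime_binop_base[of b] ptime_Node[OF assms]] by simp

section \<open>Integer arithmetic, decisions and branching\<close>

definition pint :: "(data \<Rightarrow> int) \<Rightarrow> bool" where
  "pint f \<longleftrightarrow> ptime (\<lambda>x. Atom (f x))"

definition pdec :: "(data \<Rightarrow> bool) \<Rightarrow> bool" where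
  "pdec P \<longleftrightarrow> ptime (\<lambda>x. Atom (if P x then 1 else 0))"

lemma ptime_pint [ptime_intros]: "pint f \<Longrightarrow> ptime (\<lambda>x. Atom (f x))"
  by (simp add: pint_def)

lemma pint_int_of [ptime_intros]: "ptime f \<Longrightarrow> pint (\<lambda>x. int_of (f x))"
  using ptime_binop[of f "\<lambda>_. Atom 0" Plus] by (simp add: pint_def ptime_Atom)

lemma pint_const [ptime_intros]: "pint (\<lambda>_. k)"
  by (simp add: pint_def ptime_Atom)

lemma pint_arith [ptime_intros]:
  assumes "pint f" "pint g"
  shows "pint (\<lambda>x. f x + g x)" "pint (\<lambda>x. f x - g x)" "pint (\<lambda>x. f x * g x)" "pint (\<lambda>x. f x div g x)"
  using ptime_binop[OF assms[unfolded pint_def], of Plus] ptime_binop[OF assms[unfolded pint_def], of Minus]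
    ptime_binop[OF assms[unfolded pint_def], of Times] ptime_binop[OF assms[unfolded pint_def], of Div]
  by (simp_all add: pint_def)

lemma pint_uminus [ptime_intros]: "pint f \<Longrightarrow> pint (\<lambda>x. - f x)"
  using pint_arith(2)[OF pint_const[of 0]] by simp

lemma pdec_less [ptime_intros]:
  assumes "pint f" "pint g"
  shows "pdec (\<lambda>x. f x < g x)"
  using ptime_binop[OF assms[unfolded pint_def], of Less] by (simp add: pdec_def)

lemma ptime_if [ptime_intros]:
  assumes "pdec P" "ptime f" "ptime g"
  shows "ptime (\<lambda>x. if P x then f x else g x)"
proof -
  obtain c1 m1 d1 where p1: "0 < m1" and 1: "\<And>s. \<exists>t s'. exec c1 s t s' \<and> s' 0 = Atom (if P (s 0) then 1 else 0) \<and> (\<forall>r\<ge>m1. s' r = s r) \<and> t \<le> (bit_size (s 0) + 2) ^ d1"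
    by (rule ptimeE[OF assms(1)[unfolded pdec_def]], erule that, assumption+)
  obtain c2 m2 d2 where p2: "0 < m2" and 2: "\<And>s. \<exists>t s'. exec c2 s t s' \<and> s' 0 = f (s 0) \<and> (\<forall>r\<ge>m2. s' r = s r) \<and> t \<le> (bit_size (s 0) + 2) ^ d2"
    and s2: "\<And>x. bit_size (f x) \<le> (bit_size x + 2) ^ d2"
    by (rule ptimeE[OF assms(2)], erule that, assumption+)
  obtain c3 m3 d3 where p3: "0 < m3" and 3: "\<And>s. \<exists>t s'. exec c3 s t s' \<and> s' 0 = g (s 0) \<and> (\<forall>r\<ge>m3. s' r = s r) \<and> t \<le> (bit_size (s 0) + 2) ^ d3"
    and s3: "\<And>x. bit_size (g x) \<le> (bit_size x + 2) ^ d3"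
    by (rule ptimeE[OF assms(3)], erule that, assumption+)
  define m where "m = max m1 (max m2 m3)"
  have m: "m1 \<le> m" "m2 \<le> m" "m3 \<le> m" "0 < m" using p1 by (auto simp: m_def)
  define c where "c = Seq (Assign m (Var 0)) (Seq c1 (Seq (Assign (m + 1) (Var 0)) (Seq (Assign 0 (Var m))
    (If (Var (m + 1)) c2 c3))))"
  show ?thesis
  proof (rule ptimeI[of c _ "m + 2" "\<lambda>s. 2 * s + (s + 2) ^ d1 + 4 + (s + 2) ^ d2 + (s + 2) ^ d3" "\<lambda>s. (s + 2) ^ d2 + (s + 2) ^ d3"])
    fix s :: store
    let ?z = "bit_size (s 0)"
    define s0 where "s0 = s(m := s 0)"
    have e0: "exec (Assign m (Var 0)) s ?z s0"
      using exec.Assign[of m "Var 0" s] by (simp add: s0_def)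
    obtain t1 s1' where a: "exec c1 s0 t1 s1'" "s1' 0 = Atom (if P (s0 0) then 1 else 0)" "\<forall>r\<ge>m1. s1' r = s0 r" "t1 \<le> (bit_size (s0 0) + 2) ^ d1"
      using 1 by blast
    define s2' where "s2' = s1'(m + 1 := s1' 0)"
    have e1: "exec (Assign (m + 1) (Var 0)) s1' (bit_size (s1' 0)) s2'"
      using exec.Assign[of "m + 1" "Var 0" s1'] by (simp add: s2'_def)
    define s3' where "s3' = s2'(0 := s2' m)"
    have e2: "exec (Assign 0 (Var m)) s2' (bit_size (s2' m)) s3'"
      using exec.Assign[of 0 "Var m" s2'] by (simp add: s3'_def)
    have z: "s0 0 = s 0" "s1' m = s 0" "s2' m = s 0" "s3' 0 = s 0" "s3' (m + 1) = Atom (if P (s 0) then 1 else 0)"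
      using a m by (auto simp: s0_def s2'_def s3'_def)
    have u: "isz (if P (s 0) then 1 else 0) \<le> 2" using isz_le[of 1 1] by auto
    obtain t4 s4 where b: "exec (If (Var (m + 1)) c2 c3) s3' t4 s4" "s4 0 = (if P (s 0) then f (s 0) else g (s 0))"
      "\<forall>r\<ge>m. s4 r = s3' r" "t4 \<le> 2 + (?z + 2) ^ d2 + (?z + 2) ^ d3"
    proof (cases "P (s 0)")
      case True
      obtain t s' where q: "exec c2 s3' t s'" "s' 0 = f (s3' 0)" "\<forall>r\<ge>m2. s' r = s3' r" "t \<le> (bit_size (s3' 0) + 2) ^ d2"
        using 2 by blast
      show thesis
        using that[OF exec.If_True[OF _ q(1)]] q z u True m by (simp add: is_true_def)
    next
      case False
      obtain t s' where q: "exec c3 s3' t s'" "s' 0 = g (s3' 0)" "\<forall>r\<ge>m3. s' r = s3' r" "t \<le> (bit_size (s3' 0) + 2) ^ d3"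
        using 3 by blast
      show thesis
        using that[OF exec.If_False[OF _ q(1)]] q z u False m by (simp add: is_true_def)
    qed
    have "exec c s (?z + (t1 + (bit_size (s1' 0) + (bit_size (s2' m) + t4)))) s4"
      unfolding c_def by (intro exec.Seq[OF e0] exec.Seq[OF a(1)] exec.Seq[OF e1] exec.Seq[OF e2] b(1))
    moreover have "?z + (t1 + (bit_size (s1' 0) + (bit_size (s2' m) + t4)))
        \<le> 2 * ?z + (?z + 2) ^ d1 + 4 + (?z + 2) ^ d2 + (?z + 2) ^ d3"
      using a b z u by (simp del: bit_size.simps(1))
    moreover have "\<forall>r\<ge>m + 2. s4 r = s r"
      using a b m by (auto simp: s0_def s2'_def s3'_def)
    ultimately show "\<exists>t s'. exec c s t s' \<and> s' 0 = (if P (s 0) then f (s 0) else g (s 0)) \<and> (\<forall>r\<ge>m + 2. s' r = s r) \<and>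
        t \<le> 2 * ?z + (?z + 2) ^ d1 + 4 + (?z + 2) ^ d2 + (?z + 2) ^ d3"
      using b(2) by blast
  next
    show "bit_size (if P x then f x else g x) \<le> (bit_size x + 2) ^ d2 + (bit_size x + 2) ^ d3" for x
      using s2[of x] s3[of x] by simp
  qed (intro pbounded_intros)+
qed

lemma pint_if [ptime_intros]:
  assumes "pdec P" "pint f" "pint g"
  shows "pint (\<lambda>x. if P x then f x else g x)"
  using ptime_if[OF assms(1) assms(2,3)[unfolded pint_def]] by (simp add: pint_def if_distrib)

lemma pdec_not [ptime_intros]:
  assumes "pdec P"
  shows "pdec (\<lambda>x. \<not> P x)"
proof -
  have "(\<lambda>x. Atom (if \<not> P x then 1 else 0)) = (\<lambda>x. Atom (if P x then 0 else 1))"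
    by auto
  then show ?thesis
    using pint_if[OF assms pint_const pint_const, of 0 1] by (simp add: pint_def pdec_def)
qed

lemma pdec_conj [ptime_intros]:
  assumes "pdec P" "pdec Q"
  shows "pdec (\<lambda>x. P x \<and> Q x)"
proof -
  have "(\<lambda>x. Atom (if P x \<and> Q x then 1 else 0)) = (\<lambda>x. if P x then Atom (if Q x then 1 else 0) else Atom 0)"
    by auto
  then show ?thesis
    using ptime_if[OF assms(1) assms(2)[unfolded pdec_def] ptime_Atom[of 0]] by (simp add: pdec_def)
qed

lemma pdec_le [ptime_intros]:
  assumes "pint f" "pint g"
  shows "pdec (\<lambda>x. f x \<le> g x)"
  using pdec_not[OF pdec_less[OF assms(2,1)]] by (simp add: not_less)

lemma pdec_eq [ptime_intros]:
  assumes "pint f" "pint g"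
  shows "pdec (\<lambda>x. f x = g x)"
  using pdec_conj[OF pdec_le[OF assms] pdec_le[OF assms(2,1)]] by (simp add: order_eq_iff)

lemma pint_max [ptime_intros]:
  assumes "pint f" "pint g"
  shows "pint (\<lambda>x. max (f x) (g x))"
  unfolding max_def using assms by (intro ptime_intros)

section \<open>Lists and loops over lists\<close>

primrec to_list :: "data \<Rightarrow> data list" where
  "to_list (Atom k) = []"
| "to_list (Node a b) = a # to_list b"

abbreviation of_list :: "data list \<Rightarrow> data" where
  "of_list xs \<equiv> enc_list (\<lambda>x. x) xs"

lemma of_list_simps [simp]:
  "of_list [] = Atom 0" "of_list (x # xs) = Node x (of_list xs)"
  by (simp_all add: enc_list_def)

lemma to_list_of_list [simp]: "to_list (of_list xs) = xs"
  by (induction xs) simp_all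

lemma enc_list_eq: "enc_list f xs = of_list (map f xs)"
  by (induction xs) (simp_all add: enc_list_def)

lemma bit_size_of_list: "bit_size (of_list xs) = 1 + length xs + (\<Sum>x\<leftarrow>xs. bit_size x)"
  by (induction xs) simp_all

lemma bit_size_to_list: "length (to_list l) + (\<Sum>x\<leftarrow>to_list l. bit_size x) < bit_size l"
  by (induction l) simp_all

lemma bit_size_to_list_nth: "h \<in> set (to_list l) \<Longrightarrow> bit_size h < bit_size l"
  by (induction l) auto

text \<open>Register \<open>m\<close> holds the fixed parameter, \<open>m + 1\<close> the rest of
  the list and \<open>m + 2\<close> the accumulator; the loop runs until the rest is an atom. The
  bound \<open>Z\<close> on all intermediate accumulators gives every round the same cost
  bound.\<close>

lemma while_fold:
  fixes f :: "data \<Rightarrow> data \<Rightarrow> data"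
  assumes c: "\<And>s. \<exists>t s'. exec c s t s' \<and> s' 0 = F (s 0) \<and> (\<forall>r\<ge>m. s' r = s r) \<and> t \<le> (bit_size (s 0) + 2) ^ d"
    and m: "0 < m" and F: "\<And>h acc. F (Node x (Node h acc)) = f h acc"
  defines "e \<equiv> Op2 Minus (Lit 1) (Op1 Is_Atom (Var (m + 1)))"
    and "b \<equiv> Seq (Assign 0 (Op2 Mk_Node (Var m) (Op2 Mk_Node (Op1 Fst (Var (m + 1))) (Var (m + 2)))))
      (Seq c (Seq (Assign (m + 2) (Var 0)) (Assign (m + 1) (Op1 Snd (Var (m + 1))))))"
  assumes "s m = x" "s (m + 1) = l" "s (m + 2) = a"
    and "\<And>i. i \<le> length (to_list l) \<Longrightarrow> bit_size (fold f (take i (to_list l)) a) \<le> Z"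
    and "bit_size x + bit_size l \<le> Y"
  shows "\<exists>t s'. exec (While e b) s t s' \<and> s' (m + 2) = fold f (to_list l) a \<and> (\<forall>r\<ge>m + 3. s' r = s r) \<and>
    t \<le> (length (to_list l) + 1) * (20 * (Y + Z + 1) + (Y + Z + 4) ^ d)"
  using assms(6-)
proof (induction l arbitrary: s a)
  case (Atom k)
  have "expr_cost e s \<le> Y + 8"
    using Atom.prems isz_le[of 1 1] by (simp add: e_def)
  moreover have "exec (While e b) s (expr_cost e s) s"
    by (rule exec.While_False) (use Atom.prems in \<open>simp add: e_def is_true_def\<close>)
  ultimately show ?case
    using Atom.prems by (intro exI[of _ "expr_cost e s"] exI[of _ s]) auto
next
  case (Node h l)
  let ?C = "20 * (Y + Z + 1) + (Y + Z + 4) ^ d"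
  have sz: "bit_size x + bit_size h + bit_size l + 1 \<le> Y" "bit_size a \<le> Z" "bit_size (f h a) \<le> Z"
    using Node.prems(5) Node.prems(4)[of 0] Node.prems(4)[of 1] by simp_all
  have T: "is_true e s" using Node.prems by (simp add: e_def is_true_def)
  have ce: "expr_cost e s \<le> Y + 8"
    using Node.prems sz isz_le[of 1 1] by (simp add: e_def)
  define e1 where "e1 = Op2 Mk_Node (Var m) (Op2 Mk_Node (Op1 Fst (Var (m + 1))) (Var (m + 2)))"
  define s1 where "s1 = s(0 := eval_expr e1 s)"
  have x1: "exec (Assign 0 e1) s (expr_cost e1 s) s1" unfolding s1_def by (rule exec.Assign)
  have s1: "s1 0 = Node x (Node h a)" "\<And>r. r > 0 \<Longrightarrow> s1 r = s r"
    using Node.prems by (simp_all add: s1_def e1_def)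
  obtain t2 s2 where x2: "exec c s1 t2 s2" and s2: "s2 0 = f h a" "\<forall>r\<ge>m. s2 r = s1 r"
    and t2: "t2 \<le> (bit_size (s1 0) + 2) ^ d"
    using c[of s1] by (auto simp: s1 F)
  have t2: "t2 \<le> (Y + Z + 4) ^ d"
    using t2 sz by (elim order_trans) (auto simp: s1 intro!: power_mono)
  define s3 where "s3 = s2(m + 2 := s2 0)"
  have x3: "exec (Assign (m + 2) (Var 0)) s2 (bit_size (s2 0)) s3"
    using exec.Assign[of "m + 2" "Var 0" s2] by (simp add: s3_def)
  define e4 where "e4 = Op1 Snd (Var (m + 1))"
  define s4 where "s4 = s3(m + 1 := eval_expr e4 s3)"
  have x4: "exec (Assign (m + 1) e4) s3 (expr_cost e4 s3) s4"
    unfolding s4_def by (rule exec.Assign)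
  have s3': "s3 (m + 1) = Node h l" using s1 s2 Node.prems m by (simp add: s3_def)
  have s4: "s4 m = x" "s4 (m + 1) = l" "s4 (m + 2) = f h a" "\<forall>r\<ge>m + 3. s4 r = s r"
    using s1 s2 Node.prems m by (auto simp: s4_def s3_def e4_def)
  have "exec b s (expr_cost e1 s + (t2 + (bit_size (s2 0) + expr_cost e4 s3))) s4"
    unfolding b_def e1_def[symmetric] e4_def[symmetric]
    by (intro exec.Seq[OF x1] exec.Seq[OF x2] exec.Seq[OF x3] x4)
  note xb = this
  have cb: "expr_cost e1 s + (t2 + (bit_size (s2 0) + expr_cost e4 s3)) \<le> 8 * (Y + Z + 1) + (Y + Z + 4) ^ d"
    using sz t2 s2 Node.prems s3' by (simp add: e1_def e4_def)
  have "\<exists>t s'. exec (While e b) s4 t s' \<and> s' (m + 2) = fold f (to_list l) (f h a) \<and> (\<forall>r\<ge>m + 3. s' r = s4 r) \<and>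
      t \<le> (length (to_list l) + 1) * ?C"
  proof (rule Node.IH(2)[OF s4(1,2,3)])
    fix i assume "i \<le> length (to_list l)"
    then show "bit_size (fold f (take i (to_list l)) (f h a)) \<le> Z"
      using Node.prems(4)[of "Suc i"] by simp
  qed (use sz in simp)
  then obtain t s' where r: "exec (While e b) s4 t s'" "s' (m + 2) = fold f (to_list l) (f h a)"
    "\<forall>r\<ge>m + 3. s' r = s4 r" "t \<le> (length (to_list l) + 1) * ?C" by blast
  have "exec (While e b) s (expr_cost e s + (expr_cost e1 s + (t2 + (bit_size (s2 0) + expr_cost e4 s3))) + t) s'"
    by (rule exec.While_True[OF T xb r(1)])
  moreover have "expr_cost e s + (expr_cost e1 s + (t2 + (bit_size (s2 0) + expr_cost e4 s3))) + t
      \<le> (length (to_list (Node h l)) + 1) * ?C"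
    using ce cb r(4) by simp
  ultimately show ?case
    using r s4 by (intro exI conjI) (assumption, auto)
qed

text \<open>Polynomial time of the step is not enough, since its output may be longer than its input
  by a factor in every round. Hence the bound \<open>Z\<close> for the accumulator after every
  prefix.\<close>

lemma ptime_fold:
  assumes l: "ptime l" and a: "ptime a"
    and f: "ptime (\<lambda>z. f (fs z) (fs (sn z)) (sn (sn z)))"
    and Z: "pbounded Z"
      "\<And>x i. i \<le> length (to_list (l x)) \<Longrightarrow> bit_size (fold (f x) (take i (to_list (l x))) (a x)) \<le> Z (bit_size x)"
  shows "ptime (\<lambda>x. fold (f x) (to_list (l x)) (a x))"
proof -
  have g: "ptime (\<lambda>x. Node (l x) (a x))" by (intro ptime_intros l a)
  obtain c1 m1 d1 where p1: "0 < m1" and 1: "\<And>s. \<exists>t s'. exec c1 s t s' \<and> s' 0 = Node (l (s 0)) (a (s 0)) \<and> (\<forall>r\<ge>m1. s' r = s r) \<and> t \<le> (bit_size (s 0) + 2) ^ d1"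
    and s1: "\<And>x. bit_size (Node (l x) (a x)) \<le> (bit_size x + 2) ^ d1"
    by (rule ptimeE[OF g], erule that, assumption+)
  obtain c2 m2 d2 where p2: "0 < m2" and 2: "\<And>s. \<exists>t s'. exec c2 s t s' \<and> s' 0 = f (fs (s 0)) (fs (sn (s 0))) (sn (sn (s 0))) \<and> (\<forall>r\<ge>m2. s' r = s r) \<and> t \<le> (bit_size (s 0) + 2) ^ d2"
    and s2: "\<And>z. bit_size (f (fs z) (fs (sn z)) (sn (sn z))) \<le> (bit_size z + 2) ^ d2"
    by (rule ptimeE[OF f], erule that, assumption+)
  define m where "m = max m1 m2"
  have m: "m1 \<le> m" "m2 \<le> m" "0 < m" using p1 by (auto simp: m_def)
  have c2: "\<exists>t s'. exec c2 s t s' \<and> s' 0 = f (fs (s 0)) (fs (sn (s 0))) (sn (sn (s 0))) \<and> (\<forall>r\<ge>m. s' r = s r) \<and> t \<le> (bit_size (s 0) + 2) ^ d2" for s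
    using 2[of s] m(2) by (meson order_trans)
  define e where "e = Op2 Minus (Lit 1) (Op1 Is_Atom (Var (m + 1)))"
  define b where "b = Seq (Assign 0 (Op2 Mk_Node (Var m) (Op2 Mk_Node (Op1 Fst (Var (m + 1))) (Var (m + 2)))))
      (Seq c2 (Seq (Assign (m + 2) (Var 0)) (Assign (m + 1) (Op1 Snd (Var (m + 1))))))"
  define c where "c = Seq (Assign m (Var 0)) (Seq c1 (Seq (Assign (m + 1) (Op1 Fst (Var 0)))
    (Seq (Assign (m + 2) (Op1 Snd (Var 0))) (Seq (While e b) (Assign 0 (Var (m + 2)))))))"
  let ?Y = "\<lambda>z. z + (z + 2) ^ d1"
  show ?thesis
  proof (rule ptimeI[of c _ "m + 3" "\<lambda>z. z + 6 * (z + 2) ^ d1 + (?Y z + 1) * (20 * (?Y z + Z z + 1) + (?Y z + Z z + 4) ^ d2) + Z z" Z])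
    fix s :: store
    define x where "x = s 0"
    let ?z = "bit_size x"
    define s0 where "s0 = s(m := s 0)"
    have e0: "exec (Assign m (Var 0)) s ?z s0"
      using exec.Assign[of m "Var 0" s] by (simp add: s0_def x_def)
    obtain t1 s1' where q: "exec c1 s0 t1 s1'" "s1' 0 = Node (l (s0 0)) (a (s0 0))" "\<forall>r\<ge>m1. s1' r = s0 r" "t1 \<le> (bit_size (s0 0) + 2) ^ d1"
      using 1 by blast
    define s2' where "s2' = s1'(m + 1 := fs (s1' 0))"
    have e1: "exec (Assign (m + 1) (Op1 Fst (Var 0))) s1' (expr_cost (Op1 Fst (Var 0)) s1') s2'"
      using exec.Assign[of "m + 1" "Op1 Fst (Var 0)" s1'] by (simp add: s2'_def)
    define s3 where "s3 = s2'(m + 2 := sn (s2' 0))"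
    have e2: "exec (Assign (m + 2) (Op1 Snd (Var 0))) s2' (expr_cost (Op1 Snd (Var 0)) s2') s3"
      using exec.Assign[of "m + 2" "Op1 Snd (Var 0)" s2'] by (simp add: s3_def)
    have z: "s0 0 = x" "s1' 0 = Node (l x) (a x)" "s2' 0 = Node (l x) (a x)" "s3 m = x" "s3 (m + 1) = l x" "s3 (m + 2) = a x"
      using q m by (auto simp: s0_def s2'_def s3_def x_def)
    have "\<exists>t s'. exec (While e b) s3 t s' \<and> s' (m + 2) = fold (f x) (to_list (l x)) (a x) \<and> (\<forall>r\<ge>m + 3. s' r = s3 r) \<and>
      t \<le> (length (to_list (l x)) + 1) * (20 * (?Y ?z + Z ?z + 1) + (?Y ?z + Z ?z + 4) ^ d2)"
      unfolding e_def b_def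
      by (rule while_fold[OF c2 m(3) _ z(4-6)]) (use Z(2) s1[of x] in auto)
    then obtain t4 s4 where w: "exec (While e b) s3 t4 s4" "s4 (m + 2) = fold (f x) (to_list (l x)) (a x)"
      "\<forall>r\<ge>m + 3. s4 r = s3 r" "t4 \<le> (length (to_list (l x)) + 1) * (20 * (?Y ?z + Z ?z + 1) + (?Y ?z + Z ?z + 4) ^ d2)"
      by blast
    have "exec c s (?z + (t1 + (expr_cost (Op1 Fst (Var 0)) s1' + (expr_cost (Op1 Snd (Var 0)) s2' + (t4 + bit_size (s4 (m + 2))))))) (s4(0 := s4 (m + 2)))"
      unfolding c_def using exec.Assign[of 0 "Var (m + 2)" s4]
      by (intro exec.Seq[OF e0] exec.Seq[OF q(1)] exec.Seq[OF e1] exec.Seq[OF e2] exec.Seq[OF w(1)]) simp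
    moreover have "t4 \<le> (?Y ?z + 1) * (20 * (?Y ?z + Z ?z + 1) + (?Y ?z + Z ?z + 4) ^ d2)"
    proof -
      have "length (to_list (l x)) + 1 \<le> ?Y ?z + 1"
        using bit_size_to_list[of "l x"] s1[of x] by simp
      then show ?thesis using w(4) by (meson mult_right_mono order_trans zero_le)
    qed
    then have "?z + (t1 + (expr_cost (Op1 Fst (Var 0)) s1' + (expr_cost (Op1 Snd (Var 0)) s2' + (t4 + bit_size (s4 (m + 2))))))
      \<le> ?z + 6 * (?z + 2) ^ d1 + (?Y ?z + 1) * (20 * (?Y ?z + Z ?z + 1) + (?Y ?z + Z ?z + 4) ^ d2) + Z ?z"
      using q(4) z s1[of x] w(2) Z(2)[of "length (to_list (l x))" x] by simp
    moreover have "\<forall>r\<ge>m + 3. (s4(0 := s4 (m + 2))) r = s r"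
      using q w m by (auto simp: s0_def s2'_def s3_def)
    ultimately show "\<exists>t s'. exec c s t s' \<and> s' 0 = fold (f (s 0)) (to_list (l (s 0))) (a (s 0)) \<and> (\<forall>r\<ge>m + 3. s' r = s r) \<and>
        t \<le> bit_size (s 0) + 6 * (bit_size (s 0) + 2) ^ d1 + (?Y (bit_size (s 0)) + 1) * (20 * (?Y (bit_size (s 0)) + Z (bit_size (s 0)) + 1) + (?Y (bit_size (s 0)) + Z (bit_size (s 0)) + 4) ^ d2) + Z (bit_size (s 0))"
      using w(2) unfolding x_def by (intro exI conjI) (assumption, auto)
  next
    show "bit_size (fold (f x) (to_list (l x)) (a x)) \<le> Z (bit_size x)" for x
      using Z(2)[of "length (to_list (l x))" x] by simp
  qed (intro pbounded_intros Z(1))+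
qed

text \<open>The prefix bound from a potential \<open>\<mu>\<close> which each step raises by an
  amount that depends on the input alone. The invariant \<open>P\<close> is for accumulators whose
  size is comparable to \<open>\<mu>\<close> only when they have the right shape.\<close>

lemma ptime_fold_invar:
  fixes f :: "data \<Rightarrow> data \<Rightarrow> data \<Rightarrow> data"
  assumes "ptime l" "ptime a"
    and "ptime (\<lambda>z. f (fs z) (fs (sn z)) (sn (sn z)))"
    and B: "pbounded B" and P0: "\<And>x. P x (a x)"
    and step: "\<And>x h acc. h \<in> set (to_list (l x)) \<Longrightarrow> P x acc \<Longrightarrow>
       P x (f x h acc) \<and> \<mu> (f x h acc) \<le> \<mu> acc + B (bit_size x)"
    and \<mu>: "pbounded M" "\<And>x acc. P x acc \<Longrightarrow> bit_size acc \<le> \<mu> acc * M (bit_size x)"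
    and a: "pbounded A" "\<And>x. \<mu> (a x) \<le> A (bit_size x)"
  shows "ptime (\<lambda>x. fold (f x) (to_list (l x)) (a x))"
proof -
  obtain d where d: "\<And>x. bit_size (l x) \<le> (bit_size x + 2) ^ d"
    by (rule ptime_size[OF assms(1)], erule that)
  have *: "P x (fold (f x) (take i (to_list (l x))) (a x)) \<and>
      \<mu> (fold (f x) (take i (to_list (l x))) (a x)) \<le> A (bit_size x) + i * B (bit_size x)"
    if "i \<le> length (to_list (l x))" for x i
    using that
  proof (induction i)
    case (Suc i)
    then show ?case
      using step[of "to_list (l x) ! i" x "fold (f x) (take i (to_list (l x))) (a x)"]
      by (simp add: take_Suc_conv_app_nth)
  qed (use P0 a in simp)
  show ?thesis
  proof (rule ptime_fold[OF assms(1-3), where Z = "\<lambda>s. (A s + (s + 2) ^ d * B s) * M s"])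
    fix x i
    assume i: "i \<le> length (to_list (l x))"
    then have "i \<le> (bit_size x + 2) ^ d"
      using bit_size_to_list[of "l x"] d[of x] by linarith
    then have "\<mu> (fold (f x) (take i (to_list (l x))) (a x)) \<le> A (bit_size x) + (bit_size x + 2) ^ d * B (bit_size x)"
      using *[OF i] by (meson add_left_mono mult_right_mono order_trans zero_le)
    then show "bit_size (fold (f x) (take i (to_list (l x))) (a x)) \<le> (A (bit_size x) + (bit_size x + 2) ^ d * B (bit_size x)) * M (bit_size x)"
      using \<mu>(2) *[OF i] by (meson mult_right_mono order_trans zero_le)
  qed (intro pbounded_intros B a \<mu>)
qed

text \<open>The potential is the size itself. The function \<open>g\<close> sees the parameter and
  the current element but not the accumulator, so the increments do not compound.\<close>

lemma ptime_fold_add: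
  fixes f :: "data \<Rightarrow> data \<Rightarrow> data \<Rightarrow> data"
  assumes "ptime l" "ptime a"
    and "ptime (\<lambda>z. f (fs z) (fs (sn z)) (sn (sn z)))"
    and g: "ptime g" and step: "\<And>x h acc. bit_size (f x h acc) \<le> bit_size acc + bit_size (g (Node x h))"
  shows "ptime (\<lambda>x. fold (f x) (to_list (l x)) (a x))"
proof -
  obtain d where d: "\<And>x. bit_size (g x) \<le> (bit_size x + 2) ^ d"
    by (rule ptime_size[OF g], erule that)
  obtain d' where d': "\<And>x. bit_size (l x) \<le> (bit_size x + 2) ^ d'"
    by (rule ptime_size[OF assms(1)], erule that)
  obtain d'' where d'': "\<And>x. bit_size (a x) \<le> (bit_size x + 2) ^ d''"
    by (rule ptime_size[OF assms(2)], erule that)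
  show ?thesis
  proof (rule ptime_fold_invar[OF assms(1-3), where P = "\<lambda>_ _. True" and \<mu> = bit_size and M = "\<lambda>_. 1"
        and B = "\<lambda>s. (s + (s + 2) ^ d' + 3) ^ d" and A = "\<lambda>s. (s + 2) ^ d''"])
    fix x h acc
    assume "h \<in> set (to_list (l x))"
    then have "bit_size (Node x h) + 2 \<le> bit_size x + (bit_size x + 2) ^ d' + 3"
      using bit_size_to_list_nth[of h "l x"] d'[of x] by simp
    then have "(bit_size (Node x h) + 2) ^ d \<le> (bit_size x + (bit_size x + 2) ^ d' + 3) ^ d"
      by (rule power_mono) simp
    then show "True \<and> bit_size (f x h acc) \<le> bit_size acc + (bit_size x + (bit_size x + 2) ^ d' + 3) ^ d"
      using step[of x h acc] d[of "Node x h"] by simp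
  qed (use d'' in \<open>auto intro!: pbounded_intros\<close>)
qed

definition plist :: "(data \<Rightarrow> data list) \<Rightarrow> bool" where
  "plist l \<longleftrightarrow> ptime (\<lambda>x. of_list (l x))"

lemma ptime_plist [ptime_intros]: "plist l \<Longrightarrow> ptime (\<lambda>x. of_list (l x))"
  by (simp add: plist_def)

lemma ptime_fold_cons:
  assumes "ptime l" "ptime a"
  shows "ptime (\<lambda>x. fold Node (to_list (l x)) (a x))"
  by (rule ptime_fold_add[OF assms, where g = "\<lambda>x. x"]) (auto intro!: ptime_intros)

lemma fold_Node: "fold Node xs (of_list ys) = of_list (rev xs @ ys)"
  by (induction xs arbitrary: ys) (simp_all flip: of_list_simps(2))

lemma plist_rev_to_list: "ptime l \<Longrightarrow> plist (\<lambda>x. rev (to_list (l x)))"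
  using ptime_fold_cons[of l "\<lambda>_. Atom 0"] fold_Node[of _ "[]"]
  by (simp add: plist_def ptime_Atom)

lemma plist_rev [ptime_intros]: "plist l \<Longrightarrow> plist (\<lambda>x. rev (l x))"
  using plist_rev_to_list[of "\<lambda>x. of_list (l x)"] by (simp add: plist_def)

lemma plist_to_list [ptime_intros]: "ptime l \<Longrightarrow> plist (\<lambda>x. to_list (l x))"
  using plist_rev[OF plist_rev_to_list] by simp

lemma plist_Nil [ptime_intros]: "plist (\<lambda>_. [])"
  by (simp add: plist_def ptime_Atom)

lemma plist_Cons [ptime_intros]: "ptime f \<Longrightarrow> plist l \<Longrightarrow> plist (\<lambda>x. f x # l x)"
  by (simp add: plist_def ptime_Node)

lemma plist_append [ptime_intros]:
  assumes "plist l" "plist k"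
  shows "plist (\<lambda>x. l x @ k x)"
  using ptime_fold_cons[OF plist_rev[OF assms(1), unfolded plist_def] assms(2)[unfolded plist_def]]
  by (simp add: plist_def fold_Node)

lemma plist_if [ptime_intros]:
  assumes "pdec P" "plist f" "plist g"
  shows "plist (\<lambda>x. if P x then f x else g x)"
  using ptime_if[OF assms[unfolded plist_def]] by (simp add: plist_def if_distrib)

lemma plist_concat_map [ptime_intros]:
  assumes l: "plist l" and f: "plist (\<lambda>z. f (fs z) (sn z))"
  shows "plist (\<lambda>x. concat (map (\<lambda>h. f x h) (l x)))"
proof -
  have f': "plist (\<lambda>x. f (g x) (h x))" if "ptime g" "ptime h" for g h
    using ptime_comp[OF f[unfolded plist_def] ptime_Node[OF that]] by (simp add: plist_def)
  have *: "of_list (fold (\<lambda>h acc. f x h @ acc) xs ys) = fold (\<lambda>h acc. of_list (f x h @ to_list acc)) xs (of_list ys)" for x xs ys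
    by (induction xs arbitrary: ys) simp_all
  have **: "fold (\<lambda>h acc. f x h @ acc) (rev xs) ys = concat (map (f x) xs) @ ys" for x xs ys
    by (induction xs arbitrary: ys) simp_all
  have sz: "bit_size (of_list (xs @ to_list d)) \<le> bit_size d + bit_size (of_list xs)" for xs d
    using bit_size_to_list[of d] by (simp add: bit_size_of_list)
  have "ptime (\<lambda>x. fold (\<lambda>h acc. of_list (f x h @ to_list acc)) (to_list (of_list (rev (l x)))) (Atom 0))"
    by (rule ptime_fold_add[where g = "\<lambda>z. of_list (f (fs z) (sn z))"])
       (use sz in \<open>auto intro!: ptime_intros l f f'\<close>)
  moreover have "of_list (concat (map (f x) xs)) = fold (\<lambda>h acc. of_list (f x h @ to_list acc)) (rev xs) (Atom 0)" for x xs
    using *[of x "rev xs" "[]"] **[of x xs "[]"] by simp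
  ultimately show ?thesis
    by (simp add: plist_def)
qed

lemma plist_map [ptime_intros]:
  assumes "plist l" "ptime (\<lambda>z. f (fs z) (sn z))"
  shows "plist (\<lambda>x. map (\<lambda>h. f x h) (l x))"
proof -
  have "plist (\<lambda>x. concat (map (\<lambda>h. [f x h]) (l x)))"
    using assms by (intro ptime_intros)
  then show ?thesis by simp
qed

lemma plist_filter [ptime_intros]:
  assumes "plist l" "pdec (\<lambda>z. P (fs z) (sn z))"
  shows "plist (\<lambda>x. filter (\<lambda>h. P x h) (l x))"
proof -
  have "filter (P x) xs = concat (map (\<lambda>h. if P x h then [h] else []) xs)" for x xs
    by (induction xs) simp_all
  then show ?thesis
    using assms by (auto intro!: ptime_intros)
qed

lemma pint_sum_list [ptime_intros]:
  assumes l: "plist l" and f: "pint (\<lambda>z. f (fs z) (sn z))"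
  shows "pint (\<lambda>x. \<Sum>h\<leftarrow>l x. f x h)"
proof -
  have f': "pint (\<lambda>x. f (g x) (h x))" if "ptime g" "ptime h" for g h
    using ptime_comp[OF f[unfolded pint_def] ptime_Node[OF that]] by (simp add: pint_def)
  have *: "fold (\<lambda>h acc. Atom (f x h + int_of acc)) xs (Atom k) = Atom ((\<Sum>h\<leftarrow>xs. f x h) + k)" for x xs k
    by (induction xs arbitrary: k) simp_all
  have sz: "isz (f x h + int_of acc) \<le> bit_size acc + isz (f x h)" for x h acc
    using isz_add[of "f x h" "int_of acc"] isz_int_of[of acc] by linarith
  have "ptime (\<lambda>x. fold (\<lambda>h acc. Atom (f x h + int_of acc)) (to_list (of_list (l x))) (Atom 0))"
    by (rule ptime_fold_add[where g = "\<lambda>z. Atom (f (fs z) (sn z))"])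
       (use sz in \<open>auto intro!: ptime_intros l f f' simp del: bit_size.simps(1)\<close>)
  then show ?thesis
    by (simp add: pint_def *)
qed

lemma pint_prod_list [ptime_intros]:
  assumes l: "plist l" and f: "pint (\<lambda>z. f (fs z) (sn z))"
  shows "pint (\<lambda>x. \<Prod>h\<leftarrow>l x. f x h)"
proof -
  have f': "pint (\<lambda>x. f (g x) (h x))" if "ptime g" "ptime h" for g h
    using ptime_comp[OF f[unfolded pint_def] ptime_Node[OF that]] by (simp add: pint_def)
  have *: "fold (\<lambda>h acc. Atom (f x h * int_of acc)) xs (Atom k) = Atom ((\<Prod>h\<leftarrow>xs. f x h) * k)" for x xs k
    by (induction xs arbitrary: k) simp_all
  have sz: "isz (f x h * int_of acc) \<le> bit_size acc + isz (f x h)" for x h acc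
    using isz_mult[of "f x h" "int_of acc"] isz_int_of[of acc] by linarith
  have "ptime (\<lambda>x. fold (\<lambda>h acc. Atom (f x h * int_of acc)) (to_list (of_list (l x))) (Atom 1))"
    by (rule ptime_fold_add[where g = "\<lambda>z. Atom (f (fs z) (sn z))"])
       (use sz in \<open>auto intro!: ptime_intros l f f' simp del: bit_size.simps(1)\<close>)
  then show ?thesis
    by (simp add: pint_def *)
qed

lemma pint_length [ptime_intros]: "plist l \<Longrightarrow> pint (\<lambda>x. int (length (l x)))"
  using pint_sum_list[of l "\<lambda>_ _. 1"] by (simp add: pint_const sum_list_triv)

lemma pdec_Nil [ptime_intros]: "plist l \<Longrightarrow> pdec (\<lambda>x. l x = [])"
  using pdec_eq[OF pint_length pint_const, of l 0] by simp

definition dhd :: "data list \<Rightarrow> data" where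
  "dhd xs = (case xs of [] \<Rightarrow> Atom 0 | x # _ \<Rightarrow> x)"

lemma ptime_dhd [ptime_intros]: "plist l \<Longrightarrow> ptime (\<lambda>x. dhd (l x))"
proof -
  have "dhd xs = fs (of_list xs)" for xs by (cases xs) (simp_all add: dhd_def)
  then show "plist l \<Longrightarrow> ptime (\<lambda>x. dhd (l x))" by (auto intro!: ptime_intros)
qed

section \<open>Best and greedy choices\<close>

definition best :: "(data \<Rightarrow> int) \<Rightarrow> data list \<Rightarrow> data" where
  "best key xs = fold (\<lambda>c b. if key b < key c then c else b) xs (dhd xs)"

lemma best_aux:
  "(let r = fold (\<lambda>c b. if key b < key c then c else b) xs b in r \<in> insert b (set xs) \<and> key b \<le> key r \<and> (\<forall>c\<in>set xs. key c \<le> (key r :: int)))"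
  by (induction xs arbitrary: b) (force simp: Let_def)+

lemma best_in: "xs \<noteq> [] \<Longrightarrow> best key xs \<in> set xs"
  using best_aux[where key = key and xs = xs and b = "dhd xs"]
  by (cases xs) (auto simp: best_def Let_def dhd_def)

lemma best_max: "c \<in> set xs \<Longrightarrow> key c \<le> key (best key xs)"
  using best_aux[where key = key and xs = xs and b = "dhd xs"] by (auto simp: best_def Let_def)

lemma bit_size_best: "bit_size (best key xs) \<le> bit_size (of_list xs)"
proof (cases "xs = []")
  case False
  then show ?thesis
    using bit_size_to_list_nth[of "best key xs" "of_list xs"] best_in[of xs key] by simp
qed (simp add: best_def dhd_def)

lemma ptime_best [ptime_intros]:
  assumes l: "plist l" and key: "pint (\<lambda>z. key (fs z) (sn z))"
  shows "ptime (\<lambda>x. best (\<lambda>h. key x h) (l x))"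
proof -
  have key': "pint (\<lambda>x. key (g x) (h x))" if "ptime g" "ptime h" for g h
    using ptime_comp[OF key[unfolded pint_def] ptime_Node[OF that]] by (simp add: pint_def)
  have "ptime (\<lambda>x. fold (\<lambda>c b. if key x b < key x c then c else b) (to_list (of_list (l x))) (dhd (l x)))"
    by (rule ptime_fold_add[where g = "\<lambda>z. z"]) (auto intro!: ptime_intros l key')
  then show ?thesis by (simp add: best_def)
qed

text \<open>The key may read the whole accumulator, yet the accumulator grows only by one candidate
  per step, and the candidates depend on the input alone.\<close>

lemma plist_greedy:
  assumes l: "plist l" and cs: "plist (\<lambda>z. cs (fs z) (sn z))"
    and key: "pint (\<lambda>z. key (fs z) (fs (sn z))
       (to_list (fs (sn (sn z)))) (sn (sn (sn z))))"
  shows "plist (\<lambda>x. fold (\<lambda>h acc. best (\<lambda>c. key x h acc c) (cs x h) # acc) (l x) [])"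
proof -
  have cs': "plist (\<lambda>x. cs (g x) (h x))" if "ptime g" "ptime h" for g h
    using ptime_comp[OF cs[unfolded plist_def] ptime_Node[OF that]] by (simp add: plist_def)
  have key': "pint (\<lambda>x. key (g x) (h x) (to_list (i x)) (j x))" if "ptime g" "ptime h" "ptime i" "ptime j" for g h i j
    using ptime_comp[OF key[unfolded pint_def] ptime_Node[OF that(1) ptime_Node[OF that(2) ptime_Node[OF that(3,4)]]]]
    by (simp add: pint_def)
  have *: "of_list (fold (\<lambda>h acc. best (key x h acc) (cs x h) # acc) xs ys) =
      fold (\<lambda>h acc. Node (best (key x h (to_list acc)) (cs x h)) acc) xs (of_list ys)" for x xs ys
    by (induction xs arbitrary: ys) simp_all
  have sz: "bit_size (best k xs) \<le> bit_size (of_list xs)" for k xs by (rule bit_size_best)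
  have "ptime (\<lambda>x. fold (\<lambda>h acc. Node (best (key x h (to_list acc)) (cs x h)) acc) (to_list (of_list (l x))) (Atom 0))"
    by (rule ptime_fold_add[where g = "\<lambda>z. Node (Atom 0) (of_list (cs (fs z) (sn z)))"])
       (auto intro!: ptime_intros l cs' key' simp: sz le_SucI)
  then show ?thesis
    using *[of _ _ "[]"] by (simp add: plist_def)
qed

text \<open>In an iterated recurrence the numbers could double in length at every step. This is excluded by
  a bound for the growth factor that does not depend on the current state.\<close>

lemma ptime_iter_pair:
  assumes l: "plist l" and fg: "pint (\<lambda>z. f (fs z) (int_of (fs (sn z))) (int_of (sn (sn z))))"
    "pint (\<lambda>z. g (fs z) (int_of (fs (sn z))) (int_of (sn (sn z))))"
    and C: "pint C" and growth: "\<And>x v w. \<bar>f x v w\<bar> + \<bar>g x v w\<bar> \<le> \<bar>C x\<bar> * (\<bar>v\<bar> + \<bar>w\<bar>)"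
  shows "ptime (\<lambda>x. fold (\<lambda>_ acc. Node (Atom (f x (int_of (fs acc)) (int_of (sn acc))))
      (Atom (g x (int_of (fs acc)) (int_of (sn acc))))) (l x) (Node (Atom a) (Atom b)))"
proof -
  define m where "m acc = \<bar>int_of (fs acc)\<bar> + \<bar>int_of (sn acc)\<bar>" for acc
  have f': "pint (\<lambda>x. f (p x) (int_of (q x)) (int_of (r x)))" if "ptime p" "ptime q" "ptime r" for p q r
    using ptime_comp[OF fg(1)[unfolded pint_def] ptime_Node[OF that(1) ptime_Node[OF that(2,3)]]]
    by (simp add: pint_def)
  have g': "pint (\<lambda>x. g (p x) (int_of (q x)) (int_of (r x)))" if "ptime p" "ptime q" "ptime r" for p q r
    using ptime_comp[OF fg(2)[unfolded pint_def] ptime_Node[OF that(1) ptime_Node[OF that(2,3)]]]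
    by (simp add: pint_def)
  obtain d where d: "\<And>x. isz (C x) \<le> (bit_size x + 2) ^ d"
    by (rule ptime_size[OF C[unfolded pint_def]], erule that)
  have "ptime (\<lambda>x. fold (\<lambda>_ acc. Node (Atom (f x (int_of (fs acc)) (int_of (sn acc))))
      (Atom (g x (int_of (fs acc)) (int_of (sn acc))))) (to_list (of_list (l x))) (Node (Atom a) (Atom b)))"
  proof (rule ptime_fold_invar[where P = "\<lambda>_ acc. \<exists>v w. acc = Node (Atom v) (Atom w)" and \<mu> = "\<lambda>acc. isz (m acc)"
        and B = "\<lambda>s. (s + 2) ^ d" and M = "\<lambda>_. 3" and A = "\<lambda>_. isz (\<bar>a\<bar> + \<bar>b\<bar>)"])
    show "(\<exists>v w. Node (Atom (f x (int_of (fs acc)) (int_of (sn acc))))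
      (Atom (g x (int_of (fs acc)) (int_of (sn acc)))) = Node (Atom v) (Atom w)) \<and>
      isz (m (Node (Atom (f x (int_of (fs acc)) (int_of (sn acc))))
      (Atom (g x (int_of (fs acc)) (int_of (sn acc)))))) \<le> isz (m acc) + (bit_size x + 2) ^ d"
      for x and h acc :: data
    proof -
      \<comment> \<open>The potential is the length of |v| + |w|. Multiplying by \<open>C x\<close>
        adds at most the length of \<open>C x\<close>, the same amount in every round.\<close>
      have "isz (\<bar>f x (int_of (fs acc)) (int_of (sn acc))\<bar> + \<bar>g x (int_of (fs acc)) (int_of (sn acc))\<bar>)
        \<le> isz (C x * m acc)"
        using growth by (intro isz_mono) (auto simp: abs_mult m_def)
      also have "\<dots> \<le> (bit_size x + 2) ^ d + isz (m acc)"
        using isz_mult[of "C x" "m acc"] d[of x] by linarith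
      finally show ?thesis by (simp add: m_def del: bit_size.simps(1))
    qed
    show "bit_size acc \<le> isz (m acc) * 3" if "\<exists>v w. acc = Node (Atom v) (Atom w)" for acc
    proof -
      from that obtain v w where acc: "acc = Node (Atom v) (Atom w)" by blast
      have "isz v \<le> isz (m acc)" "isz w \<le> isz (m acc)"
        by (intro isz_mono; simp add: m_def acc)+
      moreover have "bit_size acc = 1 + isz v + isz w" by (simp add: acc)
      ultimately show ?thesis using isz_pos[of "m acc"] by linarith
    qed
  qed (auto intro!: pbounded_intros ptime_intros l f' g' simp: m_def simp del: bit_size.simps(1))
  then show ?thesis by simp
qed

subsection \<open>The Kertz constant\<close>

text \<open>With \<open>c = inverse b - 1\<close>, the integrand that defines
  \<open>kertz_const\<close> is \<open>inverse (c + xlx y)\<close>. The value 0 at 0 is the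
  continuous extension.\<close>

definition xlx :: "real \<Rightarrow> real" where
  "xlx y = y * (1 - ln y)"

lemma xlx_simps [simp]: "xlx 0 = 0" "xlx 1 = 1"
  by (simp_all add: xlx_def)

lemma xlx_ge: "0 \<le> y \<Longrightarrow> y \<le> 1 \<Longrightarrow> y \<le> xlx y"
  unfolding xlx_def by (cases "y = 0") (auto simp: mult_le_cancel_left1)

lemma xlx_mono:
  assumes "0 \<le> x" "x \<le> y" "y \<le> 1"
  shows "xlx x \<le> xlx y"
proof (cases "x = 0")
  case True
  then show ?thesis using xlx_ge[of y] assms by simp
next
  case False
  have "\<exists>d. (xlx has_real_derivative d) (at t) \<and> 0 \<le> d" if "x \<le> t" "t \<le> y" for t
    using that assms False unfolding xlx_def
    by (intro exI[of _ "- ln t"] conjI) (auto intro!: derivative_eq_intros)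
  then show ?thesis
    using DERIV_nonneg_imp_nondecreasing[of x y xlx] assms by blast
qed

lemma xlx_le_1: "0 \<le> y \<Longrightarrow> y \<le> 1 \<Longrightarrow> xlx y \<le> 1"
  using xlx_mono[of y 1] by simp

lemma continuous_on_xlx: "continuous_on {0..1} xlx"
proof -
  have "(xlx \<longlongrightarrow> xlx t) (at t within {0..1})" if t: "t \<in> {0..1}" for t
  proof (cases "t = 0")
    case True
    have le: "xlx y \<le> 3 * sqrt y" if y: "0 \<le> y" "y \<le> 1" for y
    proof (cases "y = 0")
      case False
      then have p: "y > 0" using y by simp
      have "ln (1 / sqrt y) \<le> 1 / sqrt y - 1" using p by (intro ln_le_minus_one) simp
      then have "- ln y \<le> 2 * (1 / sqrt y - 1)"
        using p by (simp add: ln_div ln_sqrt)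
      then have "y * (1 - ln y) \<le> y * (2 / sqrt y)"
        using p by (intro mult_left_mono) auto
      also have "\<dots> = 2 * sqrt y" using p by (simp add: real_div_sqrt field_simps)
      finally show ?thesis using p unfolding xlx_def by (smt (verit) real_sqrt_ge_zero)
    qed simp
    have "((\<lambda>y. 3 * sqrt y) \<longlongrightarrow> 3 * sqrt 0) (at 0 within {0..1})"
      by (intro tendsto_intros)
    then have "((\<lambda>y. 3 * sqrt y) \<longlongrightarrow> 0) (at 0 within {0..1})" by simp
    moreover have "\<forall>\<^sub>F y in at 0 within {0..1}. 0 \<le> xlx y" "\<forall>\<^sub>F y in at 0 within {0..1}. xlx y \<le> 3 * sqrt y"
      unfolding eventually_at_filter
      using le xlx_ge by (auto intro!: always_eventually intro: order_trans)
    ultimately show ?thesis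
      using tendsto_sandwich[of "\<lambda>_. 0" xlx "at 0 within {0..1}" "\<lambda>y. 3 * sqrt y" 0] True by simp
  next
    case False
    then have "isCont xlx t" using t unfolding xlx_def by (intro continuous_intros) auto
    then show ?thesis by (simp add: continuous_at_imp_continuous_at_within flip: continuous_within)
  qed
  then show ?thesis by (simp add: continuous_on_def)
qed

definition kint :: "real \<Rightarrow> real" where
  "kint c = integral {0..1} (\<lambda>y. inverse (c + xlx y))"

lemma continuous_on_kernel:
  assumes "0 < c" shows "continuous_on {0..1} (\<lambda>y. inverse (c + xlx y))"
proof (intro continuous_on_inverse continuous_on_add continuous_on_const continuous_on_xlx ballI)
  show "c + xlx y \<noteq> 0" if "y \<in> {0..1}" for y using assms xlx_ge[of y] that by auto
qed

lemma kernel_integrable: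
  assumes "0 < c" "0 \<le> a" "b \<le> 1" shows "(\<lambda>y. inverse (c + xlx y)) integrable_on {a..b}"
  by (rule integrable_continuous_interval, rule continuous_on_subset[OF continuous_on_kernel[OF assms(1)]])
     (use assms in auto)

text \<open>Strictness survives integration because the pointwise gap is at least a positive
  constant on the unit interval, where \<open>xlx\<close> is at most 1.\<close>

lemma kint_strict_antimono:
  assumes "0 < c" "c < d"
  shows "kint d < kint c"
proof -
  let ?r = "(d - c) / ((c + 1) * (d + 1))"
  have "?r + inverse (d + xlx y) \<le> inverse (c + xlx y)" if "y \<in> {0..1}" for y
  proof -
    have g: "0 \<le> xlx y" "xlx y \<le> 1" using xlx_ge[of y] xlx_le_1[of y] that by auto
    have "?r \<le> (d - c) / ((c + xlx y) * (d + xlx y))"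
      using assms g by (intro divide_left_mono mult_mono mult_pos_pos) auto
    also have "\<dots> = inverse (c + xlx y) - inverse (d + xlx y)"
      using assms g by (simp add: field_simps)
    finally show ?thesis by simp
  qed
  then have "integral {0..1} (\<lambda>y. ?r + inverse (d + xlx y)) \<le> kint c"
    unfolding kint_def using assms
    by (intro integral_le integrable_add kernel_integrable) auto
  also have "integral {0..1} (\<lambda>y. ?r + inverse (d + xlx y)) = ?r + kint d"
    unfolding kint_def using assms
    by (subst integral_add) (auto intro!: kernel_integrable)
  finally show ?thesis using assms by (smt (verit) divide_pos_pos mult_pos_pos)
qed

lemma continuous_on_kint:
  assumes "0 < a" shows "continuous_on {a..b} kint"
proof -
  have "continuous_on ({a..b} \<times> cbox 0 1) (\<lambda>(c, y). inverse (c + xlx y))"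
    unfolding case_prod_beta
  proof (intro continuous_on_inverse continuous_on_add continuous_on_fst continuous_on_id ballI)
    show "continuous_on ({a..b} \<times> cbox 0 1) (\<lambda>x. xlx (snd x))"
      by (rule continuous_on_compose2[OF continuous_on_xlx]) (auto intro!: continuous_intros)
    show "fst p + xlx (snd p) \<noteq> 0" if "p \<in> {a..b} \<times> cbox 0 1" for p
      using that assms xlx_ge[of "snd p"] by (auto simp: mem_Times_iff)
  qed
  from integral_continuous_on_param[OF this] show ?thesis
    unfolding kint_def by (simp add: cbox_interval)
qed

lemma kint_root: "\<exists>c>0. kint c = 1"
proof -
  \<comment> \<open>Chosen so that \<open>1 - ln a = exp 2\<close>, which makes the integral of
    \<open>inverse (2 * xlx y)\<close> over \<open>{a..1}\<close> exactly 1. There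
    \<open>a \<le> y \<le> xlx y\<close>, so this integral is a lower bound for that of
    \<open>inverse (a + xlx y)\<close>.\<close>
  define a where "a = exp (- (exp 2 - 1 :: real))"
  have a: "0 < a" "a < 1" by (simp_all add: a_def)
  have g: "0 < xlx y" "a \<le> xlx y" if "y \<in> {a..1}" for y
    using xlx_ge[of y] that a by auto
  have d: "((\<lambda>y. inverse (2 * xlx y)) has_integral (- ln (1 - ln 1) / 2 - (- ln (1 - ln a) / 2))) {a..1}"
  proof (rule fundamental_theorem_of_calculus)
    fix y assume y: "y \<in> {a..1}"
    then have p: "0 < y" "0 < 1 - ln y" using a by (auto simp: add_pos_nonneg intro: order.strict_trans1[OF _ zero_less_one])
    have "((\<lambda>y. - ln (1 - ln y) / 2) has_real_derivative inverse (2 * xlx y)) (at y within {a..1})"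
      using p by (auto intro!: derivative_eq_intros simp: xlx_def field_simps)
    then show "((\<lambda>y. - ln (1 - ln y) / 2) has_vector_derivative inverse (2 * xlx y)) (at y within {a..1})"
      by (simp add: has_real_derivative_iff_has_vector_derivative)
  qed (use a in simp)
  have "1 = integral {a..1} (\<lambda>y. inverse (2 * xlx y))"
    using integral_unique[OF d] by (simp add: a_def)
  also have "\<dots> \<le> integral {a..1} (\<lambda>y. inverse (a + xlx y))"
  proof (rule integral_le)
    show "inverse (2 * xlx y) \<le> inverse (a + xlx y)" if "y \<in> {a..1}" for y
      using g[OF that] a by (intro le_imp_inverse_le) auto
  qed (use d a in \<open>auto intro!: kernel_integrable simp: has_integral_integrable_integral\<close>)
  also have "\<dots> \<le> kint a"
    unfolding kint_def
  proof (rule integral_subset_le)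
    show "\<forall>y\<in>{0..1}. 0 \<le> inverse (a + xlx y)"
      using xlx_ge a by (force intro: add_nonneg_nonneg order_trans)
  qed (use a in \<open>auto intro!: kernel_integrable\<close>)
  finally have 1: "1 \<le> kint a" .
  have "kint 2 \<le> integral {0..1::real} (\<lambda>_. 1 / 2)"
    unfolding kint_def
  proof (rule integral_le)
    show "inverse (2 + xlx y) \<le> 1 / 2" if "y \<in> {0..1}" for y
      using xlx_ge[of y] that by (simp add: field_simps)
  qed (auto intro!: kernel_integrable)
  then have 2: "kint 2 \<le> 1" by simp
  obtain c where "a \<le> c" "c \<le> 2" "kint c = 1"
    using IVT2'[of kint 2 1 a, OF 2 1 _ continuous_on_kint] a by auto
  then show ?thesis using a by (intro exI[of _ c]) auto
qed

text \<open>The definite description is proper because \<open>kint\<close> is strictly decreasing on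
  the positive reals and takes the value 1 there.\<close>

lemma kertz_const:
  obtains c where "0 < c" "kint c = 1" "kertz_const = inverse (1 + c)"
proof -
  have iff: "((\<lambda>y. inverse ((inverse b - 1) - y * (ln y - 1))) has_integral 1) {0..1} \<longleftrightarrow> kint (inverse b - 1) = 1"
    if "0 < b" "b < 1" for b :: real
  proof -
    have *: "(\<lambda>y. inverse ((inverse b - 1) - y * (ln y - 1))) = (\<lambda>y. inverse ((inverse b - 1) + xlx y))"
      by (simp add: xlx_def algebra_simps)
    have "0 < inverse b - 1" using that by (simp add: one_less_inverse)
    then show ?thesis
      unfolding * kint_def
      using kernel_integrable[of "inverse b - 1" 0 1] by (auto simp: has_integral_integrable_integral)
  qed
  obtain c where c: "0 < c" "kint c = 1" using kint_root by blast
  have "kertz_const = inverse (1 + c)"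
    unfolding kertz_const_def
  proof (rule the_equality)
    show "0 < inverse (1 + c) \<and> inverse (1 + c) < 1 \<and>
      ((\<lambda>y. inverse ((inverse (inverse (1 + c)) - 1) - y * (ln y - 1))) has_integral 1) {0..1}"
      using c iff[of "inverse (1 + c)"] by (simp add: inverse_less_1_iff)
    fix b :: real
    assume b: "0 < b \<and> b < 1 \<and> ((\<lambda>y. inverse ((inverse b - 1) - y * (ln y - 1))) has_integral 1) {0..1}"
    then have "kint (inverse b - 1) = 1" "0 < inverse b - 1" using iff[of b] by (auto simp: one_less_inverse)
    then have "inverse b - 1 = c"
      using kint_strict_antimono[of c "inverse b - 1"] kint_strict_antimono[of "inverse b - 1" c] c by (cases "c = inverse b - 1") (auto simp: neq_iff)
    then show "b = inverse (1 + c)" by auto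
  qed
  with c that show thesis by blast
qed

lemma kertz_const_pos: "0 < kertz_const"
proof -
  obtain c where c: "0 < c" and eq: "kertz_const = inverse (1 + c)" by (rule kertz_const)
  show ?thesis unfolding eq using c by simp
qed

lemma kertz_const_less_1: "kertz_const < 1"
proof -
  obtain c where c: "0 < c" and eq: "kertz_const = inverse (1 + c)" by (rule kertz_const)
  show ?thesis unfolding eq using c by (simp add: inverse_less_1_iff)
qed

text \<open>\<open>y k\<close> is the solution of y' = c + \<open>xlx\<close> y at time k / T. It is
  found by inverting \<open>H\<close>, the time needed to reach y, and \<open>kint c = 1\<close>
  says that the total time is 1. The increment is bounded by the speed at the right end because
  \<open>xlx\<close> is increasing.\<close>

lemma kertz_grid:
  fixes c :: real
  assumes c: "0 < c" "kint c = 1" and T: "0 < T"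
  obtains y :: "nat \<Rightarrow> real" where "y 0 = 0" "y T = 1" "\<And>k. k \<le> T \<Longrightarrow> y k \<in> {0..1}"
    "\<And>k. k < T \<Longrightarrow> y (Suc k) - y k \<le> (c + xlx (y (Suc k))) / T"
proof -
  define h where "h y = inverse (c + xlx y)" for y
  define H where "H x = integral {0..x} h" for x
  have hp: "0 < h y" if "y \<in> {0..1}" for y using that c xlx_ge[of y] by (auto simp: h_def)
  have hint: "h integrable_on {a..b}" if "0 \<le> a" "b \<le> 1" for a b
    using kernel_integrable[OF c(1) that] by (simp add: h_def[abs_def])
  have Hdiff: "(b - a) * h b \<le> H b - H a" if "0 \<le> a" "a \<le> b" "b \<le> 1" for a b
  proof -
    have "integral {a..b} (\<lambda>_. h b) \<le> integral {a..b} h"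
    proof (rule integral_le)
      show "h b \<le> h t" if "t \<in> {a..b}" for t
        using xlx_mono[of t b] xlx_ge[of t] that \<open>0 \<le> a\<close> \<open>b \<le> 1\<close> c
        unfolding h_def by (intro le_imp_inverse_le) auto
    qed (use hint that in auto)
    moreover have "H a + integral {a..b} h = H b"
      unfolding H_def by (rule Henstock_Kurzweil_Integration.integral_combine) (use hint that in auto)
    ultimately show ?thesis using that by simp
  qed
  have cont: "continuous_on {0..1} H"
    unfolding H_def by (rule indefinite_integral_continuous_1) (use hint in auto)
  have "\<exists>y. y \<in> {0..1} \<and> H y = real k / T" if "k \<le> T" for k
  proof -
    have "H 0 \<le> real k / T" "real k / T \<le> H 1"
      using that T c by (simp_all add: H_def h_def[abs_def] kint_def[symmetric])
    from IVT'[of H, OF this _ cont] show ?thesis by auto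
  qed
  then obtain y where y: "\<And>k. k \<le> T \<Longrightarrow> y k \<in> {0..1} \<and> H (y k) = real k / T" by metis
  have inj: "a = b" if "a \<in> {0..1}" "b \<in> {0..1}" "H a = H b" for a b
    using that Hdiff[of a b] Hdiff[of b a] hp[of a] hp[of b]
    by (cases a b rule: linorder_cases) (auto simp: mult_le_0_iff)
  have "y 0 = 0" by (rule inj) (use y[of 0] in \<open>auto simp: H_def\<close>)
  moreover have "y T = 1" by (rule inj) (use y[of T] T c in \<open>auto simp: H_def h_def[abs_def] kint_def[symmetric]\<close>)
  moreover have "y (Suc k) - y k \<le> (c + xlx (y (Suc k))) / T" if k: "k < T" for k
  proof -
    have yk: "y k \<in> {0..1}" "y (Suc k) \<in> {0..1}" "H (y (Suc k)) - H (y k) = 1 / T"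
      using y[of k] y[of "Suc k"] k T by (auto simp: field_simps)
    have p: "0 < c + xlx (y (Suc k))" using xlx_ge[of "y (Suc k)"] yk c by auto
    have "(y (Suc k) - y k) * h (y (Suc k)) \<le> 1 / T"
    proof (cases "y k \<le> y (Suc k)")
      case True
      then show ?thesis using Hdiff[of "y k" "y (Suc k)"] yk by auto
    next
      case False
      then have "(y (Suc k) - y k) * h (y (Suc k)) \<le> 0"
        using hp[OF yk(2)] by (intro mult_nonpos_nonneg) auto
      then show ?thesis using T by (auto intro: order_trans)
    qed
    then show ?thesis using p T by (simp add: h_def field_simps)
  qed
  ultimately show thesis using that y by blast
qed

text \<open>The multipliers \<open>y\<close> solve a discretised version of \<open>y' = c + y (1 - ln y)\<close>, which makes the
  right-hand side telescope.\<close>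

lemma kertz_sum:
  fixes g m :: "nat \<Rightarrow> real"
  assumes T: "0 < T" and g: "\<And>k. 0 \<le> g k"
    and m: "\<And>k y. k < T \<Longrightarrow> y \<in> {0..1} \<Longrightarrow> m k \<le> (1 - xlx y) * (g k / T) + y * (g k - g (Suc k))"
  shows "(\<Sum>k<T. m k) + g T \<le> (\<Sum>k<T. g k / T) / kertz_const"
proof -
  obtain c where c: "0 < c" "kint c = 1" and b: "kertz_const = inverse (1 + c)"
    by (rule kertz_const)
  obtain y where y0: "y 0 = 0" "y T = 1" and y1: "\<And>k. k \<le> T \<Longrightarrow> y k \<in> {0..1}"
    and y: "\<And>k. k < T \<Longrightarrow> y (Suc k) - y k \<le> (c + xlx (y (Suc k))) / T"
    by (rule kertz_grid[OF c T]) blast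
  \<comment> \<open>The weight \<open>y t\<close> of the boundary term runs from 0 to 1: the claim
    is trivial at the start and contains the full \<open>g T\<close> at the end.\<close>
  have "(\<Sum>k<t. m k) + y t * g t \<le> (\<Sum>k<t. g k / T) * (1 + c)" if "t \<le> T" for t
    using that
  proof (induction t)
    case (Suc t)
    \<comment> \<open>When the two bounds are added, the terms with \<open>xlx\<close> cancel and
      the constant rate 1 + c remains.\<close>
    have "(y (Suc t) - y t) * g t \<le> (c + xlx (y (Suc t))) / T * g t"
      using Suc.prems by (intro mult_right_mono y g) auto
    moreover have "m t \<le> (1 - xlx (y (Suc t))) * (g t / T) + y (Suc t) * (g t - g (Suc t))"
      using Suc.prems by (intro m y1) auto
    ultimately show ?case using Suc by (simp add: algebra_simps add_divide_distrib)
  qed (simp add: y0)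
  from this[of T] show ?thesis by (simp add: y0 b divide_inverse)
qed

text \<open>The tangent of \<open>1 - exp (- n)\<close> at n = - ln y, where its slope is y.\<close>

lemma exp_tangent:
  assumes "y \<in> {0..1}"
  shows "1 - exp (- n) \<le> (1 - xlx y) + y * (n :: real)"
proof (cases "y = 0")
  case False
  then have y: "0 < y" using assms by auto
  have "y * (1 + (- n - ln y)) \<le> y * exp (- n - ln y)"
    using y by (intro mult_left_mono exp_ge_add_one_self) auto
  also have "\<dots> = exp (- n)" using y by (simp add: exp_diff)
  finally show ?thesis by (simp add: xlx_def algebra_simps)
qed simp

text \<open>If \<open>N x\<close> is the mean of a Poisson number of values above \<open>x\<close>,
  the left side is the expected maximum and \<open>S\<close> the expected total excess. The
  half-line is cut at the Euler iterates. On the k-th piece, whose length is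
  \<open>S (W k) / T\<close>, the exponential is replaced by a tangent with free slope, and
  \<open>kertz_sum\<close> picks the slopes. The lengths add up to \<open>W T\<close>.\<close>

theorem kertz_integral:
  fixes W :: "nat \<Rightarrow> real" and N S :: "real \<Rightarrow> real"
  assumes T: "0 < T" and [measurable]: "N \<in> borel_measurable borel" and N: "\<And>x. 0 \<le> N x" and S: "\<And>x. 0 \<le> S x"
    and tail: "\<And>a. 0 \<le> a \<Longrightarrow> (\<integral>\<^sup>+x. ennreal (N x) * indicator {a..} x \<partial>lborel) = ennreal (S a)"
    and W0: "W 0 = 0" and W: "\<And>k. W (Suc k) = W k + S (W k) / T"
  shows "(\<integral>\<^sup>+x. ennreal (1 - exp (- N x)) * indicator {0..} x \<partial>lborel) \<le> ennreal (W T / kertz_const)"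
proof -
  have Wm: "W k \<le> W (Suc k)" for k using S[of "W k"] by (simp add: W)
  have Wp: "0 \<le> W k" for k using Wm W0 by (induction k) (auto intro: order_trans)
  define m where "m k = (\<integral>\<^sup>+x. ennreal (1 - exp (- N x)) * indicator {W k..<W (Suc k)} x \<partial>lborel)" for k
  have split: "(\<integral>\<^sup>+x. f x * indicator {a..} x \<partial>lborel) =
      (\<integral>\<^sup>+x. f x * indicator {a..<b} x \<partial>lborel) + (\<integral>\<^sup>+x. f x * indicator {b..} x \<partial>lborel)"
    if "a \<le> b" and [measurable]: "f \<in> borel_measurable borel" for a b :: real and f :: "real \<Rightarrow> ennreal"
  proof -
    have "f x * indicator {a..} x = f x * indicator {a..<b} x + f x * indicator {b..} x" for x
      using \<open>a \<le> b\<close> by (auto simp: indicator_def)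
    then show ?thesis by (simp add: nn_integral_add)
  qed
  have Nint: "(\<integral>\<^sup>+x. ennreal (N x) * indicator {W k..<W (Suc k)} x \<partial>lborel) = ennreal (S (W k) - S (W (Suc k)))"
    and Smono: "S (W (Suc k)) \<le> S (W k)" for k
  proof -
    have *: "ennreal (S (W k)) = (\<integral>\<^sup>+x. ennreal (N x) * indicator {W k..<W (Suc k)} x \<partial>lborel) + ennreal (S (W (Suc k)))"
      using split[OF Wm, of "\<lambda>x. ennreal (N x)" k] by (simp add: tail Wp)
    then show "S (W (Suc k)) \<le> S (W k)"
      by (metis S add.commute ennreal_le_iff le_iff_add)
    show "(\<integral>\<^sup>+x. ennreal (N x) * indicator {W k..<W (Suc k)} x \<partial>lborel) = ennreal (S (W k) - S (W (Suc k)))"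
      unfolding ennreal_minus[OF S, symmetric] * by simp
  qed
  have mle: "m k \<le> ennreal ((1 - xlx y) * (S (W k) / T) + y * (S (W k) - S (W (Suc k))))" if y: "y \<in> {0..1}" for k y
  proof -
    have x1: "0 \<le> 1 - xlx y" using xlx_le_1[of y] y by simp
    have d: "W (Suc k) - W k = S (W k) / T" by (simp add: W)
    have "m k \<le> (\<integral>\<^sup>+x. ennreal (1 - xlx y) * indicator {W k..<W (Suc k)} x + ennreal y * (ennreal (N x) * indicator {W k..<W (Suc k)} x) \<partial>lborel)"
      unfolding m_def
    proof (rule nn_integral_mono)
      fix x
      have "ennreal (1 - exp (- N x)) \<le> ennreal (1 - xlx y) + ennreal y * ennreal (N x)"
        using exp_tangent[OF y, of "N x"] x1 y N[of x]
        by (simp flip: ennreal_mult ennreal_plus add: ennreal_leI)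
      then show "ennreal (1 - exp (- N x)) * indicator {W k..<W (Suc k)} x \<le>
          ennreal (1 - xlx y) * indicator {W k..<W (Suc k)} x + ennreal y * (ennreal (N x) * indicator {W k..<W (Suc k)} x)"
        by (simp add: indicator_def)
    qed
    also have "\<dots> = ennreal (1 - xlx y) * ennreal (S (W k) / T) + ennreal y * ennreal (S (W k) - S (W (Suc k)))"
      using Wm[of k] d by (simp add: nn_integral_add nn_integral_cmult Nint nn_integral_cmult_indicator)
    also have "\<dots> = ennreal ((1 - xlx y) * (S (W k) / T) + y * (S (W k) - S (W (Suc k))))"
      using x1 y Smono[of k] S[of "W k"] by (simp flip: ennreal_mult ennreal_plus)
    finally show ?thesis .
  qed
  have fin: "m k < \<top>" for k using mle[of 0 k] by (auto intro: le_less_trans)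
  have "(\<integral>\<^sup>+x. ennreal (1 - exp (- N x)) * indicator {0..} x \<partial>lborel) =
      (\<Sum>k<t. m k) + (\<integral>\<^sup>+x. ennreal (1 - exp (- N x)) * indicator {W t..} x \<partial>lborel)" for t
  proof (induction t)
    case (Suc t)
    then show ?case
      using split[OF Wm, of "\<lambda>x. ennreal (1 - exp (- N x))" t] by (simp add: m_def add.assoc)
  qed (simp add: W0)
  \<comment> \<open>Beyond \<open>W T\<close> the tangent at 0, of slope 1, is used; this is the
    boundary term \<open>g T\<close> of \<open>kertz_sum\<close>.\<close>
  also have "(\<integral>\<^sup>+x. ennreal (1 - exp (- N x)) * indicator {W T..} x \<partial>lborel) \<le> ennreal (S (W T))"
    unfolding tail[OF Wp, symmetric]
    by (intro nn_integral_mono mult_right_mono ennreal_leI) (use exp_ge_add_one_self[of "- N _"] in \<open>auto simp: algebra_simps\<close>)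
  also have "(\<Sum>k<T. m k) = ennreal (\<Sum>k<T. enn2real (m k))"
    using fin by (simp flip: sum_ennreal)
  also have "ennreal (\<Sum>k<T. enn2real (m k)) + ennreal (S (W T)) = ennreal ((\<Sum>k<T. enn2real (m k)) + S (W T))"
    by (simp add: S sum_nonneg)
  also have "\<dots> \<le> ennreal ((\<Sum>k<T. S (W k) / T) / kertz_const)"
  proof (intro ennreal_leI kertz_sum[where g = "\<lambda>k. S (W k)"] T S)
    fix k and y :: real assume y: "y \<in> {0..1}"
    have "0 \<le> (1 - xlx y) * (S (W k) / T) + y * (S (W k) - S (W (Suc k)))"
      using xlx_le_1[of y] y S[of "W k"] Smono[of k] by auto
    then show "enn2real (m k) \<le> (1 - xlx y) * (S (W k) / T) + y * (S (W k) - S (W (Suc k)))"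
      using enn2real_mono[OF mle[OF y, of k]] by (simp add: enn2real_ennreal)
  qed
  also have "(\<Sum>k<t. S (W k) / T) = W t" for t
    by (induction t) (simp_all add: W0 W)
  finally show ?thesis by (simp add: add_left_mono)
qed

subsection \<open>Tail integrals and expected maxima\<close>

text \<open>Layer-cake formula: Fubini for the region between \<open>a\<close> and the graph of
  \<open>Z\<close>.\<close>

lemma nn_integral_excess:
  fixes Z :: "'a \<Rightarrow> real"
  assumes "prob_space M" and [measurable]: "Z \<in> borel_measurable M"
  shows "(\<integral>\<^sup>+\<omega>. ennreal (Z \<omega> - a) \<partial>M) =
    (\<integral>\<^sup>+x. ennreal (measure M {\<omega>\<in>space M. x < Z \<omega>}) * indicator {a..} x \<partial>lborel)"
proof -
  interpret prob_space M by fact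
  interpret pair_sigma_finite M lborel ..
  have 1: "ennreal (Z \<omega> - a) = (\<integral>\<^sup>+x. indicator {a..} x * indicator {..<Z \<omega>} x \<partial>lborel)" for \<omega>
  proof -
    have "(\<integral>\<^sup>+x. indicator {a..} x * indicator {..<Z \<omega>} x \<partial>lborel) = (\<integral>\<^sup>+x. indicator {a..<Z \<omega>} x \<partial>lborel)"
      by (intro nn_integral_cong) (auto simp: indicator_def)
    also have "\<dots> = ennreal (Z \<omega> - a)"
      by (cases "a \<le> Z \<omega>") (auto simp: ennreal_neg)
    finally show ?thesis ..
  qed
  have "(\<integral>\<^sup>+\<omega>. ennreal (Z \<omega> - a) \<partial>M) = (\<integral>\<^sup>+\<omega>. \<integral>\<^sup>+x. indicator {a..} x * indicator {..<Z \<omega>} x \<partial>lborel \<partial>M)"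
    by (simp add: 1)
  also have "\<dots> = (\<integral>\<^sup>+x. \<integral>\<^sup>+\<omega>. indicator {a..} x * indicator {..<Z \<omega>} x \<partial>M \<partial>lborel)"
  proof (rule Fubini'[symmetric])
    have "(\<lambda>p. indicator {a..} (snd p) * (if snd p < Z (fst p) then 1 else 0) :: ennreal) \<in> borel_measurable (M \<Otimes>\<^sub>M lborel)"
      by measurable
    then show "(\<lambda>(\<omega>, x). indicator {a..} x * indicator {..<Z \<omega>} x :: ennreal) \<in> borel_measurable (M \<Otimes>\<^sub>M lborel)"
      by (simp add: indicator_def case_prod_beta cong: if_cong)
  qed
  also have "\<dots> = (\<integral>\<^sup>+x. ennreal (measure M {\<omega>\<in>space M. x < Z \<omega>}) * indicator {a..} x \<partial>lborel)"
  proof (rule nn_integral_cong)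
    fix x
    have "(\<integral>\<^sup>+\<omega>. indicator {a..} x * indicator {..<Z \<omega>} x \<partial>M) =
        (\<integral>\<^sup>+\<omega>. indicator {a..} x * indicator {\<omega>\<in>space M. x < Z \<omega>} \<omega> \<partial>M)"
      by (intro nn_integral_cong) (auto simp: indicator_def)
    then show "(\<integral>\<^sup>+\<omega>. indicator {a..} x * indicator {..<Z \<omega>} x \<partial>M) =
        ennreal (measure M {\<omega>\<in>space M. x < Z \<omega>}) * indicator {a..} x"
      by (simp add: nn_integral_cmult emeasure_eq_measure mult.commute)
  qed
  finally show ?thesis .
qed

lemma PiM_cong_prob:
  assumes "\<And>j. j \<in> J \<Longrightarrow> prob_space (D j)"
  obtains D' :: "'i \<Rightarrow> 'a measure" where "PiM J D = PiM J D'" "\<And>j. prob_space (D' j)" "\<And>j. j \<in> J \<Longrightarrow> D' j = D j"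
proof (rule that[of "\<lambda>j. if j \<in> J then D j else return (count_space UNIV) undefined"])
  show "PiM J D = PiM J (\<lambda>j. if j \<in> J then D j else return (count_space UNIV) undefined)"
    by (rule PiM_cong) auto
qed (auto intro: assms prob_space_return)

lemma prob_space_PiM':
  assumes "\<And>j. j \<in> J \<Longrightarrow> prob_space (D j)"
  shows "prob_space (PiM J D)"
proof (rule PiM_cong_prob[OF assms])
  fix D' assume eq: "PiM J D = PiM J D'" and D': "\<And>j. prob_space (D' j)"
  show "prob_space (PiM J D)" unfolding eq using D' by (rule prob_space_PiM)
qed

lemma nn_integral_PiM_prod:
  assumes "finite J" "\<And>j. j \<in> J \<Longrightarrow> prob_space (D j)" "\<And>j. j \<in> J \<Longrightarrow> f j \<in> borel_measurable (D j)"
  shows "(\<integral>\<^sup>+x. (\<Prod>j\<in>J. f j (x j)) \<partial>PiM J D) = (\<Prod>j\<in>J. \<integral>\<^sup>+v. f j v \<partial>D j)"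
proof -
  obtain D' where D': "PiM J D = PiM J D'" "\<And>j. prob_space (D' j)" "\<And>j. j \<in> J \<Longrightarrow> D' j = D j"
    by (rule PiM_cong_prob[OF assms(2)], assumption, rule that; assumption)
  interpret product_sigma_finite D'
    by (simp add: product_sigma_finite_def prob_space_imp_sigma_finite[OF D'(2)])
  show ?thesis
    unfolding D'(1) using assms(1,3) D'(3) by (subst product_nn_integral_prod) simp_all
qed

definition finite_mean :: "real measure \<Rightarrow> bool" where
  "finite_mean \<mu> \<longleftrightarrow> (\<integral>\<^sup>+v. ennreal v \<partial>\<mu>) < \<top>"

lemma nonneg_lawD:
  assumes "nonneg_law \<mu>"
  shows "prob_space \<mu>" "sets \<mu> = sets borel" "space \<mu> = UNIV"
  using assms sets_eq_imp_space_eq[of \<mu> borel] by (auto simp: nonneg_law_def)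

lemma borel_measurable_nonneg_law:
  assumes "nonneg_law \<mu>" "f \<in> borel_measurable borel"
  shows "f \<in> borel_measurable \<mu>"
  using assms(2) measurable_cong_sets[OF nonneg_lawD(2)[OF assms(1)] refl] by blast

text \<open>The layer-cake formula for the maximum; independence turns the probability that all
  values are at most x into a product.\<close>

lemma expected_max_tail:
  assumes "finite J" "J \<noteq> {}" "\<And>j. j \<in> J \<Longrightarrow> nonneg_law (D j)"
  shows "expected_max D J =
    (\<integral>\<^sup>+x. ennreal (1 - (\<Prod>j\<in>J. 1 - measure (D j) {x<..})) * indicator {0..} x \<partial>lborel)"
proof -
  have D: "prob_space (D j)" "sets (D j) = sets borel" "space (D j) = UNIV" if "j \<in> J" for j
    using nonneg_lawD[OF assms(3)[OF that]] by auto
  interpret P: prob_space "PiM J D" by (rule prob_space_PiM') (rule D)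
  let ?Z = "\<lambda>x. MAX j\<in>J. x j"
  have [measurable]: "(\<lambda>x. x j) \<in> borel_measurable (PiM J D)" if "j \<in> J" for j
    using measurable_component_singleton[OF that, of D] measurable_cong_sets[OF refl D(2)[OF that]] by blast
  have Zm: "?Z \<in> borel_measurable (PiM J D)"
    using assms(1,2) by (intro borel_measurable_Max) auto
  have "expected_max D J = (\<integral>\<^sup>+x. ennreal (?Z x - 0) \<partial>PiM J D)"
    unfolding expected_max_def
  proof (rule nn_integral_cong)
    fix x :: "nat \<Rightarrow> real"
    have "(\<Squnion>i\<in>J. ennreal (x i)) = Max ((\<lambda>i. ennreal (x i)) ` J)"
      using assms(1,2) by (simp add: Max_Sup)
    also have "\<dots> = ennreal (?Z x)"
      using mono_Max_commute[of ennreal "x ` J"] assms(1,2) by (simp add: mono_def ennreal_leI image_image)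
    finally show "(\<Squnion>i\<in>J. ennreal (x i)) = ennreal (?Z x - 0)" by simp
  qed
  also have "\<dots> = (\<integral>\<^sup>+t. ennreal (measure (PiM J D) {x\<in>space (PiM J D). t < ?Z x}) * indicator {0..} t \<partial>lborel)"
    by (rule nn_integral_excess[OF P.prob_space_axioms Zm])
  also have "\<dots> = (\<integral>\<^sup>+x. ennreal (1 - (\<Prod>j\<in>J. 1 - measure (D j) {x<..})) * indicator {0..} x \<partial>lborel)"
  proof (rule nn_integral_cong, rule arg_cong2[where f = "\<lambda>a b. ennreal a * b"])
    fix t :: real
    let ?A = "{x\<in>space (PiM J D). ?Z x \<le> t}"
    have A: "?A \<in> sets (PiM J D)" using Zm by measurable
    have "emeasure (PiM J D) ?A = (\<integral>\<^sup>+x. indicator ?A x \<partial>PiM J D)"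
      using A by simp
    also have "\<dots> = (\<integral>\<^sup>+x. (\<Prod>j\<in>J. indicator {..t} (x j)) \<partial>PiM J D)"
    proof (rule nn_integral_cong)
      fix x assume "x \<in> space (PiM J D)"
      then show "indicator ?A x = (\<Prod>j\<in>J. indicator {..t} (x j) :: ennreal)"
        using assms(1,2) by (cases "\<forall>j\<in>J. x j \<le> t") (auto simp: prod_zero_iff indicator_def)
    qed
    also have "\<dots> = (\<Prod>j\<in>J. \<integral>\<^sup>+v. indicator {..t} v \<partial>D j)"
      by (rule nn_integral_PiM_prod[OF assms(1) D(1)]) (auto simp: measurable_cong_sets[OF D(2) refl])
    also have "\<dots> = (\<Prod>j\<in>J. ennreal (1 - measure (D j) {t<..}))"
    proof (rule prod.cong[OF refl])
      fix j assume j: "j \<in> J"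
      interpret prob_space "D j" by (rule D(1)[OF j])
      have "measure (D j) (space (D j) - {t<..}) = 1 - measure (D j) {t<..}"
        by (rule prob_compl) (simp add: D(2)[OF j])
      moreover have "space (D j) - {t<..} = {..t}" using D(3)[OF j] by auto
      ultimately show "(\<integral>\<^sup>+v. indicator {..t} v \<partial>D j) = ennreal (1 - measure (D j) {t<..})"
        by (simp add: D(2)[OF j] emeasure_eq_measure)
    qed
    also have "\<dots> = ennreal (\<Prod>j\<in>J. 1 - measure (D j) {t<..})"
      by (rule prod_ennreal) (use D(1) prob_space.prob_le_1 in \<open>auto simp: measure_def\<close>)
    finally have "measure (PiM J D) ?A = (\<Prod>j\<in>J. 1 - measure (D j) {t<..})"
      using D(1) by (subst (asm) P.emeasure_eq_measure, subst (asm) ennreal_inj)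
        (auto intro!: prod_nonneg prob_space.prob_le_1)
    moreover have "measure (PiM J D) {x\<in>space (PiM J D). t < ?Z x} = 1 - measure (PiM J D) ?A"
      using P.prob_compl[OF A] by (simp add: set_diff_eq not_le cong: conj_cong)
    ultimately show "measure (PiM J D) {x\<in>space (PiM J D). t < ?Z x} = 1 - (\<Prod>j\<in>J. 1 - measure (D j) {t<..})"
      by simp
  qed simp
  finally show ?thesis .
qed

text \<open>The top-\<open>\<delta>\<close> part of a law: mass \<open>\<delta>\<close> above a quantile \<open>q\<close>, the rest being moved to \<open>0\<close>. If the
  law has an atom at \<open>q\<close>, then only a part of the atom belongs to it.\<close>

definition quantile :: "real \<Rightarrow> real measure \<Rightarrow> real \<Rightarrow> bool" where
  "quantile \<delta> \<mu> q \<longleftrightarrow> 0 \<le> q \<and> measure \<mu> {q<..} \<le> \<delta> \<and> \<delta> \<le> measure \<mu> {q..}"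

definition excess :: "real measure \<Rightarrow> real \<Rightarrow> real" where
  "excess \<mu> a = enn2real (\<integral>\<^sup>+v. ennreal (v - a) \<partial>\<mu>)"

definition gain_on :: "real measure \<Rightarrow> real set \<Rightarrow> real" where
  "gain_on \<mu> A = enn2real (\<integral>\<^sup>+v. ennreal v * indicator A v \<partial>\<mu>)"

definition top_tail :: "real \<Rightarrow> real \<Rightarrow> real measure \<Rightarrow> real \<Rightarrow> real" where
  "top_tail \<delta> q \<mu> x = (if x < q then \<delta> else measure \<mu> {x<..})"

text \<open>The expected excess of the top part over \<open>w\<close>; for \<open>w \<ge> 0\<close>
  it is the integral of \<open>top_tail\<close> from \<open>w\<close> to infinity.\<close>

definition top_excess :: "real \<Rightarrow> real \<Rightarrow> real measure \<Rightarrow> real \<Rightarrow> real" where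
  "top_excess \<delta> q \<mu> w = excess \<mu> (max w q) + \<delta> * max 0 (q - w)"

text \<open>The expected value collected by accepting the top part above \<open>w\<close>: every
  accepted value is \<open>w\<close> plus its excess.\<close>

definition top_gain :: "real \<Rightarrow> real \<Rightarrow> real measure \<Rightarrow> real \<Rightarrow> real" where
  "top_gain \<delta> q \<mu> w = top_excess \<delta> q \<mu> w + w * top_tail \<delta> q \<mu> w"

lemma excess_nonneg: "0 \<le> excess \<mu> a"
  by (simp add: excess_def)

lemma gain_on_nonneg: "0 \<le> gain_on \<mu> A"
  by (simp add: gain_on_def)

lemma ennreal_excess:
  assumes "finite_mean \<mu>" "0 \<le> a"
  shows "(\<integral>\<^sup>+v. ennreal (v - a) \<partial>\<mu>) = ennreal (excess \<mu> a)"
proof -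
  have "(\<integral>\<^sup>+v. ennreal (v - a) \<partial>\<mu>) \<le> (\<integral>\<^sup>+v. ennreal v \<partial>\<mu>)"
    using assms(2) by (intro nn_integral_mono ennreal_leI) auto
  then show ?thesis
    using assms(1) by (auto simp: excess_def finite_mean_def intro: le_less_trans)
qed

lemma ennreal_gain_on:
  assumes "finite_mean \<mu>"
  shows "(\<integral>\<^sup>+v. ennreal v * indicator A v \<partial>\<mu>) = ennreal (gain_on \<mu> A)"
proof -
  have "(\<integral>\<^sup>+v. ennreal v * indicator A v \<partial>\<mu>) \<le> (\<integral>\<^sup>+v. ennreal v \<partial>\<mu>)"
    by (intro nn_integral_mono) (auto simp: indicator_def)
  then show ?thesis
    using assms(1) by (auto simp: gain_on_def finite_mean_def intro: le_less_trans)
qed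

lemma top_tail_antimono:
  assumes "nonneg_law \<mu>" "quantile \<delta> \<mu> q" "x \<le> y"
  shows "top_tail \<delta> q \<mu> y \<le> top_tail \<delta> q \<mu> x"
proof -
  interpret prob_space \<mu> using nonneg_lawD[OF assms(1)] by simp
  have "measure \<mu> {y<..} \<le> measure \<mu> {z<..}" if "z \<le> y" for z
    using that nonneg_lawD[OF assms(1)] by (intro finite_measure_mono) auto
  from this[of x] this[of q] show ?thesis
    using assms(2,3) by (auto simp: top_tail_def quantile_def)
qed

lemma top_tail_bounds:
  assumes "nonneg_law \<mu>" "quantile \<delta> \<mu> q" "0 \<le> \<delta>"
  shows "0 \<le> top_tail \<delta> q \<mu> x" "top_tail \<delta> q \<mu> x \<le> \<delta>"
  using assms(3) top_tail_antimono[OF assms(1,2), of "min x (q - 1)" x] by (auto simp: top_tail_def)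

lemma measurable_top_tail:
  assumes "nonneg_law \<mu>" "quantile \<delta> \<mu> q"
  shows "top_tail \<delta> q \<mu> \<in> borel_measurable borel"
proof -
  have "(\<lambda>x. - top_tail \<delta> q \<mu> x) \<in> borel_measurable borel"
    by (rule borel_measurable_mono) (auto simp: mono_def intro: top_tail_antimono assms)
  then have "(\<lambda>x. - (- top_tail \<delta> q \<mu> x)) \<in> borel_measurable borel"
    by (rule borel_measurable_uminus)
  then show ?thesis by simp
qed

lemma top_excess_nonneg: "0 \<le> \<delta> \<Longrightarrow> 0 \<le> top_excess \<delta> q \<mu> w"
  by (simp add: top_excess_def excess_nonneg)

lemma nn_integral_top_tail:
  assumes \<mu>: "nonneg_law \<mu>" "finite_mean \<mu>" and q: "quantile \<delta> \<mu> q" and \<delta>: "0 \<le> \<delta>" and a: "0 \<le> a"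
  shows "(\<integral>\<^sup>+x. ennreal (top_tail \<delta> q \<mu> x) * indicator {a..} x \<partial>lborel) = ennreal (top_excess \<delta> q \<mu> a)"
proof -
  note [measurable] = measurable_top_tail[OF \<mu>(1) q]
  have *: "(\<integral>\<^sup>+x. ennreal (top_tail \<delta> q \<mu> x) * indicator {b..} x \<partial>lborel) = ennreal (excess \<mu> b)" if b: "q \<le> b" "0 \<le> b" for b
  proof -
    have "(\<integral>\<^sup>+x. ennreal (top_tail \<delta> q \<mu> x) * indicator {b..} x \<partial>lborel) =
        (\<integral>\<^sup>+x. ennreal (measure \<mu> {v\<in>space \<mu>. x < v}) * indicator {b..} x \<partial>lborel)"
      using b nonneg_lawD[OF \<mu>(1)]
      by (intro nn_integral_cong) (auto simp: top_tail_def indicator_def greaterThan_def)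
    also have "\<dots> = (\<integral>\<^sup>+v. ennreal (v - b) \<partial>\<mu>)"
      by (intro nn_integral_excess[symmetric] nonneg_lawD(1)[OF \<mu>(1)] borel_measurable_nonneg_law[OF \<mu>(1)]) simp
    finally show ?thesis by (simp add: ennreal_excess[OF \<mu>(2) b(2)])
  qed
  show ?thesis
  proof (cases "q \<le> a")
    case True
    then show ?thesis using *[of a] a by (simp add: top_excess_def max_absorb1)
  next
    case False
    have "ennreal (top_tail \<delta> q \<mu> x) * indicator {a..} x =
        ennreal \<delta> * indicator {a..<q} x + ennreal (top_tail \<delta> q \<mu> x) * indicator {q..} x" for x
      using False by (auto simp: top_tail_def indicator_def)
    then have "(\<integral>\<^sup>+x. ennreal (top_tail \<delta> q \<mu> x) * indicator {a..} x \<partial>lborel) =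
        ennreal \<delta> * ennreal (q - a) + ennreal (excess \<mu> q)"
      using False a *[of q] by (simp add: nn_integral_add nn_integral_cmult_indicator)
    also have "\<dots> = ennreal (top_excess \<delta> q \<mu> a)"
      using False \<delta> excess_nonneg[of \<mu> q]
      by (simp add: top_excess_def max_def add.commute flip: ennreal_mult ennreal_plus)
    finally show ?thesis .
  qed
qed

lemma gain_on_greater:
  assumes \<mu>: "nonneg_law \<mu>" "finite_mean \<mu>" and a: "0 \<le> a"
  shows "gain_on \<mu> {a<..} = excess \<mu> a + a * measure \<mu> {a<..}"
proof -
  interpret prob_space \<mu> using nonneg_lawD[OF \<mu>(1)] by simp
  have m: "(\<lambda>v. ennreal (v - a)) \<in> borel_measurable \<mu>" "{a<..} \<in> sets \<mu>"
    by (auto simp: nonneg_lawD(2)[OF \<mu>(1)] intro!: borel_measurable_nonneg_law[OF \<mu>(1)])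
  have "ennreal v * indicator {a<..} v = ennreal (v - a) + ennreal a * indicator {a<..} v" for v
    using a by (auto simp: indicator_def ennreal_neg simp flip: ennreal_plus)
  then have "(\<integral>\<^sup>+v. ennreal v * indicator {a<..} v \<partial>\<mu>) = (\<integral>\<^sup>+v. ennreal (v - a) \<partial>\<mu>) + ennreal a * emeasure \<mu> {a<..}"
    using m by (simp add: nn_integral_add nn_integral_cmult_indicator)
  also have "\<dots> = ennreal (excess \<mu> a + a * measure \<mu> {a<..})"
    using a excess_nonneg[of \<mu> a]
    by (simp add: ennreal_excess[OF \<mu>(2) a] emeasure_eq_measure flip: ennreal_mult ennreal_plus)
  finally show ?thesis
    using a excess_nonneg[of \<mu> a] unfolding gain_on_def by (simp add: enn2real_ennreal del: ennreal_plus)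
qed

lemma gain_on_atLeast:
  assumes \<mu>: "nonneg_law \<mu>" "finite_mean \<mu>" and a: "0 \<le> a"
  shows "gain_on \<mu> {a..} = gain_on \<mu> {a<..} + a * (measure \<mu> {a..} - measure \<mu> {a<..})"
proof -
  interpret prob_space \<mu> using nonneg_lawD[OF \<mu>(1)] by simp
  have m: "(\<lambda>v. ennreal v) \<in> borel_measurable \<mu>" "{a<..} \<in> sets \<mu>" "{a} \<in> sets \<mu>"
    by (auto simp: nonneg_lawD(2)[OF \<mu>(1)] intro!: borel_measurable_nonneg_law[OF \<mu>(1)])
  have 1: "{a..} = {a} \<union> {a<..}" by auto
  have d: "measure \<mu> {a..} - measure \<mu> {a<..} = measure \<mu> {a}"
    unfolding 1 using m by (subst finite_measure_Union) auto
  have "ennreal v * indicator {a..} v = ennreal v * indicator {a<..} v + ennreal a * indicator {a} v" for v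
    by (auto simp: indicator_def)
  then have "(\<integral>\<^sup>+v. ennreal v * indicator {a..} v \<partial>\<mu>) = ennreal (gain_on \<mu> {a<..}) + ennreal a * emeasure \<mu> {a}"
    using m by (simp add: nn_integral_add nn_integral_cmult_indicator ennreal_gain_on[OF \<mu>(2)])
  also have "\<dots> = ennreal (gain_on \<mu> {a<..} + a * measure \<mu> {a})"
    using a gain_on_nonneg[of \<mu> "{a<..}"]
    by (simp add: emeasure_eq_measure flip: ennreal_mult ennreal_plus)
  finally have "gain_on \<mu> {a..} = gain_on \<mu> {a<..} + a * measure \<mu> {a}"
    using a gain_on_nonneg[of \<mu> "{a<..}"] unfolding gain_on_def[of \<mu> "{a..}"]
    by (simp del: ennreal_plus)
  then show ?thesis by (simp only: d)
qed

text \<open>For \<open>w < q\<close>, the top-\<open>\<delta>\<close> part is a mixture of the events \<open>{q..}\<close> and \<open>{q<..}\<close>.\<close>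

lemma top_part_dominated:
  assumes \<mu>: "nonneg_law \<mu>" "finite_mean \<mu>" and q: "quantile \<delta> \<mu> q" and w: "0 \<le> w"
  shows "\<exists>A\<in>{{w<..}, {q..}, {q<..}}.
    \<alpha> * top_gain \<delta> q \<mu> w - \<gamma> * top_tail \<delta> q \<mu> w \<le> \<alpha> * gain_on \<mu> A - \<gamma> * measure \<mu> A"
proof (cases "w < q")
  case False
  then have "top_gain \<delta> q \<mu> w = gain_on \<mu> {w<..}" "top_tail \<delta> q \<mu> w = measure \<mu> {w<..}"
    by (simp_all add: top_gain_def top_excess_def top_tail_def gain_on_greater[OF \<mu> w] max_absorb1)
  then show ?thesis by auto
next
  case True
  let ?a = "measure \<mu> {q<..}" and ?b = "measure \<mu> {q..}"
  have q0: "0 \<le> q" "?a \<le> \<delta>" "\<delta> \<le> ?b" using q by (auto simp: quantile_def)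
  \<comment> \<open>The weight of the closed event \<open>{q..}\<close> in the mixture of total mass
    \<delta>. An objective that is linear in gain and mass is then at most its value at one of the
    two events.\<close>
  obtain l where l: "0 \<le> l" "l \<le> 1" "\<delta> = l * ?b + (1 - l) * ?a"
  proof (cases "?a = ?b")
    case True
    then show thesis using that[of 0] q0 by simp
  next
    case False
    let ?l = "(\<delta> - ?a) / (?b - ?a)"
    have "l * b + (1 - l) * a = a + l * (b - a)" for a b l :: real by (simp add: algebra_simps)
    then have "?l * ?b + (1 - ?l) * ?a = ?a + ?l * (?b - ?a)" .
    also have "\<dots> = \<delta>" using False by simp
    finally show thesis
      using that[of ?l] q0 False by (simp add: divide_le_eq)
  qed
  have "top_gain \<delta> q \<mu> w = excess \<mu> q + \<delta> * q"
    using True by (simp add: top_gain_def top_excess_def top_tail_def max_def algebra_simps)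
  also have "\<dots> = l * gain_on \<mu> {q..} + (1 - l) * gain_on \<mu> {q<..}"
    by (simp add: gain_on_atLeast[OF \<mu> q0(1)] gain_on_greater[OF \<mu> q0(1)] l(3)) (simp add: algebra_simps)
  finally have g: "top_gain \<delta> q \<mu> w = l * gain_on \<mu> {q..} + (1 - l) * gain_on \<mu> {q<..}" .
  have t: "top_tail \<delta> q \<mu> w = l * ?b + (1 - l) * ?a" using True l(3) by (simp add: top_tail_def)
  let ?B = "\<alpha> * gain_on \<mu> {q..} - \<gamma> * ?b" and ?A = "\<alpha> * gain_on \<mu> {q<..} - \<gamma> * ?a"
  have "\<alpha> * top_gain \<delta> q \<mu> w - \<gamma> * top_tail \<delta> q \<mu> w = l * ?B + (1 - l) * ?A"
    unfolding g t by (simp add: algebra_simps)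
  also have "\<dots> \<le> l * max ?B ?A + (1 - l) * max ?B ?A"
    using l by (intro add_mono mult_left_mono) auto
  also have "\<dots> = max ?B ?A" by (simp add: algebra_simps)
  finally show ?thesis by (auto simp: max_def split: if_splits)
qed

subsection \<open>Thresholds from the Euler scheme\<close>

primrec euler :: "(real \<Rightarrow> real) \<Rightarrow> nat \<Rightarrow> nat \<Rightarrow> real" where
  "euler S T 0 = 0"
| "euler S T (Suc k) = euler S T k + S (euler S T k) / T"

text \<open>\<open>r i k\<close> is the expected reward that variable \<open>i\<close> collects in
  slot \<open>k\<close>, and \<open>u j k\<close> the probability that \<open>j\<close> would be
  accepted in slot \<open>k\<close> or in one inspected before it. Counting the other variables of
  slot \<open>k\<close> as if all came before \<open>i\<close> can only lower the value, so that the
  order within a slot does not matter.\<close>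

definition reward_bound :: "nat \<Rightarrow> nat set \<Rightarrow> (nat \<Rightarrow> nat \<Rightarrow> real) \<Rightarrow> (nat \<Rightarrow> nat \<Rightarrow> real) \<Rightarrow> real" where
  "reward_bound T J u r = (\<Sum>k<T. \<Sum>i\<in>J. r i k * (\<Prod>j\<in>J - {i}. 1 - u j k))"

text \<open>In the applications \<open>T\<close> is the number of all variables, removed ones
  included. With \<open>card J \<le> T\<close> and uniform slots, the expected number of acceptances
  within one slot is at most \<delta>.\<close>

locale small_laws =
  fixes D :: "nat \<Rightarrow> real measure" and J :: "nat set" and q :: "nat \<Rightarrow> real" and \<delta> :: real and T :: nat
  assumes finite_J: "finite J" and T_pos: "0 < T" and card_J: "card J \<le> T"
    and \<delta>_pos: "0 < \<delta>" and \<delta>_le: "\<delta> \<le> 1/4"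
    and law: "\<And>j. j \<in> J \<Longrightarrow> nonneg_law (D j)" and mean: "\<And>j. j \<in> J \<Longrightarrow> finite_mean (D j)"
    and quant: "\<And>j. j \<in> J \<Longrightarrow> quantile \<delta> (D j) (q j)"
begin

definition tails :: "real \<Rightarrow> real" where
  "tails x = (\<Sum>j\<in>J. top_tail \<delta> (q j) (D j) x)"

definition slope :: "real \<Rightarrow> real" where
  "slope w = (1 + 2 * \<delta>) * (\<Sum>j\<in>J. top_excess \<delta> (q j) (D j) w)"

definition W :: "nat \<Rightarrow> real" where
  "W = euler slope T"

lemma W_simps: "W 0 = 0" "W (Suc k) = W k + slope (W k) / T"
  by (simp_all add: W_def)

lemma slope_nonneg: "0 \<le> slope w"
  unfolding slope_def using \<delta>_pos by (intro mult_nonneg_nonneg sum_nonneg top_excess_nonneg) auto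

lemma W_nonneg: "0 \<le> W k"
  by (induction k) (simp_all add: W_simps slope_nonneg)

lemma tails_nonneg: "0 \<le> tails x"
  unfolding tails_def using \<delta>_pos law quant by (intro sum_nonneg top_tail_bounds) auto

lemma tails_le: "tails x \<le> \<delta> * T"
proof -
  have "tails x \<le> (\<Sum>j\<in>J. \<delta>)"
    unfolding tails_def using \<delta>_pos law quant by (intro sum_mono top_tail_bounds) auto
  also have "\<dots> \<le> \<delta> * T" using card_J \<delta>_pos by simp
  finally show ?thesis .
qed

lemma measurable_tails: "tails \<in> borel_measurable borel"
  unfolding tails_def[abs_def] using measurable_top_tail law quant by (intro borel_measurable_sum) auto

lemma kertz_tails:
  "(\<integral>\<^sup>+x. ennreal (1 - exp (- ((1 + 2 * \<delta>) * tails x))) * indicator {0..} x \<partial>lborel) \<le> ennreal (W T / kertz_const)"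
proof (rule kertz_integral[where S = slope and W = W and T = T])
  fix a :: real assume a: "0 \<le> a"
  have m: "(\<lambda>x. ennreal (top_tail \<delta> (q j) (D j) x) * indicator {a..} x) \<in> borel_measurable borel" if "j \<in> J" for j
    using measurable_top_tail[OF law[OF that] quant[OF that]] by simp
  have "ennreal ((1 + 2 * \<delta>) * tails x) = ennreal (1 + 2 * \<delta>) * (\<Sum>j\<in>J. ennreal (top_tail \<delta> (q j) (D j) x))" for x
  proof -
    have "(\<Sum>j\<in>J. ennreal (top_tail \<delta> (q j) (D j) x)) = ennreal (tails x)"
      unfolding tails_def using \<delta>_pos law quant by (intro sum_ennreal top_tail_bounds) auto
    then show ?thesis using \<delta>_pos tails_nonneg by (simp add: ennreal_mult)
  qed
  then have "(\<integral>\<^sup>+x. ennreal ((1 + 2 * \<delta>) * tails x) * indicator {a..} x \<partial>lborel) =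
      (\<integral>\<^sup>+x. ennreal (1 + 2 * \<delta>) * (\<Sum>j\<in>J. ennreal (top_tail \<delta> (q j) (D j) x) * indicator {a..} x) \<partial>lborel)"
    by (simp add: sum_distrib_right mult.assoc)
  also have "\<dots> = ennreal (1 + 2 * \<delta>) * (\<Sum>j\<in>J. \<integral>\<^sup>+x. ennreal (top_tail \<delta> (q j) (D j) x) * indicator {a..} x \<partial>lborel)"
    by (subst nn_integral_cmult) (auto intro!: borel_measurable_sum m nn_integral_sum arg_cong2[where f = "(*)"])
  also have "\<dots> = ennreal (1 + 2 * \<delta>) * (\<Sum>j\<in>J. ennreal (top_excess \<delta> (q j) (D j) a))"
    using \<delta>_pos a by (intro arg_cong2[where f = "(*)"] sum.cong nn_integral_top_tail law mean quant) auto
  also have "(\<Sum>j\<in>J. ennreal (top_excess \<delta> (q j) (D j) a)) = ennreal (\<Sum>j\<in>J. top_excess \<delta> (q j) (D j) a)"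
    using \<delta>_pos by (intro sum_ennreal top_excess_nonneg) auto
  also have "ennreal (1 + 2 * \<delta>) * \<dots> = ennreal (slope a)"
    unfolding slope_def using \<delta>_pos by (intro ennreal_mult[symmetric] sum_nonneg top_excess_nonneg) auto
  finally show "(\<integral>\<^sup>+x. ennreal ((1 + 2 * \<delta>) * tails x) * indicator {a..} x \<partial>lborel) = ennreal (slope a)" .
qed (use T_pos \<delta>_pos measurable_tails in \<open>auto simp: W_simps slope_nonneg tails_nonneg\<close>)

text \<open>Since the top parts have mass at most \<open>\<delta>\<close>, the factor \<open>1 + 2 \<delta>\<close> makes the Poisson
  approximation an upper bound.\<close>

lemma one_minus_ge_exp:
  assumes "0 \<le> u" "u \<le> \<delta>"
  shows "exp (- ((1 + 2 * \<delta>) * u)) \<le> 1 - u"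
proof -
  have "- u - 2 * u\<^sup>2 \<le> ln (1 - u)"
    using assms \<delta>_le by (intro ln_one_minus_pos_lower_bound) auto
  moreover have "u * u \<le> \<delta> * u" using assms by (intro mult_right_mono) auto
  ultimately have "- ((1 + 2 * \<delta>) * u) \<le> ln (1 - u)"
    by (simp add: power2_eq_square algebra_simps)
  then have "exp (- ((1 + 2 * \<delta>) * u)) \<le> exp (ln (1 - u))" by simp
  then show ?thesis using assms \<delta>_le by simp
qed

text \<open>Above all quantiles the top parts have the same tails as the laws themselves.\<close>

lemma max_tail_le:
  assumes "\<And>j. j \<in> J \<Longrightarrow> q j \<le> x"
  shows "1 - (\<Prod>j\<in>J. 1 - measure (D j) {x<..}) \<le> 1 - exp (- ((1 + 2 * \<delta>) * tails x))"
proof -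
  have "exp (- ((1 + 2 * \<delta>) * tails x)) = (\<Prod>j\<in>J. exp (- ((1 + 2 * \<delta>) * top_tail \<delta> (q j) (D j) x)))"
    by (simp add: tails_def sum_distrib_left sum_negf exp_sum[OF finite_J, symmetric])
  also have "\<dots> \<le> (\<Prod>j\<in>J. 1 - top_tail \<delta> (q j) (D j) x)"
    using \<delta>_pos law quant by (intro prod_mono conjI one_minus_ge_exp top_tail_bounds) auto
  also have "\<dots> = (\<Prod>j\<in>J. 1 - measure (D j) {x<..})"
    using assms by (intro prod.cong) (auto simp: top_tail_def dest: leD)
  finally show ?thesis by simp
qed

lemma max_tail_le_1: "1 - (\<Prod>j\<in>J. 1 - measure (D j) {x<..}) \<le> 1"
  using law nonneg_lawD(1) by (auto intro!: prod_nonneg prob_space.prob_le_1)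

text \<open>Above \<open>\<tau>\<close> the Poisson bound applies, below \<open>\<sigma>\<close> the
  Poisson tail is already within \<open>\<eta>\<close> of 1, and in between the tail is bounded by
  1, at the cost of the length of the interval.\<close>

lemma expected_max_le_split:
  assumes "0 \<le> \<sigma>" "\<sigma> \<le> \<tau>" "\<And>j. j \<in> J \<Longrightarrow> q j \<le> \<tau>" "0 \<le> \<eta>"
    and low: "\<And>x. 0 \<le> x \<Longrightarrow> x < \<sigma> \<Longrightarrow> exp (- ((1 + 2 * \<delta>) * tails x)) \<le> \<eta>"
  shows "expected_max D J \<le> ennreal (W T / kertz_const + \<eta> * \<sigma> + (\<tau> - \<sigma>))"
proof (cases "J = {}")
  case True
  have "expected_max D J = 0" unfolding True expected_max_def by (simp add: bot_ennreal)
  then show ?thesis by simp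
next
  case False
  let ?G = "\<lambda>x. 1 - (\<Prod>j\<in>J. 1 - measure (D j) {x<..})"
  let ?P = "\<lambda>x. 1 - exp (- ((1 + 2 * \<delta>) * tails x))"
  note [measurable] = measurable_tails
  have Pn: "0 \<le> ?P x" for x using \<delta>_pos tails_nonneg[of x] by simp
  have "expected_max D J = (\<integral>\<^sup>+x. ennreal (?G x) * indicator {0..} x \<partial>lborel)"
    by (rule expected_max_tail[OF finite_J False law])
  also have "\<dots> \<le> (\<integral>\<^sup>+x. ennreal (?P x) * indicator {0..} x + (ennreal \<eta> * indicator {0..<\<sigma>} x + indicator {\<sigma>..<\<tau>} x) \<partial>lborel)"
  proof (rule nn_integral_mono)
    fix x :: real
    have "ennreal (?G x) \<le> ennreal (?P x)" if "\<tau> \<le> x"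
      using max_tail_le[of x] assms(3) that by (intro ennreal_leI) (meson order_trans)
    moreover have "ennreal (?G x) \<le> ennreal (?P x) + ennreal \<eta>" if "0 \<le> x" "x < \<sigma>"
      using low[OF that] max_tail_le_1[of x] Pn assms(4) by (simp flip: ennreal_plus add: ennreal_leI)
    moreover have "ennreal (?G x) \<le> ennreal (?P x) + 1"
    proof -
      have "ennreal (?G x) \<le> 1" by (simp only: ennreal_le_1 max_tail_le_1)
      also have "\<dots> \<le> ennreal (?P x) + 1" by (rule add_increasing) simp_all
      finally show ?thesis .
    qed
    moreover have "g * indicator {0..} x \<le> p * indicator {0..} x + (e * indicator {0..<\<sigma>} x + indicator {\<sigma>..<\<tau>} x)"
      if "\<tau> \<le> x \<Longrightarrow> g \<le> p" "0 \<le> x \<Longrightarrow> x < \<sigma> \<Longrightarrow> g \<le> p + e" "g \<le> p + 1" for g p e :: ennreal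
      using that assms(1,2) by (cases "x < 0"; cases "x < \<sigma>"; cases "x < \<tau>") (simp_all add: indicator_def)
    ultimately show "ennreal (?G x) * indicator {0..} x \<le>
        ennreal (?P x) * indicator {0..} x + (ennreal \<eta> * indicator {0..<\<sigma>} x + indicator {\<sigma>..<\<tau>} x)"
      by blast
  qed
  also have "\<dots> = (\<integral>\<^sup>+x. ennreal (?P x) * indicator {0..} x \<partial>lborel) + (ennreal \<eta> * ennreal \<sigma> + ennreal (\<tau> - \<sigma>))"
    using assms(1,2) by (simp add: nn_integral_add nn_integral_cmult_indicator)
  also have "\<dots> \<le> ennreal (W T / kertz_const) + (ennreal \<eta> * ennreal \<sigma> + ennreal (\<tau> - \<sigma>))"
    by (intro add_right_mono kertz_tails)
  also have "\<dots> = ennreal (W T / kertz_const + \<eta> * \<sigma> + (\<tau> - \<sigma>))"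
    using assms(1,2,4) W_nonneg[of T] kertz_const_pos by (simp flip: ennreal_mult ennreal_plus add: add.assoc)
  finally show ?thesis .
qed

lemma expected_max_le_rest:
  assumes "0 \<le> \<tau>" "\<And>j. j \<in> J \<Longrightarrow> q j \<le> \<tau>"
  shows "expected_max D J \<le> ennreal (W T / kertz_const + \<tau>)"
  using expected_max_le_split[of 0 \<tau> 0] assms by simp

text \<open>At a level below the window every variable in it has the full top mass \<delta>, so
  together they contribute at least ln(1/\<delta>) to \<open>tails\<close>, and the Poisson
  probability of no value above that level is at most \<delta>. This bounds the loss by a multiple
  of \<open>\<delta> * \<tau>\<close>.\<close>

lemma expected_max_le_window:
  assumes \<tau>: "0 \<le> \<tau>" "\<And>j. j \<in> J \<Longrightarrow> q j \<le> \<tau>"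
    and many: "ln (1 / \<delta>) \<le> \<delta> * card {j\<in>J. (1 - \<delta>) * \<tau> \<le> q j}"
  shows "expected_max D J \<le> ennreal ((1 + 4 * \<delta>) * W T / kertz_const)"
proof -
  define \<sigma> where "\<sigma> = (1 - \<delta>) * \<tau>"
  have \<sigma>: "0 \<le> \<sigma>" "\<sigma> \<le> \<tau>" using \<delta>_pos \<delta>_le \<tau> by (auto simp: \<sigma>_def mult_left_le_one_le)
  have low: "exp (- ((1 + 2 * \<delta>) * tails x)) \<le> \<delta>" if "x < \<sigma>" for x
  proof -
    have "\<delta> * card {j\<in>J. \<sigma> \<le> q j} = (\<Sum>j | j \<in> J \<and> \<sigma> \<le> q j. top_tail \<delta> (q j) (D j) x)"
      using that by (simp add: top_tail_def mult.commute)
    also have "\<dots> \<le> tails x"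
      unfolding tails_def using finite_J \<delta>_pos law quant by (intro sum_mono2 top_tail_bounds) auto
    also have "\<dots> \<le> (1 + 2 * \<delta>) * tails x" using tails_nonneg \<delta>_pos by (simp add: algebra_simps)
    finally have "- ((1 + 2 * \<delta>) * tails x) \<le> ln \<delta>"
      using many \<delta>_pos by (simp add: ln_div \<sigma>_def)
    then have "exp (- ((1 + 2 * \<delta>) * tails x)) \<le> exp (ln \<delta>)" by simp
    then show ?thesis using \<delta>_pos by simp
  qed
  have 1: "expected_max D J \<le> ennreal (W T / kertz_const + \<delta> * \<sigma> + (\<tau> - \<sigma>))"
    using expected_max_le_split[OF \<sigma> \<tau>(2), of \<delta>] low \<delta>_pos by auto
  \<comment> \<open>The same estimate bounds \<open>W T\<close> from below, which turns the loss
    into a fraction of \<open>W T\<close>.\<close>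
  have "ennreal ((1 - \<delta>) * \<sigma>) = (\<integral>\<^sup>+x. ennreal (1 - \<delta>) * indicator {0..<\<sigma>} x \<partial>lborel)"
    using \<sigma> \<delta>_le by (simp add: nn_integral_cmult_indicator ennreal_mult)
  also have "\<dots> \<le> (\<integral>\<^sup>+x. ennreal (1 - exp (- ((1 + 2 * \<delta>) * tails x))) * indicator {0..} x \<partial>lborel)"
  proof (rule nn_integral_mono)
    fix x show "ennreal (1 - \<delta>) * indicator {0..<\<sigma>} x \<le> ennreal (1 - exp (- ((1 + 2 * \<delta>) * tails x))) * indicator {0..} x"
      using low[of x] by (auto simp: indicator_def intro!: ennreal_leI)
  qed
  also have "\<dots> \<le> ennreal (W T / kertz_const)" by (rule kertz_tails)
  finally have "(1 - \<delta>) * \<sigma> \<le> W T / kertz_const"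
    using W_nonneg[of T] kertz_const_pos by (subst (asm) ennreal_le_iff) auto
  then have 2: "(1 - \<delta>) * ((1 - \<delta>) * \<tau>) \<le> W T / kertz_const" by (simp add: \<sigma>_def)
  have "\<delta> * \<sigma> + (\<tau> - \<sigma>) \<le> 2 * \<delta> * \<tau>"
    using \<sigma> \<delta>_pos by (simp add: \<sigma>_def algebra_simps)
  also have "\<dots> \<le> 4 * \<delta> * ((1 - \<delta>) * ((1 - \<delta>) * \<tau>))"
  proof -
    have "1/2 \<le> (1 - \<delta>) * (1 - \<delta>)"
    proof -
      have "(3/4) * (3/4) \<le> (1 - \<delta>) * (1 - \<delta>)" using \<delta>_le by (intro mult_mono) auto
      then show ?thesis by simp
    qed
    then have "(4 * \<delta> * \<tau>) * (1/2) \<le> (4 * \<delta> * \<tau>) * ((1 - \<delta>) * (1 - \<delta>))"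
      using \<tau> \<delta>_pos by (intro mult_left_mono) auto
    then show ?thesis by (simp add: mult_ac)
  qed
  also have "\<dots> \<le> 4 * \<delta> * (W T / kertz_const)" using 2 \<delta>_pos by (intro mult_left_mono) auto
  finally have "W T / kertz_const + \<delta> * \<sigma> + (\<tau> - \<sigma>) \<le> (1 + 4 * \<delta>) * W T / kertz_const"
    by (simp add: algebra_simps add_divide_distrib)
  with 1 show ?thesis by (rule order_trans[OF _ ennreal_leI])
qed

text \<open>The rows of the randomised policy: slot \<open>s\<close> is uniform, and in slot
  \<open>s\<close> the top part above \<open>W s\<close> is accepted. Only slots
  \<open>s \<ge> k\<close> count for \<open>u\<^sub>0 j k\<close>, because larger slots are
  inspected first.\<close>

definition u\<^sub>0 :: "nat \<Rightarrow> nat \<Rightarrow> real" where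
  "u\<^sub>0 j k = (\<Sum>s\<in>{k..<T}. top_tail \<delta> (q j) (D j) (W s)) / T"

definition r\<^sub>0 :: "nat \<Rightarrow> nat \<Rightarrow> real" where
  "r\<^sub>0 j k = top_gain \<delta> (q j) (D j) (W k) / T"

lemma u\<^sub>0_bounds:
  assumes "j \<in> J" shows "0 \<le> u\<^sub>0 j k" "u\<^sub>0 j k \<le> \<delta>"
proof -
  show "0 \<le> u\<^sub>0 j k"
    unfolding u\<^sub>0_def using \<delta>_pos assms law quant by (intro divide_nonneg_nonneg sum_nonneg top_tail_bounds) auto
  have "(\<Sum>s\<in>{k..<T}. top_tail \<delta> (q j) (D j) (W s)) \<le> (\<Sum>s\<in>{k..<T}. \<delta>)"
    using \<delta>_pos assms law quant by (intro sum_mono top_tail_bounds) auto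
  also have "\<dots> \<le> \<delta> * T" using \<delta>_pos by (simp add: mult.commute mult_left_mono)
  finally show "u\<^sub>0 j k \<le> \<delta>" using T_pos by (simp add: u\<^sub>0_def divide_le_eq)
qed

lemma r\<^sub>0_nonneg: "j \<in> J \<Longrightarrow> 0 \<le> r\<^sub>0 j k"
  unfolding r\<^sub>0_def top_gain_def using \<delta>_pos law quant W_nonneg
  by (intro divide_nonneg_nonneg add_nonneg_nonneg mult_nonneg_nonneg top_excess_nonneg top_tail_bounds) auto

text \<open>\<open>E k\<close> is a lower bound for the probability that the prior policy rejects everything in the
  slots \<open>k, \<dots>, T - 1\<close>, which precede the slots below \<open>k\<close>.\<close>

lemma W_le_reward_bound: "W T \<le> (1 + 6 * \<delta>) * reward_bound T J u\<^sub>0 r\<^sub>0"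
proof -
  let ?\<kappa> = "1 + 2 * \<delta>"
  define E where "E k = exp (- (?\<kappa> * (\<Sum>s\<in>{k..<T}. tails (W s)) / T))" for k
  define R where "R k = (\<Sum>j\<in>J. r\<^sub>0 j k)" for k
  have R0: "0 \<le> R k" for k unfolding R_def by (intro sum_nonneg r\<^sub>0_nonneg)
  have E: "E k = exp (- (?\<kappa> * tails (W k) / T)) * E (Suc k)" if "k < T" for k
    using that by (simp add: E_def sum.atLeast_Suc_lessThan exp_add[symmetric] field_simps)
  \<comment> \<open>The Euler step read as dynamic programming: the reward of slot \<open>k\<close>,
    plus the old value times approximately the probability of rejecting everything in slot
    \<open>k\<close>.\<close>
  have WR: "W (Suc k) = ?\<kappa> * R k + (1 - ?\<kappa> * tails (W k) / T) * W k" for k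
  proof -
    have "R k = ((\<Sum>j\<in>J. top_excess \<delta> (q j) (D j) (W k)) + W k * tails (W k)) / T"
      by (simp add: R_def r\<^sub>0_def top_gain_def tails_def sum.distrib sum_distrib_left sum_divide_distrib[symmetric])
    then have "(\<Sum>j\<in>J. top_excess \<delta> (q j) (D j) (W k)) = R k * T - W k * tails (W k)"
      using T_pos by (simp add: field_simps)
    then show ?thesis using T_pos by (simp add: W_simps slope_def) (simp add: field_simps)
  qed
  have step: "W (Suc k) * E (Suc k) \<le> ?\<kappa> * exp (?\<kappa> * \<delta>) * (R k * E k) + W k * E k" if "k < T" for k
  proof -
    have "(1 - ?\<kappa> * tails (W k) / T) * W k \<le> exp (- (?\<kappa> * tails (W k) / T)) * W k"
      using exp_ge_add_one_self[of "- (?\<kappa> * tails (W k) / T)"] W_nonneg by (intro mult_right_mono) auto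
    then have "W (Suc k) * E (Suc k) \<le> (?\<kappa> * R k + exp (- (?\<kappa> * tails (W k) / T)) * W k) * E (Suc k)"
      unfolding WR by (rule mult_right_mono[OF add_left_mono]) (simp add: E_def)
    also have "\<dots> = ?\<kappa> * R k * E (Suc k) + W k * E k" by (simp add: E[OF that] algebra_simps)
    \<comment> \<open>\<open>reward_bound\<close> also charges the rejections within slot
      \<open>k\<close> itself. They cost the factor \<open>exp (?\<kappa> * \<delta>)\<close>, since
      one slot holds mass at most \<delta>.\<close>
    also have "E (Suc k) \<le> exp (?\<kappa> * \<delta>) * E k"
    proof -
      have "?\<kappa> * tails (W k) / T \<le> ?\<kappa> * \<delta>"
        using tails_le[of "W k"] T_pos \<delta>_pos by (simp add: divide_le_eq mult.assoc)
      then have "1 \<le> exp (?\<kappa> * \<delta> - ?\<kappa> * tails (W k) / T)" by simp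
      then have "E (Suc k) \<le> exp (?\<kappa> * \<delta> - ?\<kappa> * tails (W k) / T) * E (Suc k)"
        by (simp add: E_def)
      also have "\<dots> = exp (?\<kappa> * \<delta>) * E k" by (simp add: E[OF that] exp_diff exp_minus field_simps)
      finally show ?thesis .
    qed
    then have "?\<kappa> * R k * E (Suc k) \<le> ?\<kappa> * R k * (exp (?\<kappa> * \<delta>) * E k)"
      using R0 \<delta>_pos by (intro mult_left_mono) auto
    finally show ?thesis by (simp add: mult_ac)
  qed
  have "W t * E t \<le> ?\<kappa> * exp (?\<kappa> * \<delta>) * (\<Sum>k<t. R k * E k)" if "t \<le> T" for t
    using that
  proof (induction t)
    case (Suc t)
    then show ?case using step[of t] by (simp add: distrib_left)
  qed (simp add: W_simps)
  from this[of T] have 1: "W T \<le> ?\<kappa> * exp (?\<kappa> * \<delta>) * (\<Sum>k<T. R k * E k)" by (simp add: E_def)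
  have 2: "(\<Sum>k<T. R k * E k) \<le> reward_bound T J u\<^sub>0 r\<^sub>0"
    unfolding reward_bound_def R_def sum_distrib_right
  proof (intro sum_mono mult_left_mono r\<^sub>0_nonneg)
    fix i k assume i: "i \<in> J"
    have "E k = (\<Prod>j\<in>J. exp (- (?\<kappa> * u\<^sub>0 j k)))"
      unfolding exp_sum[OF finite_J, symmetric] E_def tails_def u\<^sub>0_def
      by (subst sum.swap) (simp add: sum_negf sum_distrib_left sum_divide_distrib)
    also have "\<dots> \<le> (\<Prod>j\<in>J. 1 - u\<^sub>0 j k)"
      using u\<^sub>0_bounds by (intro prod_mono conjI one_minus_ge_exp) auto
    also have "\<dots> = (1 - u\<^sub>0 i k) * (\<Prod>j\<in>J - {i}. 1 - u\<^sub>0 j k)"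
      by (rule prod.remove[OF finite_J i])
    also have "\<dots> \<le> (\<Prod>j\<in>J - {i}. 1 - u\<^sub>0 j k)"
    proof (intro mult_left_le_one_le prod_nonneg)
      show "0 \<le> 1 - u\<^sub>0 j k" if "j \<in> J - {i}" for j using that u\<^sub>0_bounds(2)[of j k] \<delta>_le by auto
    qed (use u\<^sub>0_bounds[OF i, of k] \<delta>_le in auto)
    finally show "E k \<le> (\<Prod>j\<in>J - {i}. 1 - u\<^sub>0 j k)" .
  qed
  have 3: "?\<kappa> * exp (?\<kappa> * \<delta>) \<le> 1 + 6 * \<delta>"
  proof -
    have d2: "\<delta> * \<delta> \<le> \<delta> / 4" using \<delta>_le \<delta>_pos mult_left_mono[of \<delta> "1/4" \<delta>] by simp
    have le: "?\<kappa> * \<delta> \<le> 3/2 * \<delta>" using d2 by (simp add: algebra_simps)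
    have "exp (?\<kappa> * \<delta>) \<le> exp (3/2 * \<delta>)" using le by simp
    also have "\<dots> \<le> 1 + 3/2 * \<delta> + (3/2 * \<delta>)\<^sup>2" using \<delta>_pos \<delta>_le by (intro exp_bound) auto
    also have "\<dots> \<le> 1 + 5/2 * \<delta>" using d2 \<delta>_pos by (simp add: power2_eq_square)
    finally have "?\<kappa> * exp (?\<kappa> * \<delta>) \<le> ?\<kappa> * (1 + 5/2 * \<delta>)" using \<delta>_pos by (intro mult_left_mono) auto
    also have "\<dots> \<le> 1 + 6 * \<delta>" using d2 \<delta>_pos by (simp add: algebra_simps)
    finally show ?thesis .
  qed
  have "0 \<le> (\<Sum>k<T. R k * E k)" using R0 by (intro sum_nonneg mult_nonneg_nonneg) (auto simp: E_def)
  then have "?\<kappa> * exp (?\<kappa> * \<delta>) * (\<Sum>k<T. R k * E k) \<le> (1 + 6 * \<delta>) * reward_bound T J u\<^sub>0 r\<^sub>0"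
    using 2 3 \<delta>_pos by (intro mult_mono) auto
  with 1 show ?thesis by linarith
qed

end

subsection \<open>Rounding the random slots and thresholds\<close>

text \<open>Each summand contains exactly one factor from the rows of \<open>j\<close>:
  \<open>r j k\<close> if it is the summand of \<open>j\<close>, and \<open>1 - u j k\<close>
  otherwise.\<close>

lemma reward_bound_linear:
  assumes J: "finite J" "j \<in> J"
  shows "\<exists>a b. \<forall>x y. reward_bound T J (u(j := x)) (r(j := y)) = (\<Sum>k<T. y k * a k - x k * b k) + (\<Sum>k<T. b k)"
proof -
  define a where "a k = (\<Prod>i\<in>J - {j}. 1 - u i k)" for k
  define b where "b k = (\<Sum>i\<in>J - {j}. r i k * (\<Prod>i'\<in>J - {i} - {j}. 1 - u i' k))" for k
  have inner: "(\<Sum>i\<in>J. (r(j := y)) i k * (\<Prod>i'\<in>J - {i}. 1 - (u(j := x)) i' k)) = y k * a k + (1 - x k) * b k" for x y k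
  proof -
    have "(\<Sum>i\<in>J. (r(j := y)) i k * (\<Prod>i'\<in>J - {i}. 1 - (u(j := x)) i' k)) =
        y k * (\<Prod>i'\<in>J - {j}. 1 - (u(j := x)) i' k) + (\<Sum>i\<in>J - {j}. r i k * (\<Prod>i'\<in>J - {i}. 1 - (u(j := x)) i' k))"
      using J by (subst sum.remove[of J j]) auto
    also have "(\<Prod>i'\<in>J - {j}. 1 - (u(j := x)) i' k) = a k"
      unfolding a_def by (rule prod.cong) auto
    also have "(\<Sum>i\<in>J - {j}. r i k * (\<Prod>i'\<in>J - {i}. 1 - (u(j := x)) i' k)) = (\<Sum>i\<in>J - {j}. (1 - x k) * (r i k * (\<Prod>i'\<in>J - {i} - {j}. 1 - u i' k)))"
    proof (rule sum.cong[OF refl])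
      fix i assume i: "i \<in> J - {j}"
      have "(\<Prod>i'\<in>J - {i}. 1 - (u(j := x)) i' k) = (1 - x k) * (\<Prod>i'\<in>J - {i} - {j}. 1 - (u(j := x)) i' k)"
        using J i by (subst prod.remove[of "J - {i}" j]) auto
      also have "(\<Prod>i'\<in>J - {i} - {j}. 1 - (u(j := x)) i' k) = (\<Prod>i'\<in>J - {i} - {j}. 1 - u i' k)"
        by (rule prod.cong) auto
      finally show "r i k * (\<Prod>i'\<in>J - {i}. 1 - (u(j := x)) i' k) = (1 - x k) * (r i k * (\<Prod>i'\<in>J - {i} - {j}. 1 - u i' k))"
        by simp
    qed
    finally show ?thesis by (simp add: b_def sum_distrib_left)
  qed
  have "reward_bound T J (u(j := x)) (r(j := y)) = (\<Sum>k<T. y k * a k - x k * b k) + (\<Sum>k<T. b k)" for x y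
    unfolding reward_bound_def inner by (simp add: sum.distrib[symmetric] algebra_simps)
  then show ?thesis by blast
qed

text \<open>\<open>u_row\<close> and \<open>r_row\<close> are the rows of a variable with a definite
  slot and acceptance set, which are to replace the averaged rows \<open>u\<^sub>0\<close> and
  \<open>r\<^sub>0\<close>.\<close>

definition u_row :: "real measure \<Rightarrow> nat \<Rightarrow> real set \<Rightarrow> nat \<Rightarrow> real" where
  "u_row \<mu> s A k = (if k \<le> s then measure \<mu> A else 0)"

definition r_row :: "real measure \<Rightarrow> nat \<Rightarrow> real set \<Rightarrow> nat \<Rightarrow> real" where
  "r_row \<mu> s A k = (if k = s then gain_on \<mu> A else 0)"

lemma sum_triangle:
  fixes f :: "nat \<Rightarrow> nat \<Rightarrow> real"
  shows "(\<Sum>k<T. \<Sum>s\<in>{k..<T}. f k s) = (\<Sum>s<T. \<Sum>k\<le>s. f k s)"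
proof -
  have "(\<Sum>k<T. \<Sum>s\<in>{k..<T}. f k s) = (\<Sum>k<T. \<Sum>s<T. if k \<le> s then f k s else 0)"
    by (intro sum.cong[OF refl] sum.mono_neutral_cong_left) auto
  also have "\<dots> = (\<Sum>s<T. \<Sum>k<T. if k \<le> s then f k s else 0)" by (rule sum.swap)
  also have "\<dots> = (\<Sum>s<T. \<Sum>k\<le>s. f k s)"
    by (intro sum.cong[OF refl] sum.mono_neutral_cong_right) auto
  finally show ?thesis .
qed

context small_laws begin

text \<open>The averaged rows are a mean over slots, and within a slot the top part is an event or a
  mixture of two. As the bound is affine in the rows of \<open>j\<close>, some slot and some event
  do at least as well.\<close>

lemma round_row:
  assumes j: "j \<in> J"
  shows "\<exists>s<T. \<exists>A\<in>{{W s<..}, {q j..}, {q j<..}}.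
    reward_bound T J (u(j := u\<^sub>0 j)) (r(j := r\<^sub>0 j)) \<le>
    reward_bound T J (u(j := u_row (D j) s A)) (r(j := r_row (D j) s A))"
proof -
  obtain a b where lin: "\<And>x y. reward_bound T J (u(j := x)) (r(j := y)) = (\<Sum>k<T. y k * a k - x k * b k) + (\<Sum>k<T. b k)"
    using reward_bound_linear[OF finite_J j] by blast
  \<comment> \<open>The price of accepting \<open>j\<close> in slot \<open>s\<close>: it blocks the
    rewards \<open>b k\<close> of the other variables in all slots up to \<open>s\<close>.\<close>
  define c where "c s = (\<Sum>k\<le>s. b k)" for s
  let ?t = "top_tail \<delta> (q j) (D j)" and ?g = "top_gain \<delta> (q j) (D j)"
  define m where "m s = a s * ?g (W s) - c s * ?t (W s)" for s
  have "(\<Sum>k<T. r\<^sub>0 j k * a k - u\<^sub>0 j k * b k) = ((\<Sum>k<T. ?g (W k) * a k) - (\<Sum>k<T. \<Sum>s\<in>{k..<T}. ?t (W s) * b k)) / T"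
    by (simp add: r\<^sub>0_def u\<^sub>0_def sum_subtractf sum_divide_distrib diff_divide_distrib sum_distrib_right)
  also have "\<dots> = (\<Sum>s<T. m s) / T"
    unfolding sum_triangle m_def c_def by (simp add: sum_subtractf sum_distrib_right mult.commute)
  finally have prior: "(\<Sum>k<T. r\<^sub>0 j k * a k - u\<^sub>0 j k * b k) = (\<Sum>s<T. m s) / T" .
  have "\<exists>s<T. (\<Sum>s<T. m s) / T \<le> m s"
  proof (rule ccontr)
    assume "\<not> (\<exists>s<T. (\<Sum>s<T. m s) / T \<le> m s)"
    then have "(\<Sum>s<T. m s) < (\<Sum>s<T. (\<Sum>s<T. m s) / T)"
      using T_pos by (intro sum_strict_mono) auto
    then show False using T_pos by simp
  qed
  then obtain s where s: "s < T" "(\<Sum>s<T. m s) / T \<le> m s" by blast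
  obtain A where A: "A \<in> {{W s<..}, {q j..}, {q j<..}}" "m s \<le> a s * gain_on (D j) A - c s * measure (D j) A"
    using top_part_dominated[OF law[OF j] mean[OF j] quant[OF j] W_nonneg, where \<alpha> = "a s" and \<gamma> = "c s"] unfolding m_def by blast
  have "(\<Sum>k<T. r_row (D j) s A k * a k - u_row (D j) s A k * b k) = a s * gain_on (D j) A - c s * measure (D j) A"
  proof -
    have "(\<Sum>k<T. r_row (D j) s A k * a k) = (\<Sum>k<T. if k = s then gain_on (D j) A * a s else 0)"
      by (intro sum.cong) (auto simp: r_row_def)
    moreover have "(\<Sum>k<T. u_row (D j) s A k * b k) = (\<Sum>k\<le>s. measure (D j) A * b k)"
      using s(1) by (intro sum.mono_neutral_cong_right) (auto simp: u_row_def)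
    ultimately show ?thesis
      using s(1) by (simp add: sum_subtractf c_def sum_distrib_right mult.commute)
  qed
  then show ?thesis using s A prior by (auto simp: lin)
qed

end

subsection \<open>Rewards of threshold policies\<close>

text \<open>The rounding of arbitrary laws produces open rays and real thresholds, which a
  \<open>schedule\<close> cannot express.\<close>

definition set_policy :: "(nat \<times> real set) list \<Rightarrow> policy" where
  "set_policy sch h = (let k = length h in
     if k \<ge> length sch \<or> (k > 0 \<and> last_value h \<in> snd (sch ! (k - 1))) then Stop else Inspect (fst (sch ! k)))"

lemma schedule_policy_eq:
  "schedule_policy sch = set_policy (map (\<lambda>(i, \<theta>). (i, {of_rat \<theta>..})) sch)"
proof
  fix h
  show "schedule_policy sch h = set_policy (map (\<lambda>(i, \<theta>). (i, {of_rat \<theta>..})) sch) h"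
  proof (cases "length h < length sch")
    case True
    then have "sch \<noteq> []" by auto
    moreover have "length h - 1 < length sch" using True by simp
    ultimately show ?thesis
      using True by (simp add: schedule_policy_def set_policy_def Let_def case_prod_beta)
  qed (simp add: schedule_policy_def set_policy_def Let_def)
qed

lemma measurable_set_policy:
  assumes "\<And>i A. (i, A) \<in> set sch \<Longrightarrow> A \<in> sets borel"
  shows "measurable_policy (set_policy sch)"
  unfolding measurable_policy_def
proof
  fix js :: "nat list"
  show "(\<lambda>x. set_policy sch (map (\<lambda>i. (i, x i)) js)) \<in> (\<Pi>\<^sub>M i\<in>(UNIV :: nat set). (borel :: real measure)) \<rightarrow>\<^sub>M count_space UNIV"
  proof (cases "js = [] \<or> length sch \<le> length js")
    case True
    then show ?thesis by (auto simp: set_policy_def)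
  next
    case False
    then obtain j js' where js: "js = j # js'" by (cases js) auto
    have "snd (sch ! length js') \<in> sets borel"
      using assms[of "fst (sch ! length js')" "snd (sch ! length js')"] False js by simp
    then have [measurable]: "Measurable.pred borel (\<lambda>v. v \<in> snd (sch ! length js'))"
      by (simp add: pred_def)
    have "(\<lambda>x. if x j \<in> snd (sch ! length js') then Stop else Inspect (fst (sch ! length js)))
        \<in> (\<Pi>\<^sub>M i\<in>(UNIV :: nat set). (borel :: real measure)) \<rightarrow>\<^sub>M count_space UNIV"
      by measurable
    then show ?thesis using False by (simp add: set_policy_def js last_value_def)
  qed
qed

text \<open>Unlike the policy, which keeps the last value in any case, this counts 0 if no value
  lies in its acceptance set. It is therefore only a lower bound.\<close>

fun run :: "(nat \<times> real set) list \<Rightarrow> (nat \<Rightarrow> real) \<Rightarrow> real" where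
  "run [] x = 0"
| "run ((i, A) # sch) x = (if x i \<in> A then x i else run sch x)"

text \<open>Induction on the remaining schedule: \<open>pre\<close> has been inspected, appears in
  reverse order in the history, and its last value was rejected.\<close>

lemma run_le_payoff_aux:
  assumes "distinct (map fst (pre @ suf))" "pre \<noteq> [] \<Longrightarrow> x (fst (last pre)) \<notin> snd (last pre)"
  shows "ennreal (run suf x) \<le>
    ennreal (payoff (set (map fst suf)) (set_policy (pre @ suf)) x (rev (map (\<lambda>(i, A). (i, x i)) pre)))"
  using assms
proof (induction suf arbitrary: pre)
  case Nil
  show ?case by simp
next
  case (Cons a suf)
  obtain i A where a: "a = (i, A)" by (cases a)
  let ?\<pi> = "set_policy (pre @ a # suf)" and ?h = "rev (map (\<lambda>(i, A). (i, x i)) pre)"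
  have "?\<pi> ?h = Inspect i"
  proof (cases "pre = []")
    case False
    then obtain pre' b where pre: "pre = pre' @ [b]" by (metis rev_exhaust)
    then show ?thesis
      using Cons.prems(2) by (simp add: set_policy_def a last_value_def case_prod_beta nth_append)
  qed (simp add: set_policy_def a)
  moreover have "i \<notin> set (map fst suf)" using Cons.prems(1) a by auto
  ultimately have pay: "payoff (set (map fst (a # suf))) ?\<pi> x ?h = payoff (set (map fst suf)) ?\<pi> x ((i, x i) # ?h)"
    by (subst payoff.simps) (simp add: a)
  show ?case
  proof (cases "x i \<in> A")
    case True
    have "?\<pi> ((i, x i) # ?h) = Stop"
      using True by (simp add: set_policy_def a last_value_def nth_append)
    then have "payoff (set (map fst suf)) ?\<pi> x ((i, x i) # ?h) = x i"
      by (subst payoff.simps) (simp add: last_value_def)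
    then show ?thesis using True pay by (simp add: a)
  next
    case False
    then show ?thesis
      using Cons.IH[of "pre @ [a]"] Cons.prems(1) pay by (simp add: a)
  qed
qed

lemma expected_reward_ge_run:
  assumes "distinct (map fst sch)"
  shows "(\<integral>\<^sup>+x. ennreal (run sch x) \<partial>PiM (set (map fst sch)) D) \<le> expected_reward D (set (map fst sch)) (set_policy sch)"
  unfolding expected_reward_def
  using run_le_payoff_aux[of "[]" sch] assms by (intro nn_integral_mono) simp

text \<open>The product over \<open>j\<close> is the value of \<open>i\<close> times the indicator
  that \<open>i\<close> is accepted and every other variable in its slot or in a larger one is
  rejected.\<close>

definition slot_factor :: "(nat \<Rightarrow> nat) \<Rightarrow> (nat \<Rightarrow> real set) \<Rightarrow> nat \<Rightarrow> nat \<Rightarrow> real \<Rightarrow> ennreal" where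
  "slot_factor sl A i j v = (if j = i then ennreal v * indicator (A i) v
     else if sl i \<le> sl j then indicator (- A j) v else 1)"

text \<open>The events of two different \<open>i\<close> exclude each other, since the one with the
  smaller or equal slot requires the other to be rejected. Whatever precedes \<open>i\<close> in the
  list has at least its slot, so on its event the run does accept \<open>i\<close>.\<close>

lemma run_ge_slots:
  assumes "distinct js" "sorted_wrt (\<lambda>a b. sl b \<le> sl a) js"
  shows "(\<Sum>i\<in>set js. \<Prod>j\<in>set js. slot_factor sl A i j (x j)) \<le> ennreal (run (map (\<lambda>j. (j, A j)) js) x)"
  using assms
proof (induction js)
  case (Cons a js)
  let ?f = "slot_factor sl A"
  have a: "a \<notin> set js" "\<And>i. i \<in> set js \<Longrightarrow> sl i \<le> sl a" using Cons.prems by auto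
  have le1: "?f i j v \<le> 1" if "i \<noteq> j" for i j v using that by (simp add: slot_factor_def indicator_def)
  have split: "(\<Sum>i\<in>set (a # js). \<Prod>j\<in>set (a # js). ?f i j (x j)) =
      ?f a a (x a) * (\<Prod>j\<in>set js. ?f a j (x j)) + (\<Sum>i\<in>set js. ?f i a (x a) * (\<Prod>j\<in>set js. ?f i j (x j)))"
    using a(1) by simp
  show ?case
  proof (cases "x a \<in> A a")
    case True
    have "?f i a (x a) = 0" if "i \<in> set js" for i
      using that a True by (auto simp: slot_factor_def)
    moreover have "?f a a (x a) * (\<Prod>j\<in>set js. ?f a j (x j)) \<le> ?f a a (x a) * 1"
      using a(1) by (intro mult_left_mono prod_le_1) (auto intro!: le1)
    ultimately show ?thesis
      unfolding split using True by (simp add: slot_factor_def)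
  next
    case False
    have "(\<Sum>i\<in>set js. ?f i a (x a) * (\<Prod>j\<in>set js. ?f i j (x j))) \<le> (\<Sum>i\<in>set js. 1 * (\<Prod>j\<in>set js. ?f i j (x j)))"
      using a(1) by (intro sum_mono mult_right_mono le1) auto
    then show ?thesis
      unfolding split using Cons False by (simp add: slot_factor_def)
  qed
qed simp

text \<open>Every \<open>slot_factor\<close> depends on one coordinate, so by independence the
  integral of the pointwise bound factorises into \<open>reward_bound\<close>.\<close>

theorem expected_reward_ge_slots:
  assumes js: "distinct js" "sorted_wrt (\<lambda>a b. sl b \<le> sl a) js" "set js = J"
    and law: "\<And>j. j \<in> J \<Longrightarrow> nonneg_law (D j)" and mean: "\<And>j. j \<in> J \<Longrightarrow> finite_mean (D j)"
    and A: "\<And>j. j \<in> J \<Longrightarrow> A j \<in> sets borel" and sl: "\<And>j. j \<in> J \<Longrightarrow> sl j < T"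
  shows "ennreal (reward_bound T J (\<lambda>j. u_row (D j) (sl j) (A j)) (\<lambda>j. r_row (D j) (sl j) (A j)))
    \<le> expected_reward D J (set_policy (map (\<lambda>j. (j, A j)) js))"
proof -
  have fin: "finite J" using js(3) by auto
  have prob: "0 \<le> 1 - measure (D j) (A j)" if "j \<in> J" for j
    using prob_space.prob_le_1[OF nonneg_lawD(1)[OF law[OF that]]] by simp
  define F where "F i j = (if j = i then gain_on (D i) (A i) else if sl i \<le> sl j then 1 - measure (D j) (A j) else 1)" for i j
  have F0: "0 \<le> F i j" if "j \<in> J" for i j
    using prob[OF that] by (simp add: F_def gain_on_nonneg)
  have meas: "slot_factor sl A i j \<in> borel_measurable (D j)" if "i \<in> J" "j \<in> J" for i j
    using A that by (intro borel_measurable_nonneg_law[OF law[OF that(2)]]) (auto simp: slot_factor_def[abs_def])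
  have int: "(\<integral>\<^sup>+v. slot_factor sl A i j v \<partial>D j) =
ennreal (F i j)"
    if "i \<in> J" "j \<in> J" for i j
  proof -
    interpret prob_space "D j" by (rule nonneg_lawD(1)[OF law[OF that(2)]])
    have "measure (D j) (space (D j) - A j) = 1 - measure (D j) (A j)"
      using A[OF that(2)] nonneg_lawD(2)[OF law[OF that(2)]] by (intro prob_compl) simp
    moreover have "space (D j) - A j = - A j" using nonneg_lawD(3)[OF law[OF that(2)]] by auto
    moreover have "- A j \<in> sets (D j)" using A[OF that(2)] nonneg_lawD(2)[OF law[OF that(2)]] by auto
    ultimately show ?thesis
      using ennreal_gain_on[OF mean[OF that(2)], of "A i"]
      by (auto simp: slot_factor_def emeasure_eq_measure prob_space F_def)
  qed
  have "reward_bound T J (\<lambda>j. u_row (D j) (sl j) (A j)) (\<lambda>j. r_row (D j) (sl j) (A j)) =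
      (\<Sum>i\<in>J. \<Sum>k<T. if k = sl i then gain_on (D i) (A i) * (\<Prod>j\<in>J - {i}. if sl i \<le> sl j then 1 - measure (D j) (A j) else 1) else 0)"
    unfolding reward_bound_def
  proof (subst sum.swap, intro sum.cong refl)
    fix i k
    have "1 - u_row (D j) (sl j) (A j) (sl i) = (if sl i \<le> sl j then 1 - measure (D j) (A j) else 1)" for j
      by (simp add: u_row_def)
    then show "r_row (D i) (sl i) (A i) k * (\<Prod>j\<in>J - {i}. 1 - u_row (D j) (sl j) (A j) k) =
        (if k = sl i then gain_on (D i) (A i) * (\<Prod>j\<in>J - {i}. if sl i \<le> sl j then 1 - measure (D j) (A j) else 1) else 0)"
      by (simp add: r_row_def)
  qed
  also have "\<dots> = (\<Sum>i\<in>J. gain_on (D i) (A i) * (\<Prod>j\<in>J - {i}. if sl i \<le> sl j then 1 - measure (D j) (A j) else 1))"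
    using sl by (intro sum.cong) auto
  also have "\<dots> = (\<Sum>i\<in>J. \<Prod>j\<in>J. F i j)"
  proof (rule sum.cong[OF refl])
    fix i assume i: "i \<in> J"
    have "(\<Prod>j\<in>J - {i}. F i j) = (\<Prod>j\<in>J - {i}. if sl i \<le> sl j then 1 - measure (D j) (A j) else 1)"
      by (rule prod.cong) (auto simp: F_def)
    then show "gain_on (D i) (A i) * (\<Prod>j\<in>J - {i}. if sl i \<le> sl j then 1 - measure (D j) (A j) else 1) = (\<Prod>j\<in>J. F i j)"
      by (subst prod.remove[OF fin i]) (simp add: F_def)
  qed
  finally have "ennreal (reward_bound T J (\<lambda>j. u_row (D j) (sl j) (A j)) (\<lambda>j. r_row (D j) (sl j) (A j))) =
      ennreal (\<Sum>i\<in>J. \<Prod>j\<in>J. F i j)" by simp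
  also have "\<dots> = (\<Sum>i\<in>J. \<Prod>j\<in>J. ennreal (F i j))"
    using F0 by (simp add: prod_ennreal sum_ennreal prod_nonneg)
  also have "\<dots> = (\<Sum>i\<in>J. \<Prod>j\<in>J. \<integral>\<^sup>+v. slot_factor sl A i j v \<partial>D j)"
    by (intro sum.cong prod.cong refl) (simp add: int)
  also have "\<dots> = (\<Sum>i\<in>J. \<integral>\<^sup>+x. (\<Prod>j\<in>J. slot_factor sl A i j (x j)) \<partial>PiM J D)"
    using nonneg_lawD(1) law meas by (intro sum.cong refl nn_integral_PiM_prod[symmetric] fin) auto
  also have "\<dots> = (\<integral>\<^sup>+x. (\<Sum>i\<in>J. \<Prod>j\<in>J. slot_factor sl A i j (x j)) \<partial>PiM J D)"
  proof (rule nn_integral_sum[symmetric])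
    show "(\<lambda>x. \<Prod>j\<in>J. slot_factor sl A i j (x j)) \<in> borel_measurable (PiM J D)" if "i \<in> J" for i
    proof (intro borel_measurable_prod_ennreal)
      fix j assume j: "j \<in> J"
      show "(\<lambda>x. slot_factor sl A i j (x j)) \<in> borel_measurable (PiM J D)"
        by (rule measurable_compose[OF measurable_component_singleton[OF j, of D] meas[OF that j]])
    qed
  qed
  also have "\<dots> \<le> (\<integral>\<^sup>+x. ennreal (run (map (\<lambda>j. (j, A j)) js) x) \<partial>PiM J D)"
    using run_ge_slots[OF js(1,2)] js(3) by (intro nn_integral_mono) auto
  also have "\<dots> \<le> expected_reward D J (set_policy (map (\<lambda>j. (j, A j)) js))"
    using expected_reward_ge_run[of "map (\<lambda>j. (j, A j)) js" D] js by (simp add: comp_def)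
  finally show ?thesis .
qed

lemma nn_integral_PiM_component:
  assumes "finite J" "i \<in> J" "\<And>j. j \<in> J \<Longrightarrow> nonneg_law (D j)" "f \<in> borel_measurable borel"
  shows "(\<integral>\<^sup>+x. f (x i) \<partial>PiM J D) = (\<integral>\<^sup>+v. f v \<partial>D i)"
proof -
  have "(\<integral>\<^sup>+x. f (x i) \<partial>PiM J D) = (\<integral>\<^sup>+x. (\<Prod>j\<in>J. (if j = i then f else (\<lambda>_. 1)) (x j)) \<partial>PiM J D)"
    using assms(1,2) by (intro nn_integral_cong) (simp add: if_distrib[of "\<lambda>f. f _"] prod.delta cong: if_cong)
  also have "\<dots> = (\<Prod>j\<in>J. \<integral>\<^sup>+v. (if j = i then f else (\<lambda>_. 1)) v \<partial>D j)"
    using assms nonneg_lawD(1) borel_measurable_nonneg_law[OF assms(3) assms(4)]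
    by (intro nn_integral_PiM_prod) auto
  also have "\<dots> = (\<Prod>j\<in>J. if j = i then \<integral>\<^sup>+v. f v \<partial>D i else 1)"
    using nonneg_lawD(1)[OF assms(3)] by (intro prod.cong) (auto simp: prob_space.emeasure_space_1)
  also have "\<dots> = (\<integral>\<^sup>+v. f v \<partial>D i)"
    using assms(1,2) by simp
  finally show ?thesis .
qed

lemma expected_reward_ge_first:
  assumes "distinct (map fst ((i, {0..}) # sch))" "\<And>j. j \<in> insert i (set (map fst sch)) \<Longrightarrow> nonneg_law (D j)"
  shows "(\<integral>\<^sup>+v. ennreal v \<partial>D i) \<le> expected_reward D (insert i (set (map fst sch))) (set_policy ((i, {0..}) # sch))"
proof -
  have "(\<integral>\<^sup>+v. ennreal v \<partial>D i) = (\<integral>\<^sup>+x. ennreal (x i) \<partial>PiM (insert i (set (map fst sch))) D)"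
    by (rule nn_integral_PiM_component[symmetric]) (use assms in auto)
  also have "\<dots> \<le> (\<integral>\<^sup>+x. ennreal (run ((i, {0..}) # sch) x) \<partial>PiM (insert i (set (map fst sch))) D)"
    by (intro nn_integral_mono) (auto simp: ennreal_neg)
  also have "\<dots> \<le> expected_reward D (insert i (set (map fst sch))) (set_policy ((i, {0..}) # sch))"
    using expected_reward_ge_run[OF assms(1)] by simp
  finally show ?thesis .
qed

lemma expected_max_insert:
  assumes "finite J" "\<And>j. j \<in> insert i J \<Longrightarrow> nonneg_law (D j)" "i \<notin> J"
  shows "expected_max D (insert i J) \<le> (\<integral>\<^sup>+v. ennreal v \<partial>D i) + expected_max D J"
proof -
  have m: "(\<lambda>x. ennreal (x j)) \<in> borel_measurable (PiM K D)" if "j \<in> K" "nonneg_law (D j)" for j K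
    using measurable_compose[OF measurable_component_singleton[OF that(1), of D] borel_measurable_nonneg_law[OF that(2), of ennreal]] by simp
  have mS: "(\<lambda>x. \<Squnion>j\<in>J. ennreal (x j)) \<in> borel_measurable (PiM K D)" if "J \<subseteq> K" for K
    using assms(1,2) that by (intro borel_measurable_SUP countable_finite m) auto
  have "expected_max D (insert i J) \<le> (\<integral>\<^sup>+x. ennreal (x i) + (\<Squnion>j\<in>J. ennreal (x j)) \<partial>PiM (insert i J) D)"
    unfolding expected_max_def
  proof (intro nn_integral_mono)
    fix x :: "nat \<Rightarrow> real"
    have "ennreal (x j) \<le> ennreal (x i) + (\<Squnion>j\<in>J. ennreal (x j))" if "j \<in> insert i J" for j
    proof (cases "j = i")
      case False
      then have "ennreal (x j) \<le> (\<Squnion>j\<in>J. ennreal (x j))" using that by (intro SUP_upper) auto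
      then show ?thesis by (rule add_increasing[OF zero_le])
    qed (simp add: add_increasing2)
    then show "(\<Squnion>j\<in>insert i J. ennreal (x j)) \<le> ennreal (x i) + (\<Squnion>j\<in>J. ennreal (x j))"
      by (rule SUP_least)
  qed
  also have "\<dots> = (\<integral>\<^sup>+x. ennreal (x i) \<partial>PiM (insert i J) D) + (\<integral>\<^sup>+x. (\<Squnion>j\<in>J. ennreal (x j)) \<partial>PiM (insert i J) D)"
    using assms(2) by (intro nn_integral_add m mS) auto
  also have "(\<integral>\<^sup>+x. ennreal (x i) \<partial>PiM (insert i J) D) = (\<integral>\<^sup>+v. ennreal v \<partial>D i)"
    by (rule nn_integral_PiM_component) (use assms in auto)
  also have "(\<integral>\<^sup>+x. (\<Squnion>j\<in>J. ennreal (x j)) \<partial>PiM (insert i J) D) = expected_max D J"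
  proof -
    obtain D' where D': "PiM (insert i J) D = PiM (insert i J) D'" "\<And>j. prob_space (D' j)" "\<And>j. j \<in> insert i J \<Longrightarrow> D' j = D j"
      by (rule PiM_cong_prob[of "insert i J" D], rule nonneg_lawD(1)[OF assms(2)], assumption, rule that; assumption)
    have J: "PiM J D = PiM J D'" by (rule PiM_cong) (auto simp: D'(3))
    interpret product_sigma_finite D'
      by (simp add: product_sigma_finite_def prob_space_imp_sigma_finite[OF D'(2)])
    interpret i: prob_space "D' i" by (rule D'(2))
    have "(\<integral>\<^sup>+x. (\<Squnion>j\<in>J. ennreal (x j)) \<partial>PiM (insert i J) D') =
        (\<integral>\<^sup>+x. \<integral>\<^sup>+y. (\<Squnion>j\<in>J. ennreal ((x(i := y)) j)) \<partial>D' i \<partial>PiM J D')"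
      by (rule product_nn_integral_insert[OF assms(1,3)]) (use mS[of "insert i J"] D'(1) in auto)
    also have "\<dots> = (\<integral>\<^sup>+x. \<integral>\<^sup>+y. (\<Squnion>j\<in>J. ennreal (x j)) \<partial>D' i \<partial>PiM J D')"
      using assms(3) by (intro nn_integral_cong SUP_cong) auto
    also have "\<dots> = (\<integral>\<^sup>+x. (\<Squnion>j\<in>J. ennreal (x j)) \<partial>PiM J D')" by (simp add: i.emeasure_space_1)
    finally show ?thesis unfolding expected_max_def D'(1) J .
  qed
  finally show ?thesis .
qed

context small_laws begin

text \<open>\<open>round_row\<close> is applied to one variable after the other; the bound never
  decreases.\<close>

lemma exists_rounding:
  "\<exists>sl A. (\<forall>j\<in>J. sl j < T \<and> A j \<in> sets borel) \<and>
    reward_bound T J u\<^sub>0 r\<^sub>0 \<le> reward_bound T J (\<lambda>j. u_row (D j) (sl j) (A j)) (\<lambda>j. r_row (D j) (sl j) (A j))"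
proof -
  have cong: "reward_bound T J u r = reward_bound T J u' r'" if "\<And>j. j \<in> J \<Longrightarrow> u j = u' j" "\<And>j. j \<in> J \<Longrightarrow> r j = r' j"
    for u u' r r' :: "nat \<Rightarrow> nat \<Rightarrow> real"
    using that by (auto simp: reward_bound_def intro!: sum.cong prod.cong arg_cong2[where f = "(*)"])
  have "\<exists>sl A. (\<forall>j\<in>F. sl j < T \<and> A j \<in> sets borel) \<and>
      reward_bound T J u\<^sub>0 r\<^sub>0 \<le> reward_bound T J (\<lambda>j. if j \<in> F then u_row (D j) (sl j) (A j) else u\<^sub>0 j)
        (\<lambda>j. if j \<in> F then r_row (D j) (sl j) (A j) else r\<^sub>0 j)" if "F \<subseteq> J" for F
    using finite_subset[OF that finite_J] that
  proof (induction F)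
    case (insert j F)
    then obtain sl A where IH: "\<forall>j\<in>F. sl j < T \<and> A j \<in> sets borel"
      "reward_bound T J u\<^sub>0 r\<^sub>0 \<le> reward_bound T J (\<lambda>j. if j \<in> F then u_row (D j) (sl j) (A j) else u\<^sub>0 j)
        (\<lambda>j. if j \<in> F then r_row (D j) (sl j) (A j) else r\<^sub>0 j)" (is "_ \<le> reward_bound T J ?u ?r")
      by auto
    have eq: "?u(j := u\<^sub>0 j) = ?u" "?r(j := r\<^sub>0 j) = ?r" using insert.hyps(2) by auto
    obtain s B where s: "s < T" and B: "B \<in> {{W s<..}, {q j..}, {q j<..}}"
      and le: "reward_bound T J (?u(j := u\<^sub>0 j)) (?r(j := r\<^sub>0 j)) \<le>
        reward_bound T J (?u(j := u_row (D j) s B)) (?r(j := r_row (D j) s B))"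
      using round_row[of j ?u ?r] insert.prems by blast
    have upd: "?u(j := u_row (D j) s B) = (\<lambda>i. if i \<in> insert j F then u_row (D i) ((sl(j := s)) i) ((A(j := B)) i) else u\<^sub>0 i)"
      "?r(j := r_row (D j) s B) = (\<lambda>i. if i \<in> insert j F then r_row (D i) ((sl(j := s)) i) ((A(j := B)) i) else r\<^sub>0 i)"
      by auto
    have "\<forall>i\<in>insert j F. (sl(j := s)) i < T \<and> (A(j := B)) i \<in> sets borel"
      using IH(1) s B by auto
    then show ?case
      using order_trans[OF IH(2) le[unfolded eq, unfolded upd]]
      by (intro exI[of _ "sl(j := s)"] exI[of _ "A(j := B)"] conjI)
  qed auto
  from this[OF subset_refl] obtain sl A where sl: "\<forall>j\<in>J. sl j < T \<and> A j \<in> sets borel"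
    and le: "reward_bound T J u\<^sub>0 r\<^sub>0 \<le> reward_bound T J (\<lambda>j. if j \<in> J then u_row (D j) (sl j) (A j) else u\<^sub>0 j)
        (\<lambda>j. if j \<in> J then r_row (D j) (sl j) (A j) else r\<^sub>0 j)"
    by blast
  have "reward_bound T J (\<lambda>j. if j \<in> J then u_row (D j) (sl j) (A j) else u\<^sub>0 j)
        (\<lambda>j. if j \<in> J then r_row (D j) (sl j) (A j) else r\<^sub>0 j) =
      reward_bound T J (\<lambda>j. u_row (D j) (sl j) (A j)) (\<lambda>j. r_row (D j) (sl j) (A j))"
    by (rule cong) simp_all
  with sl le show ?thesis by auto
qed

lemma reward_ge_W:
  assumes "reward_bound T J u\<^sub>0 r\<^sub>0 \<le> b"
  shows "W T / (1 + 6 * \<delta>) \<le> b"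
proof -
  have "W T \<le> (1 + 6 * \<delta>) * b"
    using W_le_reward_bound mult_left_mono[OF assms, of "1 + 6 * \<delta>"] \<delta>_pos by linarith
  then show ?thesis using \<delta>_pos by (simp add: divide_le_eq mult.commute)
qed

lemma opt_free_ge: "ennreal (W T / (1 + 6 * \<delta>)) \<le> opt_free D J"
proof -
  obtain sl A where sl: "\<forall>j\<in>J. sl j < T \<and> A j \<in> sets borel"
    and le: "reward_bound T J u\<^sub>0 r\<^sub>0 \<le> reward_bound T J (\<lambda>j. u_row (D j) (sl j) (A j)) (\<lambda>j. r_row (D j) (sl j) (A j))"
    using exists_rounding by blast
  \<comment> \<open>Increasing order of \<open>T - sl j\<close> puts large slots first; slots lie
    below \<open>T\<close>, so truncated subtraction does no harm.\<close>
  define js where "js = sort_key (\<lambda>j. T - sl j) (sorted_list_of_set J)"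
  have "sorted_wrt (\<lambda>a b. T - sl a \<le> T - sl b) js"
    using sorted_sort_key[of "\<lambda>j. T - sl j" "sorted_list_of_set J"] by (simp add: js_def sorted_wrt_map)
  then have srt: "sorted_wrt (\<lambda>a b. sl b \<le> sl a) js"
    by (rule sorted_wrt_mono_rel[rotated]) (use sl finite_J in \<open>auto simp: js_def\<close>)
  have "ennreal (W T / (1 + 6 * \<delta>)) \<le> expected_reward D J (set_policy (map (\<lambda>j. (j, A j)) js))"
    using reward_ge_W[OF le] sl srt law mean finite_J
    by (intro order_trans[OF ennreal_leI expected_reward_ge_slots[where T = T and sl = sl]]) (auto simp: js_def)
  also have "\<dots> \<le> opt_free D J"
    unfolding opt_free_def
    by (intro SUP_upper CollectI measurable_set_policy) (use sl finite_J in \<open>auto simp: js_def\<close>)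
  finally show ?thesis .
qed

end

text \<open>The infimum of the nonnegative points where the distribution function reaches 1 -
  \<delta>: right continuity controls the open tail and the left limit the closed one. At 0,
  nonnegativity of the law replaces the left limit.\<close>

lemma quantile_exists:
  assumes "nonneg_law \<mu>" "0 < \<delta>" "\<delta> < 1"
  shows "\<exists>q. quantile \<delta> \<mu> q"
proof -
  interpret real_distribution \<mu>
    using nonneg_lawD[OF assms(1)] by (simp add: real_distribution_def real_distribution_axioms_def)
  have tail: "measure \<mu> {x<..} = 1 - cdf \<mu> x" for x
    using prob_compl[of "{..x}"] by (simp add: cdf_def Compl_eq_Diff_UNIV[symmetric])
  have tail': "measure \<mu> {x..} = 1 - measure \<mu> {..<x}" for x
    using prob_compl[of "{..<x}"] by (simp add: Compl_eq_Diff_UNIV[symmetric])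
  define S where "S = {x. 0 \<le> x \<and> 1 - \<delta> \<le> cdf \<mu> x}"
  define q where "q = Inf S"
  have "\<forall>\<^sub>F x in at_top. 1 - \<delta> < cdf \<mu> x"
    using order_tendstoD(1)[OF cdf_lim_at_top_prob, of "1 - \<delta>"] assms by simp
  then have "\<forall>\<^sub>F x in at_top. 0 \<le> x \<and> 1 - \<delta> < cdf \<mu> x"
    by (intro eventually_conj eventually_ge_at_top)
  then obtain x where "x \<in> S"
    using eventually_happens[of _ at_top] by (force simp: S_def)
  then have S: "S \<noteq> {}" "bdd_below S" by (auto simp: S_def bdd_below_def)
  have q0: "0 \<le> q" unfolding q_def by (rule cInf_greatest[OF S(1)]) (simp add: S_def)
  have "\<forall>\<^sub>F y in at_right q. 1 - \<delta> \<le> cdf \<mu> y"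
  proof (rule eventually_at_right_less[of q, THEN eventually_mono])
    fix y assume "q < y"
    then obtain x where "x \<in> S" "x < y"
      using cInf_less_iff[OF S] by (auto simp: q_def)
    then show "1 - \<delta> \<le> cdf \<mu> y"
      using cdf_nondecreasing[of x y] by (simp add: S_def)
  qed
  then have 1: "1 - \<delta> \<le> cdf \<mu> q"
    using cdf_is_right_cont[of q] by (intro tendsto_lowerbound[of "cdf \<mu>" _ "at_right q"]) (auto simp: continuous_within)
  have 2: "\<delta> \<le> measure \<mu> {q..}"
  proof (cases "q = 0")
    case True
    have "AE v in \<mu>. v \<in> {0..}" using assms(1) by (simp add: nonneg_law_def)
    then have "measure \<mu> {0..} = 1" by (rule prob_eq_1[THEN iffD2, rotated]) simp
    then show ?thesis using True assms by simp
  next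
    case False
    have "\<forall>\<^sub>F y in at_left q. cdf \<mu> y \<le> 1 - \<delta>"
    proof (rule eventually_mono[OF eventually_at_left_real])
      show "0 < q" using False q0 by simp
      fix y assume y: "y \<in> {0<..<q}"
      then have "y \<notin> S" using cInf_lower[OF _ S(2), of y] by (auto simp: q_def)
      then show "cdf \<mu> y \<le> 1 - \<delta>" using y by (simp add: S_def)
    qed
    then have "measure \<mu> {..<q} \<le> 1 - \<delta>"
      using cdf_at_left[of q] by (intro tendsto_upperbound[of "cdf \<mu>" _ "at_left q"]) auto
    then show ?thesis by (simp add: tail')
  qed
  show ?thesis using q0 1 2 by (auto simp: quantile_def tail)
qed

subsection \<open>Choosing the variables to remove\<close>

text \<open>Lowering the level by the factor \<open>1 - 1/e\<close> costs fewer than \<open>e L\<close> variables, and \<open>3 e L\<close> such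
  steps lower it by the factor \<open>e^3\<close>.\<close>

lemma few_large_quantiles:
  fixes q :: "nat \<Rightarrow> real" and e L :: nat
  assumes I: "finite I" and e: "2 \<le> e" and L: "ln e \<le> L" and M: "\<And>j. j \<in> I \<Longrightarrow> q j \<le> M" "0 \<le> M"
    and sparse: "\<And>i. i \<in> I \<Longrightarrow> card {j\<in>I. q i < q j} \<le> 3 * (e * L)\<^sup>2 \<Longrightarrow>
      card {j\<in>I. q j \<le> q i \<and> (real e - 1) * q i \<le> e * q j} < e * L"
  shows "card {j\<in>I. M < e ^ 3 * q j} \<le> 3 * (e * L)\<^sup>2"
proof -
  define p where "p = 1 - 1 / real e"
  have p: "0 \<le> p" "p * e = real e - 1" using e by (auto simp: p_def field_simps)
  have claim: "card {j\<in>I. p ^ m * M < q j} \<le> m * (e * L)" if "m \<le> 3 * (e * L)" for m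
    using that
  proof (induction m)
    case 0
    have "{j\<in>I. p ^ 0 * M < q j} = {}" using M by force
    then show ?case by (metis card.empty zero_le)
  next
    case (Suc m)
    let ?A = "{j\<in>I. p ^ m * M < q j}" and ?B = "{j\<in>I. p ^ Suc m * M < q j}"
    show ?case
    proof (cases "{j\<in>I. q j \<le> p ^ m * M} = {}")
      case True
      then have "?B \<subseteq> ?A" by force
      then have "card ?B \<le> card ?A" using I by (intro card_mono) auto
      then show ?thesis using Suc by simp
    next
      case False
      \<comment> \<open>The level is first lowered to an actual quantile \<open>q i\<close>, where
        the sparsity assumption can be applied.\<close>
      define t where "t = Max (q ` {j\<in>I. q j \<le> p ^ m * M})"
      have "t \<in> q ` {j\<in>I. q j \<le> p ^ m * M}" unfolding t_def using False I by (intro Max_in) auto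
      then obtain i where i: "i \<in> I" "q i \<le> p ^ m * M" "t = q i" by auto
      have top: "q j \<le> q i" if "j \<in> I" "q j \<le> p ^ m * M" for j
        unfolding i(3)[symmetric] t_def using that I by (intro Max_ge) auto
      have sub: "{j\<in>I. q i < q j} \<subseteq> ?A" using top by force
      have "card {j\<in>I. q i < q j} \<le> card ?A" using I sub by (intro card_mono) auto
      also have "\<dots> \<le> m * (e * L)" using Suc by simp
      also have "\<dots> \<le> 3 * (e * L)\<^sup>2" using Suc.prems by (simp add: power2_eq_square mult_le_mono)
      finally have few: "card {j\<in>I. q j \<le> q i \<and> (real e - 1) * q i \<le> e * q j} < e * L" by (rule sparse[OF i(1)])
      have "?B \<subseteq> ?A \<union> {j\<in>I. q j \<le> q i \<and> (real e - 1) * q i \<le> e * q j}"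
      proof safe
        fix j assume j: "j \<in> I" "p ^ Suc m * M < q j" "\<not> p ^ m * M < q j"
        then show "q j \<le> q i" using top by auto
        have "p * q i \<le> p * (p ^ m * M)" using i p by (intro mult_left_mono) auto
        also have "\<dots> \<le> q j" using j by simp
        finally have "e * (p * q i) \<le> e * q j" by (intro mult_left_mono) auto
        then show "(real e - 1) * q i \<le> e * q j" using p(2) by (metis mult.assoc mult.commute)
      qed
      then have "card ?B \<le> card (?A \<union> {j\<in>I. q j \<le> q i \<and> (real e - 1) * q i \<le> e * q j})"
        using I by (intro card_mono) auto
      also have "\<dots> \<le> card ?A + card {j\<in>I. q j \<le> q i \<and> (real e - 1) * q i \<le> e * q j}" by (rule card_Un_le)
      finally show ?thesis using few Suc by simp
    qed
  qed
  have small: "p ^ (3 * (e * L)) * e ^ 3 \<le> 1"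
  proof -
    have "p \<le> exp (- 1 / e)" using exp_ge_add_one_self[of "- 1 / real e"] by (simp add: p_def)
    then have "p ^ (3 * (e * L)) \<le> exp (- 1 / e) ^ (3 * (e * L))" using p by (intro power_mono)
    also have "\<dots> = exp (- 3 * L)" using e by (simp add: exp_of_nat_mult[symmetric])
    also have "\<dots> \<le> exp (- 3 * ln e)" using L by simp
    also have "\<dots> = inverse (real e ^ 3)"
      using e exp_of_nat_mult[of 3 "ln (real e)"] by (simp add: exp_minus)
    finally show ?thesis using e by (simp add: field_simps)
  qed
  have "{j\<in>I. M < e ^ 3 * q j} \<subseteq> {j\<in>I. p ^ (3 * (e * L)) * M < q j}"
  proof safe
    fix j assume j: "M < e ^ 3 * q j"
    have "(p ^ (3 * (e * L)) * e ^ 3) * M \<le> M" using small M(2) by (intro mult_left_le_one_le) (auto simp: p)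
    also note j
    finally have "e ^ 3 * (p ^ (3 * (e * L)) * M) < e ^ 3 * q j" by (simp add: mult_ac)
    then show "p ^ (3 * (e * L)) * M < q j" using e by (simp add: mult_less_cancel_left_pos)
  qed
  then have "card {j\<in>I. M < e ^ 3 * q j} \<le> card {j\<in>I. p ^ (3 * (e * L)) * M < q j}"
    using I by (intro card_mono) auto
  also have "\<dots> \<le> 3 * (e * L)\<^sup>2" using claim[of "3 * (e * L)"] by (simp add: power2_eq_square)
  finally show ?thesis .
qed

text \<open>10 = 4 + 6 adds the relative losses in the bound for the maximum and in the reward,
  combined in \<open>guarantee\<close>; \<open>2 / kertz_const\<close> comes from the case of a
  single dominating variable.\<close>

definition loss_const :: real where
  "loss_const = 10 + 2 / kertz_const"

context small_laws begin

lemma guarantee: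
  assumes max: "expected_max D J \<le> ennreal ((1 + 4 * \<delta>) * W T / kertz_const)" and b: "W T / (1 + 6 * \<delta>) \<le> b"
  shows "ennreal (kertz_const - loss_const * \<delta>) * expected_max D J \<le> ennreal b"
proof -
  let ?x = "kertz_const - loss_const * \<delta>"
  have "?x * ((1 + 4 * \<delta>) * W T / kertz_const) \<le> W T / (1 + 6 * \<delta>)"
  proof -
    have "?x \<le> kertz_const * (1 - 10 * \<delta>)"
    proof -
      have "kertz_const * \<delta> \<le> 1 * \<delta>"
        using \<delta>_pos kertz_const_less_1 by (intro mult_right_mono) auto
      moreover have "0 \<le> 2 / kertz_const * \<delta>" using \<delta>_pos kertz_const_pos by simp
      moreover have "loss_const * \<delta> = 10 * \<delta> + 2 / kertz_const * \<delta>"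
        by (simp add: loss_const_def distrib_right)
      moreover have "kertz_const * (1 - 10 * \<delta>) = kertz_const - 10 * (kertz_const * \<delta>)"
        by (simp add: algebra_simps)
      ultimately show ?thesis using \<delta>_pos by linarith
    qed
    then have "?x * ((1 + 4 * \<delta>) * W T / kertz_const) \<le> kertz_const * (1 - 10 * \<delta>) * ((1 + 4 * \<delta>) * W T / kertz_const)"
      using \<delta>_pos kertz_const_pos W_nonneg[of T] by (intro mult_right_mono) auto
    also have "\<dots> = (1 - 10 * \<delta>) * (1 + 4 * \<delta>) * W T" using kertz_const_pos by simp
    also have "\<dots> \<le> 1 / (1 + 6 * \<delta>) * W T"
    proof (rule mult_right_mono)
      have "(1 - 10 * \<delta>) * (1 + 4 * \<delta>) * (1 + 6 * \<delta>) = 1 - 76 * \<delta>\<^sup>2 - 240 * \<delta> ^ 3"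
        by (simp add: algebra_simps power2_eq_square power3_eq_cube)
      also have "\<dots> \<le> 1"
        using zero_le_power2[of \<delta>] zero_le_power[of \<delta> 3] \<delta>_pos by linarith
      finally show "(1 - 10 * \<delta>) * (1 + 4 * \<delta>) \<le> 1 / (1 + 6 * \<delta>)" using \<delta>_pos by (simp add: le_divide_eq)
    qed (rule W_nonneg)
    finally show ?thesis by simp
  qed
  also note b
  finally have *: "?x * ((1 + 4 * \<delta>) * W T / kertz_const) \<le> b" .
  show ?thesis
  proof (cases "0 \<le> ?x")
    case True
    have "ennreal ?x * expected_max D J \<le> ennreal ?x * ennreal ((1 + 4 * \<delta>) * W T / kertz_const)"
      by (intro mult_left_mono max) simp
    also have "\<dots> \<le> ennreal b"
      using True * \<delta>_pos kertz_const_pos W_nonneg[of T] by (simp flip: ennreal_mult add: ennreal_leI)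
    finally show ?thesis .
  qed (simp add: ennreal_neg)
qed

lemma guarantee_window:
  assumes "0 \<le> \<tau>" "\<And>j. j \<in> J \<Longrightarrow> q j \<le> \<tau>" "ln (1 / \<delta>) \<le> \<delta> * card {j\<in>J. (1 - \<delta>) * \<tau> \<le> q j}"
    and "W T / (1 + 6 * \<delta>) \<le> b"
  shows "ennreal (kertz_const - loss_const * \<delta>) * expected_max D J \<le> ennreal b"
  by (rule guarantee[OF expected_max_le_window assms(4)]) (use assms in auto)

lemma guarantee_rest:
  assumes "0 \<le> \<tau>" "\<And>j. j \<in> J \<Longrightarrow> q j \<le> \<tau>" "\<tau> \<le> \<delta> * W T" and "W T / (1 + 6 * \<delta>) \<le> b"
  shows "ennreal (kertz_const - loss_const * \<delta>) * expected_max D J \<le> ennreal b"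
proof (rule guarantee[OF order_trans[OF expected_max_le_rest[OF assms(1,2)]] assms(4)])
  have "\<tau> * kertz_const \<le> (\<delta> * W T) * 1"
    using assms kertz_const_pos kertz_const_less_1 by (intro mult_mono) auto
  also have "\<dots> \<le> 4 * \<delta> * W T" using \<delta>_pos W_nonneg[of T] by simp
  finally show "ennreal (W T / kertz_const + \<tau>) \<le> ennreal ((1 + 4 * \<delta>) * W T / kertz_const)"
    using kertz_const_pos by (intro ennreal_leI) (simp add: field_simps)
qed

text \<open>The mean m of \<open>D i\<close> is at least \<open>Q * \<delta>\<close>, while the
  maximum over \<open>J\<close> is at most \<open>W T / kertz_const + Q * \<delta> ^ 3\<close>,
  hence at most the fraction \<open>2 / kertz_const * \<delta>\<close> of m. So taking variable
  \<open>i\<close> alone is good enough.\<close>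

lemma guarantee_single:
  assumes i: "i \<notin> J" "nonneg_law (D i)" "finite_mean (D i)" "quantile \<delta> (D i) Q"
    and small: "\<And>j. j \<in> J \<Longrightarrow> q j \<le> Q * \<delta> ^ 3" "W T < Q * \<delta>\<^sup>2"
  shows "ennreal (kertz_const - loss_const * \<delta>) * expected_max D (insert i J) \<le> (\<integral>\<^sup>+v. ennreal v \<partial>D i)"
proof -
  have Q: "0 \<le> Q" "\<delta> \<le> measure (D i) {Q..}" using i(4) by (auto simp: quantile_def)
  define m where "m = gain_on (D i) UNIV"
  have m: "(\<integral>\<^sup>+v. ennreal v \<partial>D i) = ennreal m" "0 \<le> m"
    using ennreal_gain_on[OF i(3), of UNIV] by (simp_all add: m_def gain_on_nonneg)
  interpret i: prob_space "D i" by (rule nonneg_lawD(1)[OF i(2)])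
  have "ennreal (Q * \<delta>) \<le> ennreal (Q * measure (D i) {Q..})"
    using Q by (intro ennreal_leI mult_left_mono)
  also have "\<dots> = ennreal Q * emeasure (D i) {Q..}"
    using Q(1) by (simp add: i.emeasure_eq_measure ennreal_mult)
  also have "\<dots> = (\<integral>\<^sup>+v. ennreal Q * indicator {Q..} v \<partial>D i)"
    using nonneg_lawD(2)[OF i(2)] by (simp add: nn_integral_cmult_indicator)
  also have "\<dots> \<le> (\<integral>\<^sup>+v. ennreal v \<partial>D i)"
    by (intro nn_integral_mono) (auto simp: indicator_def ennreal_leI)
  finally have Qm: "Q * \<delta> \<le> m" using m Q \<delta>_pos by (simp add: m)
  have "W T / kertz_const + Q * \<delta> ^ 3 \<le> 2 / kertz_const * \<delta> * m"
  proof -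
    have "W T / kertz_const \<le> Q * \<delta>\<^sup>2 / kertz_const"
      using small(2) kertz_const_pos by (intro divide_right_mono) auto
    moreover have "Q * \<delta> ^ 3 \<le> Q * \<delta>\<^sup>2 / kertz_const"
    proof -
      have "\<delta> * kertz_const \<le> 1" using \<delta>_le \<delta>_pos kertz_const_less_1 kertz_const_pos by (intro mult_le_one) auto
      then have "Q * \<delta>\<^sup>2 * (\<delta> * kertz_const) \<le> Q * \<delta>\<^sup>2 * 1" using Q by (intro mult_left_mono) auto
      then show ?thesis using kertz_const_pos by (simp add: field_simps power3_eq_cube power2_eq_square)
    qed
    moreover have "Q * \<delta>\<^sup>2 / kertz_const \<le> \<delta> * m / kertz_const"
      using mult_left_mono[OF Qm, of \<delta>] \<delta>_pos kertz_const_pos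
      by (intro divide_right_mono) (auto simp: power2_eq_square mult_ac)
    ultimately show ?thesis by simp
  qed
  then have "expected_max D J \<le> ennreal (2 / kertz_const * \<delta> * m)"
    using small(1) Q \<delta>_pos by (intro order_trans[OF expected_max_le_rest[of "Q * \<delta> ^ 3"] ennreal_leI]) auto
  then have max: "expected_max D (insert i J) \<le> ennreal (m + 2 / kertz_const * \<delta> * m)"
  proof -
    have "expected_max D (insert i J) \<le> ennreal m + expected_max D J"
      using expected_max_insert[of J i D] finite_J law i m by auto
    also have "\<dots> \<le> ennreal m + ennreal (2 / kertz_const * \<delta> * m)"
      by (intro add_left_mono) fact
    also have "\<dots> = ennreal (m + 2 / kertz_const * \<delta> * m)"
      using m(2) \<delta>_pos kertz_const_pos by simp
    finally show ?thesis .
  qed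
  let ?x = "kertz_const - loss_const * \<delta>"
  define y where "y = 2 / kertz_const * \<delta>"
  note max = max[folded y_def]
  have y: "0 \<le> y" using kertz_const_pos \<delta>_pos by (simp add: y_def)
  have "?x \<le> 1 - y"
    using kertz_const_less_1 \<delta>_pos by (simp add: loss_const_def y_def algebra_simps)
  show ?thesis
  proof (cases "0 \<le> ?x")
    case True
    have "?x * (m + y * m) \<le> (1 - y) * (m + y * m)"
      using \<open>?x \<le> 1 - y\<close> y m(2) by (intro mult_right_mono) auto
    also have "\<dots> = m - y * y * m" by (simp add: algebra_simps)
    also have "\<dots> \<le> m" using y m(2) by simp
    finally have *: "?x * (m + y * m) \<le> m" .
    have "ennreal ?x * expected_max D (insert i J) \<le> ennreal ?x * ennreal (m + y * m)"
      by (intro mult_left_mono max) simp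
    also have "\<dots> \<le> ennreal m"
      using True * y m(2) by (simp add: ennreal_leI flip: ennreal_mult del: ennreal_plus)
    finally show ?thesis by (simp add: m)
  qed (simp add: ennreal_neg)
qed

end

text \<open>27 = 3 * 3^2: the budget has the factor 3, and \<open>L\<close> may exceed
  ln(1/\<epsilon>) by another factor 3, which leaves room for rounding and for binary
  logarithms.\<close>

lemma budget_bound:
  fixes \<epsilon> :: real and e L :: nat
  assumes "0 < \<epsilon>" "\<epsilon> \<le> 1/4" "real e \<le> 1 / \<epsilon>" "real L \<le> 3 * ln (1 / \<epsilon>)"
  shows "real (3 * (e * L)\<^sup>2) \<le> 27 * (inverse \<epsilon> * ln (1 / \<epsilon>))\<^sup>2"
proof -
  have "real e * real L \<le> (1 / \<epsilon>) * (3 * ln (1 / \<epsilon>))"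
    using assms by (intro mult_mono) auto
  then have "(real e * real L)\<^sup>2 \<le> ((1 / \<epsilon>) * (3 * ln (1 / \<epsilon>)))\<^sup>2"
    by (intro power_mono) auto
  also have "((1 / \<epsilon>) * (3 * ln (1 / \<epsilon>)))\<^sup>2 = 9 * (inverse \<epsilon> * ln (1 / \<epsilon>))\<^sup>2"
    by (simp only: power_mult_distrib inverse_eq_divide) simp
  finally show ?thesis by simp
qed

text \<open>Replacing \<epsilon> by the reciprocal of an integer at most doubles it; this is the 2
  in front of \<open>loss_const\<close>.\<close>

lemma coarse_eps:
  fixes \<epsilon> :: real and e :: nat
  assumes "0 < \<epsilon>" "\<epsilon> \<le> 1/4" "1 / \<epsilon> < real e + 1"
  shows "kertz_const - 2 * loss_const * \<epsilon> \<le> kertz_const - loss_const * (1 / e)"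
proof -
  have "4 \<le> 1 / \<epsilon>" using assms by (simp add: field_simps)
  then have e: "3 < real e" using assms by linarith
  have "1 < \<epsilon> * (real e + 1)" using assms by (simp add: field_simps)
  also have "\<dots> \<le> \<epsilon> * (2 * real e)" using assms(1) e by (intro mult_left_mono) auto
  finally have "1 / e \<le> 2 * \<epsilon>" using e by (simp add: field_simps)
  then have "loss_const * (1 / e) \<le> loss_const * (2 * \<epsilon>)"
    using kertz_const_pos by (intro mult_left_mono) (auto simp: loss_const_def)
  then show ?thesis by simp
qed

lemma ln_4_gt_1: "1 < ln (4::real)"
proof -
  have "exp 1 < (4::real)" using exp_le by linarith
  then show ?thesis by (metis exp_less_cancel_iff exp_ln zero_less_numeral)
qed

section \<open>Existence of the subset for arbitrary laws\<close>

theorem prophet_removal: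
  fixes D :: "nat \<Rightarrow> real measure"
  assumes D_law: "\<And>i. i < n \<Longrightarrow> nonneg_law (D i)" and \<epsilon>: "0 < \<epsilon>"
  shows "\<exists>J\<subseteq>{..<n}. real (card ({..<n} - J)) \<le> 27 * (inverse \<epsilon> * ln (1 / \<epsilon>))\<^sup>2 \<and>
    ennreal (kertz_const - 2 * loss_const * \<epsilon>) * expected_max D J \<le> opt_free D J"
proof (cases "\<epsilon> \<le> 1/4 \<and> n \<noteq> 0")
  case False
  \<comment> \<open>As \<open>loss_const\<close> exceeds 10, the factor is negative for \<epsilon> >
    1/4, and \<open>ennreal\<close> makes it 0.\<close>
  have "kertz_const - 2 * loss_const * \<epsilon> \<le> 0 \<or> n = 0"
  proof (cases "n = 0")
    case False
    then have "1/4 < \<epsilon>" using \<open>\<not> (\<epsilon> \<le> 1/4 \<and> n \<noteq> 0)\<close> by auto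
    then have "20 * (1/4) < 2 * loss_const * \<epsilon>"
      using kertz_const_pos by (intro mult_le_less_imp_less) (auto simp: loss_const_def)
    then show ?thesis using kertz_const_less_1 by simp
  qed simp
  then have "ennreal (kertz_const - 2 * loss_const * \<epsilon>) * expected_max D {..<n} = 0"
    by (auto simp: ennreal_neg expected_max_def bot_ennreal)
  then have "ennreal (kertz_const - 2 * loss_const * \<epsilon>) * expected_max D {..<n} \<le> opt_free D {..<n}"
    by (simp only: zero_le)
  then show ?thesis by (intro exI[of _ "{..<n}"]) simp
next
  case True
  then have \<epsilon>4: "\<epsilon> \<le> 1/4" and n: "0 < n" by auto
  show ?thesis
  proof (cases "\<forall>i<n. finite_mean (D i)")
    case False
    then obtain i where i: "i < n" "(\<integral>\<^sup>+v. ennreal v \<partial>D i) = \<top>"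
      by (auto simp: finite_mean_def less_top[symmetric])
    \<comment> \<open>A variable of infinite mean is inspected first and always accepted; the others
      complete the schedule, from which \<open>expected_reward_ge_first\<close> reads off the index
      set.\<close>
    define sch where "sch = map (\<lambda>j. (j, {0::real..})) (filter (\<lambda>j. j \<noteq> i) [0..<n])"
    have sch: "insert i (set (map fst sch)) = {..<n}" "distinct (map fst ((i, {0..}) # sch))"
      using i(1) by (auto simp: sch_def comp_def)
    have "\<top> \<le> expected_reward D {..<n} (set_policy ((i, {0..}) # sch))"
      using expected_reward_ge_first[OF sch(2), of D] D_law i(2) unfolding sch(1) by auto
    also have "\<dots> \<le> opt_free D {..<n}"
      unfolding opt_free_def by (intro SUP_upper CollectI measurable_set_policy) (auto simp: sch_def)
    finally have "opt_free D {..<n} = \<top>" by (simp add: top_unique)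
    then show ?thesis by (intro exI[of _ "{..<n}"]) simp
  next
    case True
    then have D_mean: "\<And>i. i < n \<Longrightarrow> finite_mean (D i)" by blast
    \<comment> \<open>An integer value of 1/\<delta>, as in the program, so that both parts share
      their lemmas.\<close>
    define e where "e = nat \<lfloor>1 / \<epsilon>\<rfloor>"
    define \<delta> where "\<delta> = 1 / real e"
    have 4: "4 \<le> 1 / \<epsilon>" using \<epsilon> \<epsilon>4 by (simp add: field_simps)
    have e: "real e \<le> 1 / \<epsilon>" "1 / \<epsilon> < real e + 1"
      using 4 unfolding e_def by linarith+
    have e4: "4 \<le> e" using 4 by (simp add: e_def le_nat_floor le_floor_iff)
    have \<delta>: "0 < \<delta>" "\<delta> \<le> 1/4" using e4 by (auto simp: \<delta>_def field_simps)
    have le: "ennreal (kertz_const - 2 * loss_const * \<epsilon>) \<le> ennreal (kertz_const - loss_const * \<delta>)"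
      unfolding \<delta>_def by (intro ennreal_leI coarse_eps \<epsilon> \<epsilon>4 e)
    define L where "L = nat \<lceil>ln e\<rceil>"
    have lne: "ln e \<le> ln (1 / \<epsilon>)"
      by (rule ln_mono) (use e(1) e4 in auto)
    have "1 < ln (1 / \<epsilon>)" using ln_4_gt_1 ln_le_cancel_iff[of 4 "1 / \<epsilon>"] 4 by linarith
    moreover have "0 \<le> ln (real e)" using e4 by simp
    ultimately have L: "ln e \<le> L" "L \<le> 3 * ln (1 / \<epsilon>)"
      using lne unfolding L_def by linarith+
    note budget = budget_bound[OF \<epsilon> \<epsilon>4 e(1) L(2)]
    have "\<forall>i. \<exists>q. i < n \<longrightarrow> quantile \<delta> (D i) q"
      using quantile_exists[OF D_law, of _ \<delta>] \<delta> by auto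
    then obtain q where q: "\<And>i. i < n \<Longrightarrow> quantile \<delta> (D i) (q i)" by metis
    have q0: "0 \<le> q i" if "i < n" for i using q[OF that] by (simp add: quantile_def)
    have small: "small_laws D J q \<delta> n" if "J \<subseteq> {..<n}" for J
      using that n \<delta> D_law D_mean q card_mono[OF _ that] by unfold_locales (auto intro: finite_subset)
    show ?thesis
    proof (cases "\<exists>i<n. card {j\<in>{..<n}. q i < q j} \<le> 3 * (e * L)\<^sup>2 \<and>
        e * L \<le> card {j\<in>{..<n}. q j \<le> q i \<and> (real e - 1) * q i \<le> e * q j}")
      case True
      then obtain i where i: "i < n" "card {j\<in>{..<n}. q i < q j} \<le> 3 * (e * L)\<^sup>2"
        "e * L \<le> card {j\<in>{..<n}. q j \<le> q i \<and> (real e - 1) * q i \<le> e * q j}" by blast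
      define J where "J = {j\<in>{..<n}. q j \<le> q i}"
      have J: "J \<subseteq> {..<n}" by (auto simp: J_def)
      interpret small_laws D J q \<delta> n by (rule small[OF J])
      have "ennreal (kertz_const - loss_const * \<delta>) * expected_max D J \<le> ennreal (W n / (1 + 6 * \<delta>))"
      proof (rule guarantee_window[of "q i"])
        have "{j\<in>{..<n}. q j \<le> q i \<and> (real e - 1) * q i \<le> e * q j} = {j\<in>J. (1 - \<delta>) * q i \<le> q j}"
          using e4 by (auto simp: J_def \<delta>_def field_simps)
        then have "real e * L \<le> real (card {j\<in>J. (1 - \<delta>) * q i \<le> q j})"
          using i(3) by (simp flip: of_nat_mult)
        \<comment> \<open>Each variable in the window carries mass 1/e, so \<open>e * L\<close> of
          them carry mass \<open>L\<close>, which is at least ln(1/\<delta>).\<close>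
        then have "\<delta> * (real e * L) \<le> \<delta> * card {j\<in>J. (1 - \<delta>) * q i \<le> q j}"
          using \<delta> by (intro mult_left_mono) auto
        then show "ln (1 / \<delta>) \<le> \<delta> * card {j\<in>J. (1 - \<delta>) * q i \<le> q j}"
          using L(1) e4 by (simp add: \<delta>_def)
      qed (use q0 i in \<open>auto simp: J_def\<close>)
      also have "\<dots> \<le> opt_free D J" by (rule opt_free_ge)
      finally have "ennreal (kertz_const - loss_const * \<delta>) * expected_max D J \<le> opt_free D J" .
      moreover have "{..<n} - J = {j\<in>{..<n}. q i < q j}" by (auto simp: J_def)
      ultimately show ?thesis
        using J i(2) budget mult_right_mono[OF le, of "expected_max D J"]
        by (intro exI[of _ J] conjI) (auto intro: order_trans simp del: of_nat_mult of_nat_power)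
    next
      case False
      define M where "M = Max (q ` {..<n})"
      have "M \<in> q ` {..<n}" unfolding M_def using n by (intro Max_in) auto
      then obtain i where i: "i < n" "M = q i" by auto
      have M: "q j \<le> M" if "j < n" for j unfolding M_def using that by (intro Max_ge) auto
      have few: "card {j\<in>{..<n}. M < e ^ 3 * q j} \<le> 3 * (e * L)\<^sup>2"
        by (rule few_large_quantiles) (use False e4 L(1) M q0 i in \<open>auto simp: not_le\<close>)
      define J where "J = {j\<in>{..<n}. e ^ 3 * q j \<le> M}"
      have J: "J \<subseteq> {..<n}" by (auto simp: J_def)
      have rem: "{..<n} - J = {j\<in>{..<n}. M < e ^ 3 * q j}" by (auto simp: J_def)
      have qJ: "q j \<le> M * \<delta> ^ 3" if "j \<in> J" for j
        using that e4 by (simp add: J_def \<delta>_def field_simps)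
      have M0: "0 \<le> M" using q0 i by simp
      interpret small_laws D J q \<delta> n by (rule small[OF J])
      show ?thesis
      \<comment> \<open>The kept quantiles are at most \<open>M * \<delta> ^ 3\<close>, a
        \<delta>-fraction of \<open>W n\<close> unless \<open>W n\<close> is below this level. In
        that case the kept variables are negligible against variable \<open>i\<close>, whose mean is
        at least \<open>M * \<delta>\<close>.\<close>
      proof (cases "W n < M * \<delta>\<^sup>2")
        case False
        have "ennreal (kertz_const - loss_const * \<delta>) * expected_max D J \<le> ennreal (W n / (1 + 6 * \<delta>))"
        proof (rule guarantee_rest[OF _ qJ])
          show "M * \<delta> ^ 3 \<le> \<delta> * W n"
            using mult_left_mono[of "M * \<delta>\<^sup>2" "W n" \<delta>] False \<delta> by (simp add: power3_eq_cube power2_eq_square mult_ac)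
        qed (use M0 \<delta> in auto)
        also have "\<dots> \<le> opt_free D J" by (rule opt_free_ge)
        finally show ?thesis
          using J few rem budget mult_right_mono[OF le, of "expected_max D J"]
          by (intro exI[of _ J] conjI) (auto intro: order_trans simp del: of_nat_mult of_nat_power)
      next
        case True
        then have "0 < M" using W_nonneg[of n] M0 by (cases "M = 0") auto
        have iJ: "i \<notin> J"
        proof
          assume "i \<in> J"
          then have "e ^ 3 * M \<le> M" using i by (simp add: J_def)
          moreover have "1 < real e ^ 3" using e4 by (intro one_less_power) auto
          ultimately show False using \<open>0 < M\<close> by simp
        qed
        define sch where "sch = map (\<lambda>j. (j, {0::real..})) (sorted_list_of_set J)"
        have sch: "set (map fst sch) = J" "distinct (map fst ((i, {0..}) # sch))"
          using iJ finite_J by (auto simp: sch_def comp_def)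
        have "ennreal (kertz_const - loss_const * \<delta>) * expected_max D (insert i J) \<le> (\<integral>\<^sup>+v. ennreal v \<partial>D i)"
          by (rule guarantee_single[OF iJ D_law[OF i(1)] D_mean[OF i(1)] q[OF i(1)]])
             (use qJ True i(2) in auto)
        also have "\<dots> \<le> expected_reward D (insert i J) (set_policy ((i, {0..}) # sch))"
          using expected_reward_ge_first[OF sch(2), of D] D_law i(1) J sch(1) by auto
        also have "\<dots> \<le> opt_free D (insert i J)"
          unfolding opt_free_def by (intro SUP_upper CollectI measurable_set_policy) (auto simp: sch_def)
        finally have "ennreal (kertz_const - loss_const * \<delta>) * expected_max D (insert i J) \<le> opt_free D (insert i J)" .
        moreover have "card ({..<n} - insert i J) \<le> card ({..<n} - J)" by (intro card_mono) auto
        ultimately show ?thesis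
          using J i(1) few rem budget mult_right_mono[OF le, of "expected_max D (insert i J)"]
          by (intro exI[of _ "insert i J"] conjI) (auto intro: order_trans simp del: of_nat_mult of_nat_power)
      qed
    qed
  qed
qed

section \<open>The algorithm as a program on encoded instances\<close>

lemma pint_comp1: "pint F \<Longrightarrow> ptime f \<Longrightarrow> pint (\<lambda>x. F (f x))"
  unfolding pint_def by (rule ptime_comp)

lemma pint_comp2:
  "pint (\<lambda>z. F (fs z) (sn z)) \<Longrightarrow> ptime f \<Longrightarrow> ptime g \<Longrightarrow> pint (\<lambda>x. F (f x) (g x))"
  using pint_comp1[of "\<lambda>z. F (fs z) (sn z)", OF _ ptime_Node, of f g] by simp

lemma pint_comp3:
  "pint (\<lambda>z. F (fs z) (fs (sn z)) (sn (sn z))) \<Longrightarrow> ptime f \<Longrightarrow> ptime g \<Longrightarrow> ptime h \<Longrightarrow>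
    pint (\<lambda>x. F (f x) (g x) (h x))"
  using pint_comp2[of "\<lambda>a b. F a (fs b) (sn b)", OF _ _ ptime_Node] by simp

lemma ptime_comp2:
  "ptime (\<lambda>z. F (fs z) (sn z)) \<Longrightarrow> ptime f \<Longrightarrow> ptime g \<Longrightarrow> ptime (\<lambda>x. F (f x) (g x))"
  using ptime_comp[of "\<lambda>z. F (fs z) (sn z)", OF _ ptime_Node, of f g] by simp

lemma plist_comp1: "plist F \<Longrightarrow> ptime f \<Longrightarrow> plist (\<lambda>x. F (f x))"
  unfolding plist_def by (rule ptime_comp)

lemma pint_abs [ptime_intros]:
  assumes "pint f"
  shows "pint (\<lambda>x. \<bar>f x\<bar>)"
proof -
  have "pint (\<lambda>x. if f x < 0 then - f x else f x)" by (intro ptime_intros assms)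
  then show ?thesis by (simp add: abs_if)
qed

lemma pint_power [ptime_intros]: "pint f \<Longrightarrow> pint (\<lambda>x. f x ^ k)"
  by (induction k) (auto intro!: ptime_intros)

lemma isz_int: "isz (int i) \<le> 1 + i"
  using isz_le[of "int i" i] by (simp del: bit_size.simps(1))

text \<open>The index is the current length of the accumulator, so the increments depend on it and
  the size is bounded directly. Indices come out in decreasing order, which the whole program relies
  on.\<close>

lemma plist_enumerate:
  assumes l: "plist l"
  shows "plist (\<lambda>x. rev (map (\<lambda>(i, h). Node (Atom (int i)) h) (List.enumerate 0 (l x))))"
proof -
  let ?f = "\<lambda>h acc. Node (Node (Atom (int (length (to_list acc)))) h) acc"
  have *: "fold ?f xs (Atom 0) = of_list (rev (map (\<lambda>(i, h). Node (Atom (int i)) h) (List.enumerate 0 xs)))" for xs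
  proof (induction xs rule: rev_induct)
    case (snoc x xs)
    then show ?case by (simp add: enumerate_append_eq)
  qed simp
  have sz: "bit_size (fold ?f xs (Atom 0)) \<le> 1 + length xs * (3 + length xs) + (\<Sum>x\<leftarrow>xs. bit_size x)" for xs
  proof (induction xs rule: rev_induct)
    case (snoc x xs)
    have "length (to_list (fold ?f xs (Atom 0))) = length xs" by (simp add: *)
    then show ?case using snoc isz_int[of "length xs"] by (simp add: algebra_simps del: bit_size.simps(1))
  qed simp
  obtain d where d: "\<And>x. bit_size (of_list (l x)) \<le> (bit_size x + 2) ^ d"
    by (rule ptime_size[OF l[unfolded plist_def]], erule that)
  have "ptime (\<lambda>x. fold ?f (to_list (of_list (l x))) (Atom 0))"
  proof (rule ptime_fold[where Z = "\<lambda>s. 1 + (s + 2) ^ d * (3 + (s + 2) ^ d) + (s + 2) ^ d"])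
    fix x i
    let ?xs = "take i (l x)"
    have le: "length ?xs \<le> (bit_size x + 2) ^ d" "(\<Sum>x\<leftarrow>?xs. bit_size x) \<le> (bit_size x + 2) ^ d"
    proof -
      have "(\<Sum>x\<leftarrow>?xs. bit_size x) + (\<Sum>x\<leftarrow>drop i (l x). bit_size x) = (\<Sum>x\<leftarrow>l x. bit_size x)"
        by (metis append_take_drop_id map_append sum_list_append)
      then show "length ?xs \<le> (bit_size x + 2) ^ d" "(\<Sum>x\<leftarrow>?xs. bit_size x) \<le> (bit_size x + 2) ^ d"
        using d[of x] by (simp_all add: bit_size_of_list)
    qed
    have "length ?xs * (3 + length ?xs) \<le> (bit_size x + 2) ^ d * (3 + (bit_size x + 2) ^ d)"
      using le by (intro mult_mono) auto
    then show "bit_size (fold ?f (take i (to_list (of_list (l x)))) (Atom 0))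
        \<le> 1 + (bit_size x + 2) ^ d * (3 + (bit_size x + 2) ^ d) + (bit_size x + 2) ^ d"
      using sz[of ?xs] le by simp
  qed (intro pbounded_intros ptime_intros l)+
  then show ?thesis by (simp add: plist_def *)
qed

definition "lawsd z = to_list (fs z)"

text \<open>The integer part of 1/\<epsilon>; the instance \<open>z\<close> ends with the numerator
  and the denominator of \<epsilon>.\<close>

definition "epar z = int_of (sn (sn z)) div int_of (fs (sn z))"

definition "items z = rev (map (\<lambda>(i, h). Node (Atom (int i)) h) (List.enumerate 0 (lawsd z)))"

text \<open>Also the list of slots, since there are as many slots as variables.\<close>

definition "idx z = map (\<lambda>it. fs it) (items z)"

definition "npar z = int (length (lawsd z))"

definition "prs it = to_list (sn it)"

text \<open>\<open>vden\<close> and \<open>pden\<close> are common denominators of all values and of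
  all probabilities. Scaled by them the data become integers, and the divisions in \<open>sc\<close>
  and \<open>ph\<close> are exact.\<close>

definition "vden z = (\<Prod>law\<leftarrow>lawsd z. \<Prod>pr\<leftarrow>to_list law. int_of (sn (fs pr)))"

definition "pden z = (\<Prod>law\<leftarrow>lawsd z. \<Prod>pr\<leftarrow>to_list law. int_of (sn (sn pr)))"

definition "sc z r = int_of (fs r) * vden z div int_of (sn r)"

definition "vh z pr = sc z (fs pr)"

definition "ph z pr = int_of (fs (sn pr)) * pden z div int_of (sn (sn pr))"

lemma plist_lawsd [ptime_intros]: "ptime f \<Longrightarrow> plist (\<lambda>x. lawsd (f x))"
  unfolding lawsd_def by (intro ptime_intros)

lemma pint_epar [ptime_intros]: "ptime f \<Longrightarrow> pint (\<lambda>x. epar (f x))"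
  unfolding epar_def by (intro ptime_intros)

lemma plist_items [ptime_intros]: "ptime f \<Longrightarrow> plist (\<lambda>x. items (f x))"
  unfolding items_def by (rule plist_comp1[OF plist_enumerate]) (intro ptime_intros)+

lemma plist_idx [ptime_intros]: "ptime f \<Longrightarrow> plist (\<lambda>x. idx (f x))"
  unfolding idx_def by (intro ptime_intros)

lemma pint_npar [ptime_intros]: "ptime f \<Longrightarrow> pint (\<lambda>x. npar (f x))"
  unfolding npar_def by (intro ptime_intros)

lemma plist_prs [ptime_intros]: "ptime f \<Longrightarrow> plist (\<lambda>x. prs (f x))"
  unfolding prs_def by (intro ptime_intros)

lemma pint_vden [ptime_intros]: "ptime f \<Longrightarrow> pint (\<lambda>x. vden (f x))"
  by (rule pint_comp1) (unfold vden_def, intro ptime_intros)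

lemma pint_pden [ptime_intros]: "ptime f \<Longrightarrow> pint (\<lambda>x. pden (f x))"
  by (rule pint_comp1) (unfold pden_def, intro ptime_intros)

lemma pint_sc [ptime_intros]: "ptime f \<Longrightarrow> ptime g \<Longrightarrow> pint (\<lambda>x. sc (f x) (g x))"
  unfolding sc_def by (intro ptime_intros)

lemma pint_vh [ptime_intros]: "ptime f \<Longrightarrow> ptime g \<Longrightarrow> pint (\<lambda>x. vh (f x) (g x))"
  unfolding vh_def by (intro ptime_intros)

lemma pint_ph [ptime_intros]: "ptime f \<Longrightarrow> ptime g \<Longrightarrow> pint (\<lambda>x. ph (f x) (g x))"
  unfolding ph_def by (intro ptime_intros)

text \<open>The support value of \<open>pr\<close> is a candidate if the mass strictly above it is
  at most 1 / \<open>epar z\<close>. The least candidate is a quantile in the sense of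
  \<open>quantile\<close>; \<open>qh\<close> is this value scaled by \<open>vden\<close>.\<close>

definition "qcand z it pr \<longleftrightarrow>
  epar z * (\<Sum>pr'\<leftarrow>prs it. if vh z pr < vh z pr' then ph z pr' else 0) \<le> pden z"

definition "qh z it = vh z (best (\<lambda>pr. - vh z pr) (filter (\<lambda>pr. qcand z it pr) (prs it)))"

lemma pint_qh [ptime_intros]: "ptime f \<Longrightarrow> ptime g \<Longrightarrow> pint (\<lambda>x. qh (f x) (g x))"
  by (rule pint_comp2) (unfold qh_def qcand_def, intro ptime_intros)

text \<open>A state \<open>Node (Atom w) (Atom b)\<close> represents the threshold \<open>w / (b * vden z)\<close>.\<close>

definition "shat z it w b = epar z * (\<Sum>pr\<leftarrow>prs it. ph z pr * max 0 (vh z pr * b - max w (qh z it * b))) +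
  pden z * max 0 (qh z it * b - w)"

text \<open>The Euler step with denominators cleared, where \<open>y\<close> pairs the instance with
  the list of kept items. With e = \<open>epar\<close>, the slope contains 1 + 2/e = (e + 2)/e,
  \<open>shat\<close> contains another factor e and \<open>pden\<close>, and the step size is 1/n;
  whence the common factor e^2 * n * \<open>pden\<close>.\<close>

definition "wstep y w b = (epar (fs y))\<^sup>2 * npar (fs y) * pden (fs y) * w +
  (epar (fs y) + 2) * (\<Sum>it\<leftarrow>to_list (sn y). shat (fs y) it w b)"

definition "bstep y b = (epar (fs y))\<^sup>2 * npar (fs y) * pden (fs y) * b"

text \<open>The list of indices below \<open>k\<close> serves as a counter for \<open>k\<close>
  steps.\<close>

definition "wst y k = fold (\<lambda>_ acc. Node (Atom (wstep y (int_of (fs acc)) (int_of (sn acc))))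
      (Atom (bstep y (int_of (sn acc))))) (filter (\<lambda>i. int_of i < int_of k) (idx (fs y))) (Node (Atom 0) (Atom 1))"

definition "wnum y k = int_of (fs (wst y k))"

definition "wden y k = int_of (sn (wst y k))"

text \<open>For a fixed instance the step is piecewise linear and homogeneous in the pair of
  numerator and denominator. \<open>?C\<close> collects the absolute values of its coefficients and
  thus bounds the growth factor of every step.\<close>

lemma ptime_wst: "ptime f \<Longrightarrow> ptime g \<Longrightarrow> ptime (\<lambda>x. wst (f x) (g x))"
proof (rule ptime_comp2[of wst])
  let ?C = "\<lambda>y. \<bar>(epar (fs y))\<^sup>2 * npar (fs y) * pden (fs y)\<bar> + \<bar>epar (fs y) + 2\<bar> * (\<Sum>it\<leftarrow>to_list (sn y).
    \<bar>epar (fs y)\<bar> * (\<Sum>pr\<leftarrow>prs it. \<bar>ph (fs y) pr\<bar> * (\<bar>vh (fs y) pr\<bar> + 1 + \<bar>qh (fs y) it\<bar>)) + \<bar>pden (fs y)\<bar> * (\<bar>qh (fs y) it\<bar> + 1))"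
  have abs_sum: "\<bar>\<Sum>x\<leftarrow>xs. f x\<bar> \<le> (\<Sum>x\<leftarrow>xs. \<bar>f x\<bar>)" for f :: "data \<Rightarrow> int" and xs
    by (induction xs) auto
  have sum_le: "\<bar>\<Sum>x\<leftarrow>xs. f x\<bar> \<le> (\<Sum>x\<leftarrow>xs. g x) * m" if "\<And>x. \<bar>f x\<bar> \<le> g x * m" for f g :: "data \<Rightarrow> int" and xs m
    using that by (induction xs) (auto simp: distrib_right intro: order_trans[OF abs_triangle_ineq] add_mono)
  have comb: "\<bar>a + b\<bar> \<le> (p * r + p' * r') * m" if "\<bar>a\<bar> \<le> p * (r * m)" "\<bar>b\<bar> \<le> p' * (r' * m)"
    for a b p r p' r' m :: int
  proof -
    have "\<bar>a + b\<bar> \<le> p * (r * m) + p' * (r' * m)"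
      by (rule order_trans[OF abs_triangle_ineq add_mono[OF that]])
    then show ?thesis by (simp add: distrib_right mult.assoc)
  qed
  have comb': "\<bar>a + b\<bar> + c \<le> (p + q * r) * m" if "\<bar>b\<bar> \<le> q * (r * m)" "\<bar>a\<bar> + c = p * m"
    for a b c p q r m :: int
  proof -
    have "\<bar>a + b\<bar> + c \<le> (\<bar>a\<bar> + c) + \<bar>b\<bar>"
      using abs_triangle_ineq[of a b] by linarith
    also have "\<dots> \<le> p * m + q * (r * m)"
      unfolding that(2) by (intro add_left_mono that)
    finally show ?thesis by (simp add: distrib_right mult.assoc)
  qed
  have pos: "max 0 (v * b - max w (q * b)) \<le> (\<bar>v\<bar> + 1 + \<bar>q\<bar>) * (\<bar>w\<bar> + \<bar>b\<bar>)"
    "max 0 (q * b - w) \<le> (\<bar>q\<bar> + 1) * (\<bar>w\<bar> + \<bar>b\<bar>)" for v b w q :: int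
  proof -
    have "\<bar>v * b\<bar> \<le> \<bar>v\<bar> * (\<bar>w\<bar> + \<bar>b\<bar>)" "\<bar>q * b\<bar> \<le> \<bar>q\<bar> * (\<bar>w\<bar> + \<bar>b\<bar>)"
      by (simp_all add: abs_mult mult_left_mono)
    then show "max 0 (v * b - max w (q * b)) \<le> (\<bar>v\<bar> + 1 + \<bar>q\<bar>) * (\<bar>w\<bar> + \<bar>b\<bar>)"
      "max 0 (q * b - w) \<le> (\<bar>q\<bar> + 1) * (\<bar>w\<bar> + \<bar>b\<bar>)"
      by (simp_all add: distrib_right) linarith+
  qed
  have growth: "\<bar>wstep y w b\<bar> + \<bar>bstep y b\<bar> \<le> \<bar>?C y\<bar> * (\<bar>w\<bar> + \<bar>b\<bar>)" for y w b
  proof -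
    let ?z = "fs y" and ?m = "\<bar>w\<bar> + \<bar>b\<bar>"
    have 1: "\<bar>shat ?z it w b\<bar> \<le> (\<bar>epar ?z\<bar> * (\<Sum>pr\<leftarrow>prs it. \<bar>ph ?z pr\<bar> * (\<bar>vh ?z pr\<bar> + 1 + \<bar>qh ?z it\<bar>)) +
        \<bar>pden ?z\<bar> * (\<bar>qh ?z it\<bar> + 1)) * ?m" for it
    proof -
      have "\<bar>\<Sum>pr\<leftarrow>prs it. ph ?z pr * max 0 (vh ?z pr * b - max w (qh ?z it * b))\<bar>
        \<le> (\<Sum>pr\<leftarrow>prs it. \<bar>ph ?z pr\<bar> * (\<bar>vh ?z pr\<bar> + 1 + \<bar>qh ?z it\<bar>)) * ?m"
        by (rule sum_le) (unfold abs_mult mult.assoc, intro mult_left_mono, use pos in auto)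
      then have "\<bar>epar ?z * (\<Sum>pr\<leftarrow>prs it. ph ?z pr * max 0 (vh ?z pr * b - max w (qh ?z it * b)))\<bar>
        \<le> \<bar>epar ?z\<bar> * ((\<Sum>pr\<leftarrow>prs it. \<bar>ph ?z pr\<bar> * (\<bar>vh ?z pr\<bar> + 1 + \<bar>qh ?z it\<bar>)) * ?m)"
        unfolding abs_mult by (intro mult_left_mono) auto
      moreover have "\<bar>pden ?z * max 0 (qh ?z it * b - w)\<bar> \<le> \<bar>pden ?z\<bar> * ((\<bar>qh ?z it\<bar> + 1) * ?m)"
        unfolding abs_mult by (intro mult_left_mono) (use pos in auto)
      ultimately show ?thesis
        unfolding shat_def by (rule comb)
    qed
    have "\<bar>(epar ?z + 2) * (\<Sum>it\<leftarrow>to_list (sn y). shat ?z it w b)\<bar> \<le> \<bar>epar ?z + 2\<bar> * ((\<Sum>it\<leftarrow>to_list (sn y).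
        \<bar>epar ?z\<bar> * (\<Sum>pr\<leftarrow>prs it. \<bar>ph ?z pr\<bar> * (\<bar>vh ?z pr\<bar> + 1 + \<bar>qh ?z it\<bar>)) + \<bar>pden ?z\<bar> * (\<bar>qh ?z it\<bar> + 1)) * ?m)"
      unfolding abs_mult by (intro mult_left_mono sum_le 1) auto
    moreover have "\<bar>(epar ?z)\<^sup>2 * npar ?z * pden ?z * w\<bar> + \<bar>bstep y b\<bar> = \<bar>(epar ?z)\<^sup>2 * npar ?z * pden ?z\<bar> * ?m"
      by (simp add: bstep_def abs_mult distrib_left)
    ultimately have "\<bar>wstep y w b\<bar> + \<bar>bstep y b\<bar> \<le> ?C y * ?m"
      unfolding wstep_def by (intro comb')
    also have "\<dots> \<le> \<bar>?C y\<bar> * ?m" by (intro mult_right_mono) auto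
    finally show ?thesis .
  qed
  show "ptime (\<lambda>z. wst (fs z) (sn z))"
    unfolding wst_def
    by (rule ptime_iter_pair[where C = "\<lambda>x. ?C (fs x)" and f = "\<lambda>x. wstep (fs x)" and g = "\<lambda>x _ b. bstep (fs x) b"])
       (use growth in \<open>auto simp: wstep_def[abs_def] bstep_def[abs_def] shat_def[abs_def] intro!: ptime_intros\<close>)
qed

lemma pint_wnum [ptime_intros]: "ptime f \<Longrightarrow> ptime g \<Longrightarrow> pint (\<lambda>x. wnum (f x) (g x))"
  unfolding wnum_def by (intro ptime_intros ptime_wst)

lemma pint_wden [ptime_intros]: "ptime f \<Longrightarrow> ptime g \<Longrightarrow> pint (\<lambda>x. wden (f x) (g x))"
  unfolding wden_def by (intro ptime_intros ptime_wst)

text \<open>\<open>nhat\<close> and \<open>rhat\<close> are \<open>top_tail\<close> and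
  \<open>top_gain\<close> at the threshold \<open>W k\<close>, scaled by \<open>epar * pden\<close>
  and by \<open>epar * pden * vden\<close>. The threshold is a fraction, so comparisons with it are
  cross-multiplied.\<close>

definition "nhat y it k = (if wnum y k < qh (fs y) it * wden y k then pden (fs y)
  else epar (fs y) * (\<Sum>pr\<leftarrow>prs it. if wnum y k < vh (fs y) pr * wden y k then ph (fs y) pr else 0))"

definition "rhat y it k = (if wnum y k < qh (fs y) it * wden y k
  then epar (fs y) * (\<Sum>pr\<leftarrow>prs it. ph (fs y) pr * max 0 (vh (fs y) pr - qh (fs y) it)) + pden (fs y) * qh (fs y) it
  else epar (fs y) * (\<Sum>pr\<leftarrow>prs it. if wnum y k < vh (fs y) pr * wden y k then ph (fs y) pr * vh (fs y) pr else 0))"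

lemma pint_nhat [ptime_intros]: "ptime f \<Longrightarrow> ptime g \<Longrightarrow> ptime h \<Longrightarrow> pint (\<lambda>x. nhat (f x) (g x) (h x))"
  by (rule pint_comp3) (unfold nhat_def, intro ptime_intros)

lemma pint_rhat [ptime_intros]: "ptime f \<Longrightarrow> ptime g \<Longrightarrow> ptime h \<Longrightarrow> pint (\<lambda>x. rhat (f x) (g x) (h x))"
  by (rule pint_comp3) (unfold rhat_def, intro ptime_intros)

text \<open>A row is \<open>Node it (Atom 0)\<close> while \<open>it\<close> is not yet scheduled, and \<open>Node it (Node k \<theta>)\<close> once it has
  slot \<open>k\<close> and threshold \<open>\<theta>\<close>.\<close>

definition "uhat y c k = (if int_of (apply_unop Is_Atom (sn c)) = 1
  then \<Sum>s\<leftarrow>filter (\<lambda>s. int_of k \<le> int_of s) (idx (fs y)). nhat y (fs c) s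
  else if int_of k \<le> int_of (fs (sn c))
    then npar (fs y) * epar (fs y) * (\<Sum>pr\<leftarrow>prs (fs c). if sc (fs y) (sn (sn c)) \<le> vh (fs y) pr then ph (fs y) pr else 0)
    else 0)"

definition "vhat y c k = (if int_of (apply_unop Is_Atom (sn c)) = 1
  then rhat y (fs c) k
  else if int_of k = int_of (fs (sn c))
    then npar (fs y) * epar (fs y) * (\<Sum>pr\<leftarrow>prs (fs c). if sc (fs y) (sn (sn c)) \<le> vh (fs y) pr then ph (fs y) pr * vh (fs y) pr else 0)
    else 0)"

lemma pint_uhat [ptime_intros]: "ptime f \<Longrightarrow> ptime g \<Longrightarrow> ptime h \<Longrightarrow> pint (\<lambda>x. uhat (f x) (g x) (h x))"
  by (rule pint_comp3) (unfold uhat_def, intro ptime_intros)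

lemma pint_vhat [ptime_intros]: "ptime f \<Longrightarrow> ptime g \<Longrightarrow> ptime h \<Longrightarrow> pint (\<lambda>x. vhat (f x) (g x) (h x))"
  by (rule pint_comp3) (unfold vhat_def, intro ptime_intros)

definition "idof c = int_of (fs (fs c))"

lemma pint_idof [ptime_intros]: "ptime f \<Longrightarrow> pint (\<lambda>x. idof (f x))"
  unfolding idof_def by (intro ptime_intros)

text \<open>\<open>reward_bound\<close> up to a positive factor: the rows are scaled by
  \<open>npar * epar * pden\<close>, which therefore takes the place of the 1 in
  \<open>1 - u j k\<close>.\<close>

definition "phihat y cs = (\<Sum>k\<leftarrow>idx (fs y). \<Sum>c\<leftarrow>cs. vhat y c k *
  (\<Prod>c'\<leftarrow>filter (\<lambda>c'. \<not> idof c' = idof c) cs. npar (fs y) * epar (fs y) * pden (fs y) - uhat y c' k))"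

lemma pint_phihat [ptime_intros]:
  assumes "ptime f" "plist l"
  shows "pint (\<lambda>x. phihat (f x) (l x))"
proof -
  have "pint (\<lambda>x. phihat (fs x) (to_list (sn x)))"
    unfolding phihat_def by (intro ptime_intros)
  from pint_comp2[of "\<lambda>a b. phihat a (to_list b)", OF this assms(1) assms(2)[unfolded plist_def]]
  show ?thesis by simp
qed

text \<open>Every slot is combined with every support value as a threshold, and with one number
  above all of them, which rejects every value.\<close>

definition "cands y it = concat (map (\<lambda>k. map (\<lambda>\<theta>. Node it (Node k \<theta>))
  (Node (Atom (1 + (\<Sum>pr\<leftarrow>prs it. vh (fs y) pr))) (Atom 1) # map (\<lambda>pr. fs pr) (prs it))) (idx (fs y)))"

text \<open>The method of conditional expectations: \<open>acc\<close> holds the rows decided so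
  far, and undecided items keep their averaged rows. Items are in decreasing order of index, so the
  undecided ones are those with a smaller index.\<close>

definition "greedy y = fold (\<lambda>it acc.
    best (\<lambda>c. phihat y (acc @ c # map (\<lambda>i. Node i (Atom 0)) (filter (\<lambda>i. int_of (fs i) < int_of (fs it)) (to_list (sn y)))))
      (cands y it) # acc) (to_list (sn y)) []"

text \<open>Bucket sort by slot, the largest slot first.\<close>

definition "outp y = concat (map (\<lambda>k. map (\<lambda>c. Node (fs (fs c)) (sn (sn c)))
  (filter (\<lambda>c. int_of (fs (sn c)) = int_of k) (greedy y))) (idx (fs y)))"

lemma plist_greedy_prog [ptime_intros]: "ptime f \<Longrightarrow> plist (\<lambda>x. greedy (f x))"
  by (rule plist_comp1) (unfold greedy_def cands_def, intro plist_greedy ptime_intros)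

lemma plist_outp [ptime_intros]: "ptime f \<Longrightarrow> plist (\<lambda>x. outp (f x))"
  by (rule plist_comp1) (unfold outp_def, intro ptime_intros)

text \<open>The number of powers of 2 up to \<open>epar z\<close>, an integer stand-in for its
  logarithm. Exponents run over the indices, which covers all relevant ones if \<open>epar z\<close>
  is at most the number of variables.\<close>

definition "lgpar z = int (length (filter (\<lambda>i. (\<Prod>j\<leftarrow>filter (\<lambda>j. int_of j < int_of i) (idx z). 2) \<le> epar z) (idx z)))"

text \<open>Items at whose quantile a cut is within the budget and leaves a dense window just
  below.\<close>

definition "goods z = filter (\<lambda>it.
    int (length (filter (\<lambda>i. qh z it < qh z i) (items z))) \<le> 3 * (epar z * lgpar z)\<^sup>2 \<and>
    epar z * lgpar z \<le> int (length (filter (\<lambda>i. qh z i \<le> qh z it \<and> (epar z - 1) * qh z it \<le> epar z * qh z i) (items z))))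
  (items z)"

definition "topit z = best (\<lambda>it. qh z it) (items z)"

definition "keep z = (if \<not> goods z = [] then filter (\<lambda>i. qh z i \<le> qh z (dhd (goods z))) (items z)
  else filter (\<lambda>i. epar z ^ 3 * qh z i \<le> qh z (topit z)) (items z))"

definition "keepd z = Node z (of_list (keep z))"

text \<open>For \<open>epar z < 4\<close> the guaranteed factor is not positive and everything is
  kept. With fewer than \<open>epar z\<close> variables the budget allows to remove them all.
  \<open>Node (Atom 0) (Atom 1)\<close> encodes the rational threshold 0, which accepts a dominating
  variable unconditionally.\<close>

definition "prog z = (if epar z < 4 then map (\<lambda>it. Node (fs it) (Node (Atom 0) (Atom 1))) (items z)
  else if npar z < epar z then []
  else if goods z = [] \<and> wnum (keepd z) (Atom (npar z)) * (epar z)\<^sup>2 < qh z (topit z) * wden (keepd z) (Atom (npar z))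
    then Node (fs (topit z)) (Node (Atom 0) (Atom 1)) # outp (keepd z)
  else outp (keepd z))"

lemma pint_lgpar [ptime_intros]: "ptime f \<Longrightarrow> pint (\<lambda>x. lgpar (f x))"
  by (rule pint_comp1) (unfold lgpar_def, intro ptime_intros)

lemma plist_goods [ptime_intros]: "ptime f \<Longrightarrow> plist (\<lambda>x. goods (f x))"
  by (rule plist_comp1) (unfold goods_def, intro ptime_intros)

lemma ptime_topit [ptime_intros]: "ptime f \<Longrightarrow> ptime (\<lambda>x. topit (f x))"
  by (rule ptime_comp) (unfold topit_def, intro ptime_intros)

lemma plist_keep [ptime_intros]: "ptime f \<Longrightarrow> plist (\<lambda>x. keep (f x))"
  by (rule plist_comp1) (unfold keep_def, intro ptime_intros)

lemma ptime_keepd [ptime_intros]: "ptime f \<Longrightarrow> ptime (\<lambda>x. keepd (f x))"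
  unfolding keepd_def by (intro ptime_intros)

lemma ptime_prog: "ptime (\<lambda>z. of_list (prog z))"
  unfolding prog_def by (intro ptime_intros)

subsection \<open>Laws with finite support\<close>

text \<open>A value may be listed several times; its probability is then the sum over its
  entries.\<close>

lemma sum_filter_fst:
  fixes f :: "'a \<Rightarrow> ennreal"
  assumes "finite S" "fst ` set xs \<subseteq> S"
  shows "(\<Sum>x\<in>S. f x * (\<Sum>z\<leftarrow>filter (\<lambda>z. fst z = x) xs. ennreal (snd z))) = (\<Sum>z\<leftarrow>xs. f (fst z) * ennreal (snd z))"
  using assms(2)
proof (induction xs)
  case (Cons z xs)
  have "(\<Sum>x\<in>S. f x * (\<Sum>z\<leftarrow>filter (\<lambda>z. fst z = x) (z # xs). ennreal (snd z))) =
      (\<Sum>x\<in>S. (if x = fst z then f x * ennreal (snd z) else 0) + f x * (\<Sum>z\<leftarrow>filter (\<lambda>z. fst z = x) xs. ennreal (snd z)))"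
    by (intro sum.cong) (auto simp: distrib_left)
  also have "\<dots> = f (fst z) * ennreal (snd z) + (\<Sum>z\<leftarrow>xs. f (fst z) * ennreal (snd z))"
    using Cons assms(1) by (simp add: sum.distrib)
  finally show ?case by simp
qed simp

lemma sum_list_ennreal:
  assumes "\<And>z. z \<in> set xs \<Longrightarrow> 0 \<le> f z"
  shows "(\<Sum>z\<leftarrow>xs. ennreal (f z)) = ennreal (\<Sum>z\<leftarrow>xs. f z)"
  using assms
proof (induction xs)
  case (Cons z xs)
  have "0 \<le> (\<Sum>z\<leftarrow>xs. f z)" by (rule sum_list_nonneg) (use Cons.prems in auto)
  then show ?case using Cons by simp
qed simp

lemma nn_integral_pmf_of_list:
  fixes f :: "'a \<Rightarrow> ennreal"
  assumes wf: "pmf_of_list_wf xs"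
  shows "(\<integral>\<^sup>+x. f x \<partial>measure_pmf (pmf_of_list xs)) = (\<Sum>z\<leftarrow>xs. f (fst z) * ennreal (snd z))"
proof -
  let ?S = "set (map fst xs)"
  have nn: "0 \<le> snd z" if "z \<in> set xs" for z using wf that by (force simp: pmf_of_list_wf_def)
  have "(\<integral>\<^sup>+x. f x \<partial>measure_pmf (pmf_of_list xs)) = (\<integral>\<^sup>+x. f x * ennreal (pmf (pmf_of_list xs) x) \<partial>count_space UNIV)"
    by (simp add: nn_integral_measure_pmf mult.commute)
  also have "\<dots> = (\<Sum>x\<in>?S. f x * ennreal (pmf (pmf_of_list xs) x))"
    using set_pmf_of_list[OF wf] by (intro nn_integral_count_space') (auto simp: set_pmf_iff)
  also have "\<dots> = (\<Sum>x\<in>?S. f x * (\<Sum>z\<leftarrow>filter (\<lambda>z. fst z = x) xs. ennreal (snd z)))"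
  proof (intro sum.cong refl arg_cong2[where f = "(*)"])
    fix x
    have "(\<Sum>z\<leftarrow>filter (\<lambda>z. fst z = x) xs. ennreal (snd z)) = ennreal (\<Sum>z\<leftarrow>filter (\<lambda>z. fst z = x) xs. snd z)"
      by (rule sum_list_ennreal) (use nn in auto)
    then show "ennreal (pmf (pmf_of_list xs) x) = (\<Sum>z\<leftarrow>filter (\<lambda>z. fst z = x) xs. ennreal (snd z))"
      by (simp add: pmf_pmf_of_list[OF wf])
  qed
  also have "\<dots> = (\<Sum>z\<leftarrow>xs. f (fst z) * ennreal (snd z))"
    by (rule sum_filter_fst) auto
  finally show ?thesis .
qed

context
  fixes vps :: fin_law
  assumes valid: "valid_fin_law vps"
begin

lemma fin_law_nonneg: "(v, p) \<in> set vps \<Longrightarrow> 0 \<le> v \<and> 0 \<le> p"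
  using valid by (force simp: valid_fin_law_def pmf_of_list_wf_def zero_le_of_rat_iff)

lemma fin_law_sum: "(\<Sum>(v, p)\<leftarrow>vps. of_rat p) = (1 :: real)"
proof -
  have "(\<Sum>x\<leftarrow>map snd (real_pairs vps). x) = 1"
    using valid by (simp add: valid_fin_law_def pmf_of_list_wf_def)
  then show ?thesis by (simp add: case_prod_unfold comp_def)
qed

lemma fin_law_nonempty: "vps \<noteq> []"
  using fin_law_sum by auto

lemma nn_integral_law_of:
  assumes "\<And>v. 0 \<le> v \<Longrightarrow> 0 \<le> f v" "f \<in> borel_measurable borel"
  shows "(\<integral>\<^sup>+v. ennreal (f v) \<partial>law_of vps) = ennreal (\<Sum>(v, p)\<leftarrow>vps. of_rat p * f (of_rat v))"
proof -
  have wf: "pmf_of_list_wf (real_pairs vps)" using valid by (simp add: valid_fin_law_def)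
  have "(\<integral>\<^sup>+v. ennreal (f v) \<partial>law_of vps) = (\<integral>\<^sup>+v. ennreal (f v) \<partial>measure_pmf (pmf_of_list (real_pairs vps)))"
    unfolding law_of_def using assms(2) by (subst nn_integral_distr) auto
  also have "\<dots> = (\<Sum>z\<leftarrow>real_pairs vps. ennreal (f (fst z)) * ennreal (snd z))"
    by (rule nn_integral_pmf_of_list[OF wf])
  also have "\<dots> = (\<Sum>z\<leftarrow>vps. ennreal (of_rat (snd z) * f (of_rat (fst z))))"
    unfolding map_map comp_def
  proof (rule arg_cong[where f = sum_list], rule map_cong[OF refl])
    fix z assume "z \<in> set vps"
    then have "0 \<le> fst z" "0 \<le> snd z" using fin_law_nonneg[of "fst z" "snd z"] by auto
    then show "ennreal (f (fst (case z of (v, p) \<Rightarrow> (real_of_rat v, of_rat p)))) * ennreal (snd (case z of (v, p) \<Rightarrow> (real_of_rat v, of_rat p))) =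
        ennreal (of_rat (snd z) * f (of_rat (fst z)))"
      using assms(1)[of "of_rat (fst z)"] by (simp add: case_prod_beta ennreal_mult mult.commute zero_le_of_rat_iff)
  qed
  also have "\<dots> = ennreal (\<Sum>z\<leftarrow>vps. of_rat (snd z) * f (of_rat (fst z)))"
  proof -
    have "0 \<le> of_rat (snd z) * f (of_rat (fst z))" if "z \<in> set vps" for z
      using fin_law_nonneg[of "fst z" "snd z"] that by (auto intro!: mult_nonneg_nonneg assms(1) simp: zero_le_of_rat_iff)
    then show ?thesis by (rule sum_list_ennreal)
  qed
  finally show ?thesis by (simp add: case_prod_unfold)
qed

lemma fin_law_sum_nonneg:
  fixes f :: "real \<Rightarrow> real"
  assumes "\<And>v. 0 \<le> v \<Longrightarrow> 0 \<le> f v"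
  shows "0 \<le> (\<Sum>(v, p)\<leftarrow>vps. of_rat p * f (of_rat v) :: real)"
proof (rule sum_list_nonneg)
  fix x assume "x \<in> set (map (\<lambda>(v, p). of_rat p * f (of_rat v)) vps)"
  then obtain v p where "(v, p) \<in> set vps" "x = of_rat p * f (of_rat v)" by auto
  moreover from this have "0 \<le> real_of_rat v" "0 \<le> real_of_rat p"
    using fin_law_nonneg[of v p] by (simp_all add: zero_le_of_rat_iff)
  ultimately show "0 \<le> x" using assms[of "of_rat v"] by simp
qed

lemma finite_mean_law_of: "finite_mean (law_of vps)"
  using nn_integral_law_of[of "\<lambda>v. v"] by (simp add: finite_mean_def)

lemma measure_law_of:
  assumes "A \<in> sets borel"
  shows "measure (law_of vps) A = (\<Sum>(v, p)\<leftarrow>vps. if of_rat v \<in> A then of_rat p else 0)"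
proof -
  interpret prob_space "law_of vps" using nonneg_lawD(1)[OF nonneg_law_law_of[OF valid]] .
  have "ennreal (measure (law_of vps) A) = (\<integral>\<^sup>+v. indicator A v \<partial>law_of vps)"
    using assms nonneg_lawD(2)[OF nonneg_law_law_of[OF valid]] by (simp add: emeasure_eq_measure)
  also have "\<dots> = (\<integral>\<^sup>+v. ennreal (indicator A v) \<partial>law_of vps)"
    by (intro nn_integral_cong) (simp add: indicator_def)
  also have "\<dots> = ennreal (\<Sum>(v, p)\<leftarrow>vps. of_rat p * indicator A (of_rat v))"
    using assms by (intro nn_integral_law_of) auto
  finally have "measure (law_of vps) A = (\<Sum>(v, p)\<leftarrow>vps. of_rat p * indicator A (of_rat v))"
    using fin_law_sum_nonneg[of "indicator A"] by simp
  also have "\<dots> = (\<Sum>(v, p)\<leftarrow>vps. if of_rat v \<in> A then of_rat p else 0)"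
    by (intro arg_cong[where f = sum_list] map_cong) auto
  finally show ?thesis .
qed

lemma excess_law_of: "excess (law_of vps) a = (\<Sum>(v, p)\<leftarrow>vps. of_rat p * max 0 (of_rat v - a))"
proof -
  have "(\<integral>\<^sup>+v. ennreal (v - a) \<partial>law_of vps) = (\<integral>\<^sup>+v. ennreal (max 0 (v - a)) \<partial>law_of vps)"
    by (intro nn_integral_cong) (simp add: max_def ennreal_neg)
  also have "\<dots> = ennreal (\<Sum>(v, p)\<leftarrow>vps. of_rat p * max 0 (of_rat v - a))"
    by (intro nn_integral_law_of) auto
  finally show ?thesis
    using fin_law_sum_nonneg[of "\<lambda>v. max 0 (v - a)"] by (simp add: excess_def)
qed

lemma gain_on_law_of:
  assumes "A \<in> sets borel"
  shows "gain_on (law_of vps) A = (\<Sum>(v, p)\<leftarrow>vps. if of_rat v \<in> A then of_rat p * of_rat v else 0)"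
proof -
  have "(\<integral>\<^sup>+v. ennreal v * indicator A v \<partial>law_of vps) = (\<integral>\<^sup>+v. ennreal (v * indicator A v) \<partial>law_of vps)"
    by (intro nn_integral_cong) (simp add: indicator_def)
  also have "\<dots> = ennreal (\<Sum>(v, p)\<leftarrow>vps. of_rat p * (of_rat v * indicator A (of_rat v)))"
    using assms by (intro nn_integral_law_of) auto
  finally have "gain_on (law_of vps) A = (\<Sum>(v, p)\<leftarrow>vps. of_rat p * (of_rat v * indicator A (of_rat v)))"
    using fin_law_sum_nonneg[of "\<lambda>v. v * indicator A v"] by (simp add: gain_on_def)
  also have "\<dots> = (\<Sum>(v, p)\<leftarrow>vps. if of_rat v \<in> A then of_rat p * of_rat v else 0)"
    by (intro arg_cong[where f = sum_list] map_cong) auto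
  finally show ?thesis .
qed

text \<open>Allows an arbitrary acceptance set to be replaced by a ray that starts at a rational
  threshold.\<close>

lemma rows_law_of_cong:
  assumes "A \<in> sets borel" "B \<in> sets borel" "\<And>v p. (v, p) \<in> set vps \<Longrightarrow> of_rat v \<in> A \<longleftrightarrow> of_rat v \<in> B"
  shows "measure (law_of vps) A = measure (law_of vps) B" "gain_on (law_of vps) A = gain_on (law_of vps) B"
  unfolding measure_law_of[OF assms(1)] measure_law_of[OF assms(2)] gain_on_law_of[OF assms(1)] gain_on_law_of[OF assms(2)]
  using assms(3) by (auto intro!: arg_cong[where f = sum_list])

end

subsection \<open>Correctness of the program\<close>

lemma dvd_prod_list: "x \<in> set xs \<Longrightarrow> f x dvd (\<Prod>x\<leftarrow>xs. f x :: int)"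
  by (induction xs) auto

lemma prod_list_pos: "(\<And>x. x \<in> set xs \<Longrightarrow> 0 < f x) \<Longrightarrow> 0 < (\<Prod>x\<leftarrow>xs. f x :: int)"
  by (induction xs) auto

lemma of_int_sum_list: "of_int (\<Sum>x\<leftarrow>xs. f x) = (\<Sum>x\<leftarrow>xs. of_int (f x) :: real)"
  by (induction xs) simp_all

lemma to_list_enc_list [simp]: "to_list (enc_list f xs) = map f xs"
  by (subst enc_list_eq) (rule to_list_of_list)

abbreviation num :: "rat \<Rightarrow> int" where "num r \<equiv> fst (quotient_of r)"

abbreviation den :: "rat \<Rightarrow> int" where "den r \<equiv> snd (quotient_of r)"

abbreviation enc_pair :: "rat \<times> rat \<Rightarrow> data" where
  "enc_pair \<equiv> enc_prod enc_rat enc_rat"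

lemma den_pos: "0 < den r"
  by (rule quotient_of_denom_pos')

lemma of_rat_num_den: "(of_rat r :: real) = of_int (num r) / of_int (den r)"
proof -
  have "r = of_int (num r) / of_int (den r)" by (rule quotient_of_div) simp
  from arg_cong[OF this, of real_of_rat] show ?thesis by (simp add: of_rat_divide)
qed

lemma of_rat_scaled:
  assumes "den r dvd d"
  shows "of_int (num r * d div den r) = (of_rat r * of_int d :: real)"
proof -
  obtain k where "d = den r * k" using assms by (elim dvdE)
  then show ?thesis using den_pos[of r] by (simp add: of_rat_num_den)
qed

lemma enc_rat_of_int: "enc_rat (of_int m) = Node (Atom m) (Atom 1)"
  by (simp add: enc_rat_def)

locale program_instance =
  fixes laws :: "fin_law list" and \<epsilon> :: rat
  assumes valid: "\<And>vps. vps \<in> set laws \<Longrightarrow> valid_fin_law vps" and \<epsilon>_pos: "0 < \<epsilon>"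
begin

definition z :: data where
  "z = enc_instance (laws, \<epsilon>)"

definition n :: nat where
  "n = length laws"

definition D :: "nat \<Rightarrow> real measure" where
  "D i = law_of (laws ! i)"

definition it :: "nat \<Rightarrow> data" where
  "it i = Node (Atom (int i)) (enc_list enc_pair (laws ! i))"

definition V :: real where
  "V = of_int (vden z)"

definition P :: real where
  "P = of_int (pden z)"

definition E :: real where
  "E = of_int (epar z)"

definition q :: "nat \<Rightarrow> real" where
  "q i = of_int (qh z (it i)) / V"

lemma z_eq: "z = Node (enc_list (enc_list enc_pair) laws) (enc_rat \<epsilon>)"
  by (simp add: z_def enc_instance_def enc_prod_def)

lemma lawsd_z: "lawsd z = map (enc_list enc_pair) laws"
  by (simp add: lawsd_def z_eq)

lemma npar_z: "npar z = int n"
  by (simp add: npar_def lawsd_z n_def)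

lemma items_z: "items z = map it (rev [0..<n])"
proof -
  have "map (\<lambda>(i, h). Node (Atom (int i)) h) (List.enumerate 0 (map (enc_list enc_pair) laws)) = map it [0..<n]"
    by (rule nth_equalityI) (simp_all add: n_def nth_enumerate_eq it_def)
  then show ?thesis by (simp add: items_def lawsd_z rev_map)
qed

lemma idx_z: "idx z = map (\<lambda>i. Atom (int i)) (rev [0..<n])"
  by (simp add: idx_def items_z it_def)

lemma prs_it: "prs (it i) = map enc_pair (laws ! i)"
  by (simp add: prs_def it_def)

lemma enc_pair_simps [simp]: "fs (enc_pair (v, p)) = enc_rat v" "sn (enc_pair (v, p)) = enc_rat p"
  by (simp_all add: enc_prod_def)

lemma enc_rat_simps [simp]: "fs (enc_rat v) = Atom (num v)" "sn (enc_rat v) = Atom (den v)"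
  by (simp_all add: enc_rat_def)

lemma enc_pair_eq: "enc_pair = (\<lambda>x. Node (enc_rat (fst x)) (enc_rat (snd x)))"
  by (auto simp: enc_prod_def)

lemma vden_z: "vden z = (\<Prod>l\<leftarrow>laws. \<Prod>x\<leftarrow>l. den (fst x))"
  by (simp add: vden_def lawsd_z comp_def enc_pair_eq)

lemma pden_z: "pden z = (\<Prod>l\<leftarrow>laws. \<Prod>x\<leftarrow>l. den (snd x))"
  by (simp add: pden_def lawsd_z comp_def enc_pair_eq)

lemma V_pos: "0 < V"
  unfolding V_def vden_z by (simp add: prod_list_pos den_pos)

lemma P_pos: "0 < P"
  unfolding P_def pden_z by (simp add: prod_list_pos den_pos)

lemma pden_pos: "0 < pden z"
  using P_pos by (simp add: P_def)

lemma law_in: "i < n \<Longrightarrow> laws ! i \<in> set laws"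
  by (simp add: n_def)

lemma den_dvd:
  assumes "i < n" "(v, p) \<in> set (laws ! i)"
  shows "den v dvd vden z" "den p dvd pden z"
proof -
  have "den v dvd (\<Prod>x\<leftarrow>laws ! i. den (fst x))" "den p dvd (\<Prod>x\<leftarrow>laws ! i. den (snd x))"
    using dvd_prod_list[OF assms(2), of "\<lambda>x. den (fst x)"] dvd_prod_list[OF assms(2), of "\<lambda>x. den (snd x)"] by simp_all
  then show "den v dvd vden z" "den p dvd pden z"
    using dvd_prod_list[OF law_in[OF assms(1)], of "\<lambda>l. \<Prod>x\<leftarrow>l. den (fst x)"]
      dvd_prod_list[OF law_in[OF assms(1)], of "\<lambda>l. \<Prod>x\<leftarrow>l. den (snd x)"]
    unfolding vden_z pden_z by (blast intro: dvd_trans)+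
qed

lemma sc_eq: "den r dvd vden z \<Longrightarrow> of_int (sc z (enc_rat r)) = of_rat r * V"
  by (simp add: sc_def of_rat_scaled V_def)

lemma vh_eq: "i < n \<Longrightarrow> (v, p) \<in> set (laws ! i) \<Longrightarrow> of_int (vh z (enc_pair (v, p))) = of_rat v * V"
  by (simp add: vh_def sc_eq den_dvd)

lemma ph_eq: "i < n \<Longrightarrow> (v, p) \<in> set (laws ! i) \<Longrightarrow> of_int (ph z (enc_pair (v, p))) = of_rat p * P"
  by (simp add: ph_def of_rat_scaled P_def den_dvd)

text \<open>Transfers integer sums over encoded pairs to sums over the law, with the scaling factor
  \<open>c\<close> pulled out.\<close>

lemma sum_prs:
  fixes c :: real
  assumes i: "i < n" and F: "\<And>v p. (v, p) \<in> set (laws ! i) \<Longrightarrow>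
    of_int (F (enc_pair (v, p))) = c * G v p"
  shows "of_int (\<Sum>pr\<leftarrow>prs (it i). F pr) = c * (\<Sum>(v, p)\<leftarrow>laws ! i. G v p)"
proof -
  have "of_int (\<Sum>pr\<leftarrow>prs (it i). F pr) = (\<Sum>x\<leftarrow>laws ! i. real_of_int (F (enc_pair x)))"
    by (simp add: prs_it of_int_sum_list comp_def)
  also have "\<dots> = (\<Sum>x\<leftarrow>laws ! i. c * (case x of (v, p) \<Rightarrow> G v p))"
    by (intro arg_cong[where f = sum_list] map_cong refl) (use F in auto)
  finally show ?thesis by (simp add: sum_list_const_mult)
qed

lemma law_D: "i < n \<Longrightarrow> nonneg_law (D i)"
  unfolding D_def by (rule nonneg_law_law_of[OF valid[OF law_in]])

lemma mean_D: "i < n \<Longrightarrow> finite_mean (D i)"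
  unfolding D_def by (rule finite_mean_law_of[OF valid[OF law_in]])

lemma vh_less_iff:
  assumes "i < n" "(v, p) \<in> set (laws ! i)" "0 < b" and w: "of_int w = \<omega> * (of_int b * V)"
  shows "w < vh z (enc_pair (v, p)) * b \<longleftrightarrow> \<omega> < of_rat v"
proof -
  have "w < vh z (enc_pair (v, p)) * b \<longleftrightarrow> of_int w < (of_int (vh z (enc_pair (v, p))) * of_int b :: real)"
    by (simp flip: of_int_mult)
  also have "\<dots> \<longleftrightarrow> \<omega> * (of_int b * V) < of_rat v * (of_int b * V)"
    unfolding w vh_eq[OF assms(1,2)] by (simp add: mult_ac)
  also have "\<dots> \<longleftrightarrow> \<omega> < of_rat v"
    using assms(3) V_pos by (intro mult_less_cancel_right_pos) simp
  finally show ?thesis .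
qed

lemma qh_less_iff:
  assumes "0 < b" and w: "of_int w = \<omega> * (of_int b * V)"
  shows "w < qh z (it i) * b \<longleftrightarrow> \<omega> < q i"
proof -
  have "w < qh z (it i) * b \<longleftrightarrow> of_int w < (of_int (qh z (it i)) * of_int b :: real)"
    by (simp flip: of_int_mult)
  also have "\<dots> \<longleftrightarrow> \<omega> * (of_int b * V) < q i * (of_int b * V)"
    unfolding w using V_pos by (simp add: q_def mult_ac)
  also have "\<dots> \<longleftrightarrow> \<omega> < q i"
    using assms(1) V_pos by (intro mult_less_cancel_right_pos) simp
  finally show ?thesis .
qed

lemma sum_ph_greater:
  assumes "i < n" "0 < b" "of_int w = \<omega> * (of_int b * V)"
  shows "of_int (\<Sum>pr\<leftarrow>prs (it i). if w < vh z pr * b then ph z pr else 0) = P * measure (D i) {\<omega><..}"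
  unfolding D_def measure_law_of[OF valid[OF law_in[OF assms(1)]], of "{\<omega><..}", simplified]
  by (rule sum_prs[OF assms(1)]) (simp add: vh_less_iff[OF assms(1) _ assms(2,3)] ph_eq[OF assms(1)])

lemma qcand_iff:
  assumes "i < n" "(v, p) \<in> set (laws ! i)" "0 < E"
  shows "qcand z (it i) (enc_pair (v, p)) \<longleftrightarrow> measure (D i) {of_rat v<..} \<le> 1 / E"
proof -
  have "of_int (\<Sum>pr\<leftarrow>prs (it i). if vh z (enc_pair (v, p)) < vh z pr * 1 then ph z pr else 0) = P * measure (D i) {of_rat v<..}"
    by (rule sum_ph_greater) (use assms vh_eq in auto)
  moreover have "qcand z (it i) (enc_pair (v, p)) \<longleftrightarrow>
      real_of_int (epar z * (\<Sum>pr'\<leftarrow>prs (it i). if vh z (enc_pair (v, p)) < vh z pr' then ph z pr' else 0)) \<le> real_of_int (pden z)"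
    unfolding qcand_def of_int_le_iff ..
  ultimately have "qcand z (it i) (enc_pair (v, p)) \<longleftrightarrow> E * (P * measure (D i) {of_rat v<..}) \<le> P"
    by (simp add: E_def P_def)
  then show ?thesis using P_pos assms(3) by (simp add: field_simps)
qed

text \<open>\<open>q i\<close> is the least support value with at most mass 1/E strictly above it.
  The largest support value always qualifies. The next smaller support value does not, and the mass
  strictly above that one is the mass of \<open>{q i..}\<close>; if there is no smaller one, this
  mass is 1.\<close>

lemma quantile_q:
  assumes i: "i < n" and E: "1 \<le> E"
  shows "quantile (1 / E) (D i) (q i)"
proof -
  let ?xs = "filter (\<lambda>pr. qcand z (it i) pr) (prs (it i))"
  note valid_i = valid[OF law_in[OF i]]
  have ne: "laws ! i \<noteq> []" by (rule fin_law_nonempty[OF valid_i])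
  have "?xs \<noteq> []"
  proof -
    define v where "v = Max (fst ` set (laws ! i))"
    have "v \<in> fst ` set (laws ! i)" unfolding v_def using ne by (intro Max_in) auto
    then obtain p where vp: "(v, p) \<in> set (laws ! i)" by force
    have "v' \<le> v" if "(v', p') \<in> set (laws ! i)" for v' p'
      unfolding v_def using that by (intro Max_ge) force+
    then have "measure (D i) {of_rat v<..} = measure (D i) {}"
      unfolding D_def by (intro rows_law_of_cong[OF valid_i]) (auto simp: not_less of_rat_less_eq)
    then have "qcand z (it i) (enc_pair (v, p))" using E by (simp add: qcand_iff[OF i vp])
    then show ?thesis using vp by (force simp: prs_it filter_empty_conv)
  qed
  from best_in[OF this, of "\<lambda>pr. - vh z pr"] obtain v p where vp: "(v, p) \<in> set (laws ! i)"
    and cand: "qcand z (it i) (enc_pair (v, p))" and best: "best (\<lambda>pr. - vh z pr) ?xs = enc_pair (v, p)"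
    by (auto simp: prs_it)
  have qv: "q i = of_rat v"
    using vh_eq[OF i vp] V_pos by (simp add: q_def qh_def best)
  have le: "v \<le> v'" if "(v', p') \<in> set (laws ! i)" "qcand z (it i) (enc_pair (v', p'))" for v' p'
  proof -
    have "- vh z (enc_pair (v', p')) \<le> - vh z (best (\<lambda>pr. - vh z pr) ?xs)"
      by (rule best_max) (use that in \<open>auto simp: prs_it\<close>)
    then have "vh z (enc_pair (v, p)) \<le> vh z (enc_pair (v', p'))"
      unfolding best by simp
    then have "of_int (vh z (enc_pair (v, p))) \<le> (of_int (vh z (enc_pair (v', p'))) :: real)" by simp
    then show ?thesis using V_pos by (simp add: vh_eq[OF i vp] vh_eq[OF i that(1)] of_rat_less_eq)
  qed
  have "0 \<le> q i" using fin_law_nonneg[OF valid_i vp] by (simp add: qv zero_le_of_rat_iff)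
  moreover have "measure (D i) {q i<..} \<le> 1 / E" using cand E by (simp add: qv qcand_iff[OF i vp])
  moreover have "1 / E \<le> measure (D i) {q i..}"
  proof (cases "\<exists>v'\<in>fst ` set (laws ! i). v' < v")
    case False
    then have "measure (D i) {q i..} = measure (D i) UNIV"
      unfolding D_def by (intro rows_law_of_cong[OF valid_i]) (force simp: qv of_rat_less_eq not_less)+
    also have "\<dots> = 1"
      using prob_space.prob_space[OF nonneg_lawD(1)[OF law_D[OF i]]] nonneg_lawD(3)[OF law_D[OF i]] by simp
    finally show ?thesis using E by simp
  next
    case True
    define v' where "v' = Max {x \<in> fst ` set (laws ! i). x < v}"
    have "v' \<in> {x \<in> fst ` set (laws ! i). x < v}" unfolding v'_def using True by (intro Max_in) auto
    then obtain p' where v': "(v', p') \<in> set (laws ! i)" "v' < v" by force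
    have gap: "x \<le> v'" if "(x, y) \<in> set (laws ! i)" "x < v" for x y
      unfolding v'_def using that by (intro Max_ge) force+
    have "1 / E < measure (D i) {of_rat v'<..}"
      using le[OF v'(1)] v'(2) E by (auto simp: qcand_iff[OF i v'(1)] not_le[symmetric])
    also have "measure (D i) {of_rat v'<..} = measure (D i) {q i..}"
      unfolding D_def
      by (intro rows_law_of_cong[OF valid_i]) (use gap v'(2) in \<open>force simp: qv of_rat_less of_rat_less_eq not_less not_le\<close>)+
    finally show ?thesis by simp
  qed
  ultimately show ?thesis by (simp add: quantile_def)
qed

lemma q_nonneg: "i < n \<Longrightarrow> 1 \<le> E \<Longrightarrow> 0 \<le> q i"
  using quantile_q by (auto simp: quantile_def)

end

section \<open>Exactness of the computed thresholds, probabilities and rewards\<close>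

lemma fold_const: "fold (\<lambda>_. g) xs = g ^^ length xs"
  by (induction xs) (auto simp: funpow_swap1 fun_eq_iff)

lemma filter_upt_less: "k \<le> n \<Longrightarrow> filter (\<lambda>i. i < k) [0..<n] = [0..<k]"
proof (induction n)
  case (Suc n)
  then show ?case by (cases "k = Suc n") (auto simp: filter_id_conv)
qed simp

lemma pos_part_scale:
  assumes "0 \<le> (c :: real)"
  shows "max 0 (a * c - b * c) = max 0 (a - b) * c" "max (a * c) (b * c) = max a b * c"
  using assms by (simp_all add: max_mult_distrib_right left_diff_distrib)

locale program_selection = program_instance +
  fixes js :: "nat list"
  assumes n_pos: "0 < n" and E4: "4 \<le> E"
    and js_sorted: "sorted_wrt (>) js" and js_set: "set js \<subseteq> {..<n}"
begin

lemma js_distinct: "distinct js"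
  using js_sorted by (induction js) auto

lemma js_less: "j \<in> set js \<Longrightarrow> j < n"
  using js_set by auto

sublocale small_laws D "set js" q "1 / E" n
proof
  show "card (set js) \<le> n" using card_mono[OF _ js_set] by simp
qed (use E4 n_pos js_less law_D mean_D quantile_q in auto)

definition y :: data where
  "y = Node z (of_list (map it js))"

lemma y_simps: "fs y = z" "to_list (sn y) = map it js"
  by (simp_all add: y_def)

lemma sum_js: "(\<Sum>x\<leftarrow>map it js. f x) = (\<Sum>j\<in>set js. f (it j))"
  by (simp add: comp_def sum_list_distinct_conv_sum_set[OF js_distinct])

lemma shat_eq:
  assumes i: "i < n" and b: "0 < b" and w: "of_int w = \<omega> * (of_int b * V)"
  shows "of_int (shat z (it i) w b) = E * P * V * of_int b * top_excess (1 / E) (q i) (D i) \<omega>"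
proof -
  have bV: "0 < of_int b * V" using b V_pos by simp
  have qb: "of_int (qh z (it i) * b) = q i * (of_int b * V)" using V_pos by (simp add: q_def)
  have "of_int (\<Sum>pr\<leftarrow>prs (it i). ph z pr * max 0 (vh z pr * b - max w (qh z (it i) * b)))
      = P * (of_int b * V) * (\<Sum>(v, p)\<leftarrow>laws ! i. of_rat p * max 0 (of_rat v - max \<omega> (q i)))"
  proof (rule sum_prs[OF i])
    fix v p assume vp: "(v, p) \<in> set (laws ! i)"
    have vb: "of_int (vh z (enc_pair (v, p)) * b) = of_rat v * (of_int b * V)"
      by (simp add: vh_eq[OF i vp])
    have "of_int (max 0 (vh z (enc_pair (v, p)) * b - max w (qh z (it i) * b))) =
        max 0 (of_rat v * (of_int b * V) - max (\<omega> * (of_int b * V)) (q i * (of_int b * V)))"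
      by (simp only: of_int_max of_int_diff of_int_0 w qb vb)
    also have "\<dots> = max 0 (of_rat v - max \<omega> (q i)) * (of_int b * V)"
      using bV by (simp only: pos_part_scale less_imp_le)
    finally show "of_int (ph z (enc_pair (v, p)) * max 0 (vh z (enc_pair (v, p)) * b - max w (qh z (it i) * b))) =
        P * (of_int b * V) * (of_rat p * max 0 (of_rat v - max \<omega> (q i)))"
      by (simp add: ph_eq[OF i vp] del: of_int_max)
  qed
  also have "\<dots> = P * (of_int b * V) * excess (D i) (max \<omega> (q i))"
    unfolding D_def excess_law_of[OF valid[OF law_in[OF i]]] ..
  finally have 1: "of_int (\<Sum>pr\<leftarrow>prs (it i). ph z pr * max 0 (vh z pr * b - max w (qh z (it i) * b))) = P * (of_int b * V) * excess (D i) (max \<omega> (q i))" .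
  have 2: "of_int (max 0 (qh z (it i) * b - w)) = max 0 (q i - \<omega>) * (of_int b * V)"
    unfolding of_int_max of_int_diff of_int_0 w qb
    using bV by (simp only: pos_part_scale less_imp_le)
  show ?thesis
    unfolding shat_def of_int_add of_int_mult 1 2 top_excess_def
    using E4 by (simp add: E_def[symmetric] P_def[symmetric] field_simps)
qed

text \<open>There is no rounding: the state is an unreduced fraction with positive denominator that
  equals the Euler iterate.\<close>

lemma wst_aux:
  assumes "k \<le> n"
  shows "\<exists>w b. wst y (Atom (int k)) = Node (Atom w) (Atom b) \<and> 0 < b \<and> of_int w = W k * (of_int b * V)"
proof -
  define g where "g acc = Node (Atom (wstep y (int_of (fs acc)) (int_of (sn acc)))) (Atom (bstep y (int_of (sn acc))))" for acc
  have len: "length (filter (\<lambda>i. int_of i < int_of (Atom (int k))) (idx (fs y))) = k" if "k \<le> n" for k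
  proof -
    have "filter (\<lambda>i. i < k) (rev [0..<n]) = rev [0..<k]"
      using that by (simp add: rev_filter[symmetric] filter_upt_less)
    then show ?thesis by (simp add: y_simps idx_z filter_map comp_def)
  qed
  have wst: "wst y (Atom (int k)) = (g ^^ k) (Node (Atom 0) (Atom 1))" if "k \<le> n" for k
    unfolding wst_def g_def[symmetric] fold_const len[OF that] ..
  have "\<exists>w b. (g ^^ k) (Node (Atom 0) (Atom 1)) = Node (Atom w) (Atom b) \<and> 0 < b \<and> of_int w = W k * (of_int b * V)"
  proof (induction k)
    case 0
    show ?case by (simp add: W_simps)
  next
    case (Suc k)
    then obtain w b where wb: "(g ^^ k) (Node (Atom 0) (Atom 1)) = Node (Atom w) (Atom b)" "0 < b"
      "of_int w = W k * (of_int b * V)" by blast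
    let ?w = "wstep y w b" and ?b = "bstep y b"
    have "0 < epar z" using E4 by (simp add: E_def)
    then have b: "0 < ?b"
      using wb(2) n_pos pden_pos by (simp add: bstep_def y_simps npar_z)
    have bE: "of_int ?b = E\<^sup>2 * n * P * of_int b"
      by (simp add: bstep_def y_simps npar_z E_def P_def)
    have "?w = (epar z)\<^sup>2 * int n * pden z * w + (epar z + 2) * (\<Sum>j\<in>set js. shat z (it j) w b)"
      by (simp only: wstep_def y_simps npar_z sum_js)
    then have "of_int ?w = E\<^sup>2 * n * P * of_int w + (E + 2) * (\<Sum>j\<in>set js. of_int (shat z (it j) w b))"
      by (simp add: E_def P_def)
    also have "(\<Sum>j\<in>set js. of_int (shat z (it j) w b)) = (\<Sum>j\<in>set js. E * P * V * of_int b * top_excess (1 / E) (q j) (D j) (W k))"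
      by (intro sum.cong refl shat_eq[OF _ wb(2,3)] js_less)
    also have "E\<^sup>2 * n * P * of_int w + (E + 2) * \<dots> = W (Suc k) * (of_int ?b * V)"
      unfolding bE wb(3) W_simps slope_def sum_distrib_left[symmetric]
      using E4 n_pos by (simp add: field_simps power2_eq_square)
    finally have "of_int ?w = W (Suc k) * (of_int ?b * V)" .
    moreover have "g (Node (Atom w) (Atom b)) = Node (Atom ?w) (Atom ?b)" by (simp add: g_def)
    then have "(g ^^ Suc k) (Node (Atom 0) (Atom 1)) = Node (Atom ?w) (Atom ?b)"
      by (simp only: funpow.simps comp_apply wb(1))
    ultimately show ?case using b by blast
  qed
  then show ?thesis using wst[OF assms] by simp
qed

lemma wden_pos: "k \<le> n \<Longrightarrow> 0 < wden y (Atom (int k))"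
  and wnum_eq: "k \<le> n \<Longrightarrow> of_int (wnum y (Atom (int k))) = W k * (of_int (wden y (Atom (int k))) * V)"
  using wst_aux[of k] by (auto simp: wden_def wnum_def)

lemma nhat_eq:
  assumes i: "i < n" and k: "k \<le> n"
  shows "of_int (nhat y (it i) (Atom (int k))) = E * P * top_tail (1 / E) (q i) (D i) (W k)"
proof -
  let ?w = "wnum y (Atom (int k))" and ?b = "wden y (Atom (int k))"
  note wb = wden_pos[OF k] wnum_eq[OF k]
  show ?thesis
    unfolding nhat_def y_simps qh_less_iff[OF wb] top_tail_def
    using E4 sum_ph_greater[OF i wb] by (simp add: E_def P_def)
qed

lemma rhat_eq:
  assumes i: "i < n" and k: "k \<le> n"
  shows "of_int (rhat y (it i) (Atom (int k))) = E * P * V * top_gain (1 / E) (q i) (D i) (W k)"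
proof -
  let ?w = "wnum y (Atom (int k))" and ?b = "wden y (Atom (int k))"
  note wb = wden_pos[OF k] wnum_eq[OF k]
  note valid_i = valid[OF law_in[OF i]]
  show ?thesis
  proof (cases "W k < q i")
    case True
    have 2: "of_int (qh z (it i)) = q i * V" using V_pos by (simp add: q_def)
    have "of_int (\<Sum>pr\<leftarrow>prs (it i). ph z pr * max 0 (vh z pr - qh z (it i))) =
        P * V * (\<Sum>(v, p)\<leftarrow>laws ! i. of_rat p * max 0 (of_rat v - q i))"
    proof (rule sum_prs[OF i])
      fix v p assume vp: "(v, p) \<in> set (laws ! i)"
      have "of_int (max 0 (vh z (enc_pair (v, p)) - qh z (it i))) = max 0 (of_rat v * V - q i * V)"
        by (simp only: of_int_max of_int_diff of_int_0 vh_eq[OF i vp] 2)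
      also have "\<dots> = max 0 (of_rat v - q i) * V"
        using V_pos by (simp only: pos_part_scale less_imp_le)
      finally show "of_int (ph z (enc_pair (v, p)) * max 0 (vh z (enc_pair (v, p)) - qh z (it i))) =
          P * V * (of_rat p * max 0 (of_rat v - q i))"
        by (simp add: ph_eq[OF i vp] del: of_int_max)
    qed
    also have "\<dots> = P * V * excess (D i) (q i)"
      unfolding D_def excess_law_of[OF valid_i] ..
    finally have 1: "of_int (\<Sum>pr\<leftarrow>prs (it i). ph z pr * max 0 (vh z pr - qh z (it i))) = P * V * excess (D i) (q i)" .
    have "rhat y (it i) (Atom (int k)) = epar z * (\<Sum>pr\<leftarrow>prs (it i). ph z pr * max 0 (vh z pr - qh z (it i))) + pden z * qh z (it i)"
      using True by (simp add: rhat_def y_simps qh_less_iff[OF wb])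
    then have "of_int (rhat y (it i) (Atom (int k))) = E * (P * V * excess (D i) (q i)) + P * (q i * V)"
      unfolding E_def P_def by (simp only: of_int_add of_int_mult 1[unfolded P_def] 2)
    then show ?thesis
      using True E4 by (simp add: top_gain_def top_excess_def top_tail_def max_def field_simps)
  next
    case False
    have "of_int (\<Sum>pr\<leftarrow>prs (it i). if ?w < vh z pr * ?b then ph z pr * vh z pr else 0) =
        P * V * (\<Sum>(v, p)\<leftarrow>laws ! i. if of_rat v \<in> {W k<..} then of_rat p * of_rat v else 0)"
      by (rule sum_prs[OF i]) (simp add: vh_less_iff[OF i _ wb] ph_eq[OF i] vh_eq[OF i])
    also have "\<dots> = P * V * gain_on (D i) {W k<..}"
      unfolding D_def gain_on_law_of[OF valid_i, of "{W k<..}", simplified] by simp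
    also have "gain_on (D i) {W k<..} = top_gain (1 / E) (q i) (D i) (W k)"
      using False gain_on_greater[OF law_D[OF i] mean_D[OF i] W_nonneg]
      by (simp add: top_gain_def top_excess_def top_tail_def max_def)
    finally have 1: "of_int (\<Sum>pr\<leftarrow>prs (it i). if ?w < vh z pr * ?b then ph z pr * vh z pr else 0) =
        P * V * top_gain (1 / E) (q i) (D i) (W k)" .
    have "rhat y (it i) (Atom (int k)) = epar z * (\<Sum>pr\<leftarrow>prs (it i). if ?w < vh z pr * ?b then ph z pr * vh z pr else 0)"
      using False unfolding rhat_def y_simps qh_less_iff[OF wb] by simp
    then show ?thesis by (simp only: of_int_mult 1 E_def[symmetric] mult.assoc)
  qed
qed

definition X :: real where
  "X = n * E * P"

lemma X_pos: "0 < X"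
  using n_pos E4 P_pos by (simp add: X_def)

text \<open>\<open>is_row c j u r\<close>: the data \<open>c\<close> represents the acceptance probabilities \<open>u\<close> and the rewards \<open>r\<close>
  of variable \<open>j\<close>, up to the common factors \<open>X\<close> and \<open>X * V\<close>.\<close>

definition is_row :: "data \<Rightarrow> nat \<Rightarrow> (nat \<Rightarrow> real) \<Rightarrow> (nat \<Rightarrow> real) \<Rightarrow> bool" where
  "is_row c j u r \<longleftrightarrow> idof c = int j \<and> (\<forall>k<n. of_int (uhat y c (Atom (int k))) = X * u k \<and>
     of_int (vhat y c (Atom (int k))) = X * V * r k)"

lemma idof_it: "idof (Node (it j) t) = int j"
  by (simp add: idof_def it_def)

lemma is_row_prior:
  assumes j: "j < n"
  shows "is_row (Node (it j) (Atom 0)) j (u\<^sub>0 j) (r\<^sub>0 j)"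
  unfolding is_row_def
proof (intro conjI allI impI idof_it)
  fix k assume k: "k < n"
  have "uhat y (Node (it j) (Atom 0)) (Atom (int k)) = (\<Sum>s\<leftarrow>filter (\<lambda>s. k \<le> s) (rev [0..<n]). nhat y (it j) (Atom (int s)))"
    by (simp add: uhat_def y_simps idx_z filter_map comp_def)
  also have "\<dots> = (\<Sum>s\<in>{k..<n}. nhat y (it j) (Atom (int s)))"
    by (subst sum_list_distinct_conv_sum_set) (auto intro!: sum.cong)
  finally have "of_int (uhat y (Node (it j) (Atom 0)) (Atom (int k))) = (\<Sum>s\<in>{k..<n}. E * P * top_tail (1 / E) (q j) (D j) (W s))"
    by (simp add: nhat_eq[OF j])
  then show "of_int (uhat y (Node (it j) (Atom 0)) (Atom (int k))) = X * u\<^sub>0 j k"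
    using n_pos by (simp add: u\<^sub>0_def X_def sum_distrib_left[symmetric])
  show "of_int (vhat y (Node (it j) (Atom 0)) (Atom (int k))) = X * V * r\<^sub>0 j k"
    using n_pos k by (simp add: vhat_def r\<^sub>0_def X_def rhat_eq[OF j])
qed

lemma is_row_choice:
  assumes j: "j < n" and t: "den t dvd vden z"
  shows "is_row (Node (it j) (Node (Atom (int s)) (enc_rat t))) j (u_row (D j) s {of_rat t..}) (r_row (D j) s {of_rat t..})"
proof -
  note valid_j = valid[OF law_in[OF j]]
  have le: "sc z (enc_rat t) \<le> vh z (enc_pair (v, p)) \<longleftrightarrow> of_rat t \<le> (of_rat v :: real)" if vp: "(v, p) \<in> set (laws ! j)" for v p
  proof -
    have "sc z (enc_rat t) \<le> vh z (enc_pair (v, p)) \<longleftrightarrow> real_of_int (sc z (enc_rat t)) \<le> of_int (vh z (enc_pair (v, p)))"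
      by simp
    then show ?thesis using V_pos by (simp only: sc_eq[OF t] vh_eq[OF j vp] mult_le_cancel_right_pos)
  qed
  have m: "of_int (\<Sum>pr\<leftarrow>prs (it j). if sc z (enc_rat t) \<le> vh z pr then ph z pr else 0) = P * measure (D j) {of_rat t..}"
    unfolding D_def measure_law_of[OF valid_j, of "{of_rat t..}", simplified]
    by (rule sum_prs[OF j]) (simp add: le ph_eq[OF j])
  have g: "of_int (\<Sum>pr\<leftarrow>prs (it j). if sc z (enc_rat t) \<le> vh z pr then ph z pr * vh z pr else 0) = P * V * gain_on (D j) {of_rat t..}"
    unfolding D_def gain_on_law_of[OF valid_j, of "{of_rat t..}", simplified]
    by (rule sum_prs[OF j]) (simp add: le ph_eq[OF j] vh_eq[OF j])
  show ?thesis
    unfolding is_row_def uhat_def vhat_def y_simps using m g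
    by (auto simp: idof_it u_row_def r_row_def X_def npar_z E_def)
qed

text \<open>Homogeneity: each summand has one factor per variable, each of them scaled by
  \<open>X\<close>, and the reward factor also by \<open>V\<close>. Maximising \<open>phihat\<close>
  thus maximises \<open>reward_bound\<close>.\<close>

lemma phihat_eq:
  assumes R: "\<And>j. j \<in> set js' \<Longrightarrow> is_row (R j) j (u j) (r j)" and "distinct js'"
  shows "of_int (phihat y (map R js')) = V * X ^ card (set js') * reward_bound n (set js') u r"
proof -
  let ?J = "set js'"
  have id: "idof (R j) = int j" if "j \<in> ?J" for j using R[OF that] by (simp add: is_row_def)
  have filter: "filter (\<lambda>c'. \<not> idof c' = idof (R i)) (map R js') = map R (filter (\<lambda>j. j \<noteq> i) js')" if "i \<in> ?J" for i
    using id that by (auto simp: filter_map comp_def intro!: arg_cong[where f = "map R"] filter_cong)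
  have "phihat y (map R js') = (\<Sum>k<n. \<Sum>i\<in>?J. vhat y (R i) (Atom (int k)) *
      (\<Prod>j\<in>?J - {i}. int n * epar z * pden z - uhat y (R j) (Atom (int k))))"
  proof -
    have inner: "(\<Sum>c\<leftarrow>map R js'. vhat y c k * (\<Prod>c'\<leftarrow>filter (\<lambda>c'. \<not> idof c' = idof c) (map R js'). int n * epar z * pden z - uhat y c' k)) =
        (\<Sum>i\<in>?J. vhat y (R i) k * (\<Prod>j\<in>?J - {i}. int n * epar z * pden z - uhat y (R j) k))" for k
    proof -
      have "(\<Sum>c\<leftarrow>map R js'. vhat y c k * (\<Prod>c'\<leftarrow>filter (\<lambda>c'. \<not> idof c' = idof c) (map R js'). int n * epar z * pden z - uhat y c' k)) =
          (\<Sum>i\<in>?J. vhat y (R i) k * (\<Prod>c'\<leftarrow>filter (\<lambda>c'. \<not> idof c' = idof (R i)) (map R js'). int n * epar z * pden z - uhat y c' k))"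
        by (simp add: comp_def sum_list_distinct_conv_sum_set[OF assms(2)])
      also have "\<dots> = (\<Sum>i\<in>?J. vhat y (R i) k * (\<Prod>j\<in>?J - {i}. int n * epar z * pden z - uhat y (R j) k))"
      proof (intro sum.cong refl arg_cong2[where f = "(*)"])
        fix i assume "i \<in> ?J"
        have "(\<Prod>j\<in>set (filter (\<lambda>j. j \<noteq> i) js'). int n * epar z * pden z - uhat y (R j) k) =
            (\<Prod>j\<leftarrow>filter (\<lambda>j. j \<noteq> i) js'. int n * epar z * pden z - uhat y (R j) k)"
          by (rule prod.distinct_set_conv_list) (use assms(2) in simp)
        moreover have "set (filter (\<lambda>j. j \<noteq> i) js') = ?J - {i}" by auto
        ultimately show "(\<Prod>c'\<leftarrow>filter (\<lambda>c'. \<not> idof c' = idof (R i)) (map R js'). int n * epar z * pden z - uhat y c' k) =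
            (\<Prod>j\<in>?J - {i}. int n * epar z * pden z - uhat y (R j) k)"
          by (simp add: filter[OF \<open>i \<in> ?J\<close>] comp_def)
      qed
      finally show ?thesis .
    qed
    have outer: "(\<Sum>k\<leftarrow>map (\<lambda>i. Atom (int i)) (rev [0..<n]). F k) = (\<Sum>k<n. F (Atom (int k)))" for F :: "data \<Rightarrow> int"
      by (simp add: comp_def sum_list_distinct_conv_sum_set atLeast0LessThan)
    show ?thesis
      unfolding phihat_def y_simps npar_z idx_z inner outer ..
  qed
  then have "of_int (phihat y (map R js')) = (\<Sum>k<n. \<Sum>i\<in>?J. of_int (vhat y (R i) (Atom (int k))) *
      (\<Prod>j\<in>?J - {i}. X - of_int (uhat y (R j) (Atom (int k)))))"
    by (simp add: X_def E_def P_def)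
  also have "\<dots> = (\<Sum>k<n. \<Sum>i\<in>?J. V * X ^ card ?J * (r i k * (\<Prod>j\<in>?J - {i}. 1 - u j k)))"
  proof (intro sum.cong refl)
    fix k i assume k: "k \<in> {..<n}" and i: "i \<in> ?J"
    have "(\<Prod>j\<in>?J - {i}. X - of_int (uhat y (R j) (Atom (int k)))) = (\<Prod>j\<in>?J - {i}. X * (1 - u j k))"
      using R k by (intro prod.cong) (auto simp: is_row_def right_diff_distrib)
    also have "\<dots> = X ^ (card ?J - 1) * (\<Prod>j\<in>?J - {i}. 1 - u j k)"
      using i by (simp add: prod.distrib)
    finally have p: "(\<Prod>j\<in>?J - {i}. X - of_int (uhat y (R j) (Atom (int k)))) = X ^ (card ?J - 1) * (\<Prod>j\<in>?J - {i}. 1 - u j k)" .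
    have "X ^ card ?J = X * X ^ (card ?J - 1)"
      using i by (metis List.finite_set One_nat_def card_gt_0_iff empty_iff power_eq_if not_gr_zero)
    then show "of_int (vhat y (R i) (Atom (int k))) * (\<Prod>j\<in>?J - {i}. X - of_int (uhat y (R j) (Atom (int k)))) =
        V * X ^ card ?J * (r i k * (\<Prod>j\<in>?J - {i}. 1 - u j k))"
      using R[OF i] k unfolding p by (simp add: is_row_def)
  qed
  finally show ?thesis by (simp add: reward_bound_def sum_distrib_left)
qed

end

section \<open>Greedy rounding over the candidate thresholds\<close>

lemma member_le_sum_list_int: "x \<in> set xs \<Longrightarrow> (\<And>x. x \<in> set xs \<Longrightarrow> 0 \<le> f x) \<Longrightarrow> f x \<le> (\<Sum>x\<leftarrow>xs. f x :: int)"
proof (induction xs)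
  case (Cons a xs)
  have "0 \<le> (\<Sum>x\<leftarrow>xs. f x)" by (rule sum_list_nonneg) (use Cons.prems in auto)
  then show ?case using Cons by (cases "x = a") (auto intro: add_increasing)
qed simp

lemma slots_concat:
  fixes sl :: "'a \<Rightarrow> 'b :: linorder"
  assumes "sorted_wrt (>) ks" "distinct xs"
  defines "ys \<equiv> concat (map (\<lambda>k. filter (\<lambda>j. sl j = k) xs) ks)"
  shows "distinct ys" "sorted_wrt (\<lambda>a b. sl b \<le> sl a) ys" "set ys = {x\<in>set xs. sl x \<in> set ks}"
proof -
  have "distinct ys \<and> sorted_wrt (\<lambda>a b. sl b \<le> sl a) ys \<and> set ys = {x\<in>set xs. sl x \<in> set ks}"
    using assms(1) unfolding ys_def
  proof (induction ks)
    case (Cons k ks)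
    have "sorted_wrt (\<lambda>a b. sl b \<le> sl a) (filter (\<lambda>j. sl j = k) zs)" for zs
      by (induction zs) auto
    then show ?case using Cons assms(2) by (auto simp: sorted_wrt_append intro: less_imp_le)
  qed simp
  then show "distinct ys" "sorted_wrt (\<lambda>a b. sl b \<le> sl a) ys" "set ys = {x\<in>set xs. sl x \<in> set ks}" by auto
qed

context program_instance begin

definition thresholds :: "nat \<Rightarrow> rat list" where
  "thresholds j = of_int (1 + (\<Sum>pr\<leftarrow>prs (it j). vh z pr)) # map fst (laws ! j)"

lemma thresholds_dvd:
  assumes "j < n" "t \<in> set (thresholds j)"
  shows "den t dvd vden z"
proof -
  consider m where "t = of_int m" | p where "(t, p) \<in> set (laws ! j)"
    using assms(2) unfolding thresholds_def list.set set_map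
    by (elim insertE imageE, blast, metis prod.collapse)
  then show ?thesis using den_dvd(1)[OF assms(1)] by cases auto
qed

text \<open>The first threshold exceeds all values, so that every upward closed acceptance set is
  represented.\<close>

lemma threshold_exists:
  fixes A :: "real set"
  assumes j: "j < n" and up: "\<And>a b. a \<in> A \<Longrightarrow> a \<le> b \<Longrightarrow> b \<in> A"
  shows "\<exists>t\<in>set (thresholds j). \<forall>(v, p)\<in>set (laws ! j). of_rat v \<in> A \<longleftrightarrow> of_rat v \<in> {real_of_rat t..}"
proof (cases "\<exists>v\<in>fst ` set (laws ! j). of_rat v \<in> A")
  case True
  define t where "t = Min {v \<in> fst ` set (laws ! j). of_rat v \<in> A}"
  have t: "t \<in> {v \<in> fst ` set (laws ! j). of_rat v \<in> A}" unfolding t_def using True by (intro Min_in) auto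
  have tA: "of_rat t \<in> A" using t by simp
  have least: "t \<le> v" if "(v, p) \<in> set (laws ! j)" "of_rat v \<in> A" for v p
    unfolding t_def using that by (intro Min_le) force+
  have "of_rat v \<in> A \<longleftrightarrow> of_rat v \<in> {real_of_rat t..}" if "(v, p) \<in> set (laws ! j)" for v p
    using least[OF that] up[OF tA, of "of_rat v"] by (auto simp: of_rat_less_eq)
  then have "\<forall>(v, p)\<in>set (laws ! j). of_rat v \<in> A \<longleftrightarrow> of_rat v \<in> {real_of_rat t..}"
    by blast
  moreover have "t \<in> set (thresholds j)" using t by (auto simp: thresholds_def)
  ultimately show ?thesis by blast
next
  case False
  let ?M = "1 + (\<Sum>pr\<leftarrow>prs (it j). vh z pr)"
  have nn: "0 \<le> vh z (enc_pair (v, p))" if "(v, p) \<in> set (laws ! j)" for v p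
  proof -
    have "0 \<le> real_of_int (vh z (enc_pair (v, p)))"
      using fin_law_nonneg[OF valid[OF law_in[OF j]] that] V_pos
      by (simp add: vh_eq[OF j that] zero_le_of_rat_iff)
    then show ?thesis by simp
  qed
  have less: "of_rat v < real_of_rat (of_int ?M)" if vp: "(v, p) \<in> set (laws ! j)" for v p
  proof -
    have "1 \<le> V" using V_pos by (simp add: V_def)
    moreover have "0 \<le> real_of_rat v" using fin_law_nonneg[OF valid[OF law_in[OF j]] vp] by (simp add: zero_le_of_rat_iff)
    ultimately have "real_of_rat v * 1 \<le> of_rat v * V" by (intro mult_left_mono)
    also have "\<dots> = of_int (vh z (enc_pair (v, p)))" by (simp add: vh_eq[OF j vp])
    also have "\<dots> < of_int ?M"
    proof -
      have "vh z (enc_pair (v, p)) \<le> (\<Sum>pr\<leftarrow>prs (it j). vh z pr)"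
        by (rule member_le_sum_list_int) (use vp nn in \<open>auto simp: prs_it\<close>)
      then show ?thesis by simp
    qed
    finally show ?thesis unfolding of_rat_of_int_eq mult_1_right .
  qed
  have notin: "of_rat v \<notin> A" if "(v, p) \<in> set (laws ! j)" for v p
    using False that by force
  have "of_rat v \<in> A \<longleftrightarrow> of_rat v \<in> {real_of_rat (of_int ?M)..}" if "(v, p) \<in> set (laws ! j)" for v p
    using notin[OF that] leD less[OF that] unfolding atLeast_iff by blast
  then have "\<forall>(v, p)\<in>set (laws ! j). of_rat v \<in> A \<longleftrightarrow> of_rat v \<in> {real_of_rat (of_int ?M)..}"
    by blast
  then show ?thesis by (intro bexI[of _ "of_int ?M"]) (auto simp: thresholds_def)
qed

end

context program_selection begin

definition choice :: "nat \<Rightarrow> nat \<Rightarrow> rat \<Rightarrow> data" where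
  "choice j s t = Node (it j) (Node (Atom (int s)) (enc_rat t))"

lemma set_cands: "set (cands y (it j)) = (\<Union>s<n. \<Union>t\<in>set (thresholds j). {choice j s t})"
proof -
  have "Node (Atom (1 + (\<Sum>pr\<leftarrow>prs (it j). vh z pr))) (Atom 1) # map (\<lambda>pr. fs pr) (prs (it j)) = map enc_rat (thresholds j)"
    by (simp only: thresholds_def list.map enc_rat_of_int) (simp add: prs_it comp_def enc_pair_eq)
  then show ?thesis
    by (auto simp: cands_def y_simps idx_z choice_def)
qed

definition gstep :: "data \<Rightarrow> data list \<Rightarrow> data list" where
  "gstep i acc = best (\<lambda>c. phihat y (acc @ c # map (\<lambda>i. Node i (Atom 0)) (filter (\<lambda>i'. int_of (fs i') < int_of (fs i)) (map it js))))
      (cands y i) # acc"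

lemma greedy_fold: "greedy y = fold gstep (map it js) []"
  by (simp add: greedy_def gstep_def[abs_def] y_simps)

text \<open>The invariant compares the partially rounded rows with the averaged ones. For the next
  variable \<open>round_row\<close> provides a slot and an event that do not lower the bound, a
  candidate threshold represents the event on the support, and the program picks a candidate that is
  at least as good.\<close>

lemma greedy_prefix:
  assumes "js = pre @ suf"
  shows "\<exists>sl th. (\<forall>j\<in>set pre. sl j < n \<and> th j \<in> set (thresholds j)) \<and>
    fold gstep (map it pre) [] = rev (map (\<lambda>j. choice j (sl j) (th j)) pre) \<and>
    reward_bound n (set js) u\<^sub>0 r\<^sub>0 \<le> reward_bound n (set js)
      (\<lambda>j. if j \<in> set pre then u_row (D j) (sl j) {of_rat (th j)..} else u\<^sub>0 j)
      (\<lambda>j. if j \<in> set pre then r_row (D j) (sl j) {of_rat (th j)..} else r\<^sub>0 j)"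
  using assms
proof (induction pre arbitrary: suf rule: rev_induct)
  case Nil
  show ?case by simp
next
  case (snoc j pre)
  have js: "js = pre @ j # suf" using snoc.prems by simp
  have j: "j \<in> set js" "j < n" "j \<notin> set pre" "j \<notin> set suf" "distinct (rev pre @ j # suf)"
    "\<And>i. i \<in> set pre \<Longrightarrow> i < n" "\<And>i. i \<in> set suf \<Longrightarrow> i < n" "\<And>i. i \<in> set suf \<Longrightarrow> i \<notin> set pre"
    using js_distinct js_set by (auto simp: js)
  have setjs: "set (rev pre @ j # suf) = set js" by (simp add: js)
  obtain sl th where IH: "\<forall>i\<in>set pre. sl i < n \<and> th i \<in> set (thresholds i)"
    "fold gstep (map it pre) [] = rev (map (\<lambda>j. choice j (sl j) (th j)) pre)"
    and le0: "reward_bound n (set js) u\<^sub>0 r\<^sub>0 \<le> reward_bound n (set js)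
      (\<lambda>j. if j \<in> set pre then u_row (D j) (sl j) {of_rat (th j)..} else u\<^sub>0 j)
      (\<lambda>j. if j \<in> set pre then r_row (D j) (sl j) {of_rat (th j)..} else r\<^sub>0 j)"
    (is "_ \<le> reward_bound _ _ ?u ?r")
    using snoc.IH[OF js] by blast
  let ?acc = "rev (map (\<lambda>j. choice j (sl j) (th j)) pre)"
  let ?rest = "map (\<lambda>i. Node i (Atom 0)) (map it suf)"
  define key where "key c = phihat y (?acc @ c # ?rest)" for c
  \<comment> \<open>\<open>js\<close> is decreasing, so the part behind \<open>j\<close> consists of
    the smaller indices.\<close>
  have rest: "filter (\<lambda>i'. int_of (fs i') < int_of (fs (it j))) (map it js) = map it suf"
  proof -
    have "filter (\<lambda>i. i < j) js = suf"
      using js_sorted unfolding js by (auto simp: sorted_wrt_append filter_empty_conv filter_id_conv)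
    then show ?thesis by (simp add: filter_map comp_def it_def)
  qed
  have key: "of_int (key (choice j s t)) = V * X ^ card (set js) *
      reward_bound n (set js) (?u(j := u_row (D j) s {of_rat t..})) (?r(j := r_row (D j) s {of_rat t..}))"
    if t: "t \<in> set (thresholds j)" for s t
  proof -
    define R where "R i = (if i \<in> set pre then choice i (sl i) (th i) else if i = j then choice j s t else Node (it i) (Atom 0))" for i
    have eq: "?acc @ choice j s t # ?rest = map R (rev pre @ j # suf)"
      using j by (auto simp: R_def rev_map)
    have "of_int (phihat y (map R (rev pre @ j # suf))) = V * X ^ card (set (rev pre @ j # suf)) *
        reward_bound n (set (rev pre @ j # suf)) (?u(j := u_row (D j) s {of_rat t..})) (?r(j := r_row (D j) s {of_rat t..}))"
    proof (rule phihat_eq[OF _ j(5)])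
      fix i assume "i \<in> set (rev pre @ j # suf)"
      then consider "i \<in> set pre" "i \<noteq> j" | "i = j" | "i \<in> set suf" "i \<notin> set pre" "i \<noteq> j" using j by auto
      then show "is_row (R i) i ((?u(j := u_row (D j) s {of_rat t..})) i) ((?r(j := r_row (D j) s {of_rat t..})) i)"
      proof cases
        case 1
        then show ?thesis
          using is_row_choice[OF j(6) thresholds_dvd[OF j(6)], where t = "th i" and s = "sl i"] IH(1) by (simp add: R_def choice_def)
      next
        case 2
        then show ?thesis
          using is_row_choice[OF j(2) thresholds_dvd[OF j(2) t], where s = s] j(3) by (simp add: R_def choice_def)
      next
        case 3
        then show ?thesis using is_row_prior[OF j(7)] by (simp add: R_def)
      qed
    qed
    then show ?thesis unfolding key_def eq setjs .
  qed
  have ne: "cands y (it j) \<noteq> []"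
    using set_cands[of j] n_pos by (auto simp: thresholds_def)
  obtain s t where st: "s < n" "t \<in> set (thresholds j)" "best key (cands y (it j)) = choice j s t"
    using best_in[OF ne, of key] by (auto simp: set_cands)
  have "gstep (it j) ?acc = choice j s t # ?acc"
    unfolding gstep_def rest key_def[symmetric] using st(3) by simp
  then have fold: "fold gstep (map it (pre @ [j])) [] = rev (map (\<lambda>i. choice i ((sl(j := s)) i) ((th(j := t)) i)) (pre @ [j]))"
    using IH(2) j(3) by (auto simp: rev_map)
  obtain s' A where s': "s' < n" and A: "A \<in> {{W s'<..}, {q j..}, {q j<..}}"
    and le1: "reward_bound n (set js) (?u(j := u\<^sub>0 j)) (?r(j := r\<^sub>0 j)) \<le>
      reward_bound n (set js) (?u(j := u_row (D j) s' A)) (?r(j := r_row (D j) s' A))"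
    using round_row[OF j(1)] by blast
  obtain t' where t': "t' \<in> set (thresholds j)"
    "\<forall>(v, p)\<in>set (laws ! j). of_rat v \<in> A \<longleftrightarrow> of_rat v \<in> {real_of_rat t'..}"
    using threshold_exists[OF j(2), of A] A by auto
  have "A \<in> sets borel" using A by auto
  moreover have "of_rat v \<in> A \<longleftrightarrow> of_rat v \<in> {real_of_rat t'..}" if "(v, p) \<in> set (laws ! j)" for v p
    using t'(2) that by blast
  ultimately have "measure (D j) A = measure (D j) {of_rat t'..}" "gain_on (D j) A = gain_on (D j) {of_rat t'..}"
    unfolding D_def by (intro rows_law_of_cong[OF valid[OF law_in[OF j(2)]]]; simp)+
  then have rows: "u_row (D j) s' A = u_row (D j) s' {of_rat t'..}" "r_row (D j) s' A = r_row (D j) s' {of_rat t'..}"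
    by (auto simp: fun_eq_iff u_row_def r_row_def)
  have "key (choice j s' t') \<le> key (choice j s t)"
    using best_max[of "choice j s' t'" "cands y (it j)" key] s' t'(1) st(3) by (auto simp: set_cands)
  then have "real_of_int (key (choice j s' t')) \<le> of_int (key (choice j s t))" by simp
  then have le2: "reward_bound n (set js) (?u(j := u_row (D j) s' A)) (?r(j := r_row (D j) s' A)) \<le>
      reward_bound n (set js) (?u(j := u_row (D j) s {of_rat t..})) (?r(j := r_row (D j) s {of_rat t..}))"
    using V_pos X_pos unfolding key[OF t'(1)] key[OF st(2)] rows by (subst (asm) mult_le_cancel_left_pos) auto
  have same: "?u(j := u\<^sub>0 j) = ?u" "?r(j := r\<^sub>0 j) = ?r" using j(3) by auto
  have upd: "?u(j := u_row (D j) s {of_rat t..}) = (\<lambda>i. if i \<in> set (pre @ [j]) then u_row (D i) ((sl(j := s)) i) {of_rat ((th(j := t)) i)..} else u\<^sub>0 i)"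
    "?r(j := r_row (D j) s {of_rat t..}) = (\<lambda>i. if i \<in> set (pre @ [j]) then r_row (D i) ((sl(j := s)) i) {of_rat ((th(j := t)) i)..} else r\<^sub>0 i)"
    by auto
  have "\<forall>i\<in>set (pre @ [j]). (sl(j := s)) i < n \<and> (th(j := t)) i \<in> set (thresholds i)"
    using IH(1) st j(3) by auto
  with fold order_trans[OF le0 order_trans[OF le1[unfolded same] le2], unfolded upd] show ?case
    by (intro exI[of _ "sl(j := s)"] exI[of _ "th(j := t)"] conjI)
qed

definition enc_entry :: "nat \<times> rat \<Rightarrow> data" where
  "enc_entry = (\<lambda>(i, r). Node (Atom (int i)) (enc_rat r))"

lemma outp_correct:
  "\<exists>sch. outp y = map enc_entry sch \<and> distinct (map fst sch) \<and> set (map fst sch) = set js \<and>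
    ennreal (W n / (1 + 6 * (1 / E))) \<le> expected_reward D (set js) (schedule_policy sch)"
proof -
  obtain sl th where sl: "\<forall>j\<in>set js. sl j < n \<and> th j \<in> set (thresholds j)"
    and gr: "greedy y = rev (map (\<lambda>j. choice j (sl j) (th j)) js)"
    and le: "reward_bound n (set js) u\<^sub>0 r\<^sub>0 \<le> reward_bound n (set js)
      (\<lambda>j. if j \<in> set js then u_row (D j) (sl j) {of_rat (th j)..} else u\<^sub>0 j)
      (\<lambda>j. if j \<in> set js then r_row (D j) (sl j) {of_rat (th j)..} else r\<^sub>0 j)"
    using greedy_prefix[of js "[]"] by (auto simp: greedy_fold)
  have cong: "reward_bound n (set js)
      (\<lambda>j. if j \<in> set js then u_row (D j) (sl j) {of_rat (th j)..} else u\<^sub>0 j)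
      (\<lambda>j. if j \<in> set js then r_row (D j) (sl j) {of_rat (th j)..} else r\<^sub>0 j) =
    reward_bound n (set js) (\<lambda>j. u_row (D j) (sl j) {of_rat (th j)..}) (\<lambda>j. r_row (D j) (sl j) {of_rat (th j)..})"
    unfolding reward_bound_def by (intro sum.cong prod.cong refl arg_cong2[where f = "(*)"]) auto
  define js' where "js' = concat (map (\<lambda>k. filter (\<lambda>j. sl j = k) (rev js)) (rev [0..<n]))"
  have "sorted_wrt (>) (rev [0..<n])" by (simp add: sorted_wrt_rev)
  note js' = slots_concat[OF this, of "rev js" sl, folded js'_def]
  have dist: "distinct js'" and srt: "sorted_wrt (\<lambda>a b. sl b \<le> sl a) js'" and st: "set js' = set js"
    using js' js_distinct sl by auto
  define sch where "sch = map (\<lambda>j. (j, th j)) js'"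
  have "outp y = map (\<lambda>j. Node (Atom (int j)) (enc_rat (th j))) js'"
    unfolding outp_def y_simps idx_z gr js'_def
    by (simp add: map_concat comp_def choice_def filter_map rev_map it_def)
  then have out: "outp y = map enc_entry sch" by (simp add: sch_def enc_entry_def)
  have "ennreal (W n / (1 + 6 * (1 / E))) \<le> expected_reward D (set js) (set_policy (map (\<lambda>j. (j, {of_rat (th j)..})) js'))"
    using reward_ge_W[OF le[unfolded cong]] sl dist srt st
    by (intro order_trans[OF ennreal_leI expected_reward_ge_slots[where T = n and sl = sl]]) (auto simp: law mean)
  also have "set_policy (map (\<lambda>j. (j, {of_rat (th j)..})) js') = schedule_policy sch"
    by (simp add: schedule_policy_eq sch_def comp_def)
  finally show ?thesis using out dist st by (intro exI[of _ sch]) (auto simp: sch_def comp_def)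
qed

end

section \<open>Selection of the kept variables and the guarantee of the program\<close>

context program_instance begin

lemma qh_iff:
  "qh z (it i) < qh z (it j) \<longleftrightarrow> q i < q j" "qh z (it i) \<le> qh z (it j) \<longleftrightarrow> q i \<le> q j"
  "(epar z - 1) * qh z (it i) \<le> epar z * qh z (it j) \<longleftrightarrow> (E - 1) * q i \<le> E * q j"
  "epar z ^ 3 * qh z (it j) \<le> qh z (it i) \<longleftrightarrow> E ^ 3 * q j \<le> q i"
proof -
  have h: "real_of_int (qh z (it i)) = q i * V" for i using V_pos by (simp add: q_def)
  have le: "a \<le> b \<longleftrightarrow> c \<le> d" if "real_of_int a = c * V" "real_of_int b = d * V" for a b c d
    using that V_pos by (metis of_int_le_iff mult_le_cancel_right_pos)
  show "qh z (it i) \<le> qh z (it j) \<longleftrightarrow> q i \<le> q j" for i j by (rule le) (simp_all add: h)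
  then show "qh z (it i) < qh z (it j) \<longleftrightarrow> q i < q j" by (simp flip: not_le)
  show "(epar z - 1) * qh z (it i) \<le> epar z * qh z (it j) \<longleftrightarrow> (E - 1) * q i \<le> E * q j"
    by (rule le) (simp_all add: h E_def)
  show "epar z ^ 3 * qh z (it j) \<le> qh z (it i) \<longleftrightarrow> E ^ 3 * q j \<le> q i"
    by (rule le) (simp_all add: h E_def)
qed

lemma length_filter_items: "length (filter Q (items z)) = card {j\<in>{..<n}. Q (it j)}"
proof -
  have "length (filter Q (items z)) = length (filter (\<lambda>j. Q (it j)) (rev [0..<n]))"
    by (simp add: items_z filter_map comp_def)
  also have "\<dots> = card (set (filter (\<lambda>j. Q (it j)) (rev [0..<n])))"
    by (rule distinct_card[symmetric]) simp
  also have "set (filter (\<lambda>j. Q (it j)) (rev [0..<n])) = {j\<in>{..<n}. Q (it j)}" by auto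
  finally show ?thesis .
qed

lemma epar_bounds: "E \<le> 1 / of_rat \<epsilon>" "1 / of_rat \<epsilon> < E + 1"
proof -
  have "0 < num \<epsilon>"
  proof -
    have "0 < real_of_rat \<epsilon>" using \<epsilon>_pos by simp
    then show ?thesis using den_pos[of \<epsilon>] by (simp add: of_rat_num_den zero_less_divide_iff)
  qed
  have "epar z = \<lfloor>real_of_int (den \<epsilon>) / of_int (num \<epsilon>)\<rfloor>"
    by (simp add: epar_def z_eq floor_divide_of_int_eq)
  also have "real_of_int (den \<epsilon>) / of_int (num \<epsilon>) = 1 / of_rat \<epsilon>"
    by (simp add: of_rat_num_den)
  finally show "E \<le> 1 / of_rat \<epsilon>" "1 / of_rat \<epsilon> < E + 1" unfolding E_def by linarith+
qed

text \<open>The count L satisfies 2^(L - 1) \<le> E < 2^L. With 2/3 \<le> ln 2 \<le> 1 this gives ln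
  E \<le> L \<le> 1 + 3/2 ln E, and 1 \<le> ln E absorbs the summand 1.\<close>

lemma lgpar_bounds:
  assumes "4 \<le> E" "E \<le> n"
  shows "0 \<le> lgpar z" "ln E \<le> of_int (lgpar z)" "of_int (lgpar z) \<le> 3 * ln E"
proof -
  define L where "L = card {i\<in>{..<n}. 2 ^ i \<le> epar z}"
  have two: "(\<Prod>j\<leftarrow>filter (\<lambda>j. int_of j < int i) (idx z). 2) = (2 :: int) ^ i" if "i < n" for i
  proof -
    have "filter (\<lambda>j. j < i) (rev [0..<n]) = rev [0..<i]"
      using that by (simp add: rev_filter[symmetric] filter_upt_less)
    then have "length (filter (\<lambda>j. int_of j < int i) (idx z)) = i"
      by (simp add: idx_z filter_map comp_def)
    moreover have "(\<Prod>j\<leftarrow>xs. 2) = (2 :: int) ^ length xs" for xs :: "data list" by (induction xs) auto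
    ultimately show ?thesis by simp
  qed
  have L: "lgpar z = int L"
  proof -
    have "length (filter (\<lambda>i. (\<Prod>j\<leftarrow>filter (\<lambda>j. int_of j < int_of i) (idx z). 2) \<le> epar z) (idx z)) =
        length (filter (\<lambda>i. 2 ^ i \<le> epar z) (rev [0..<n]))"
    proof -
      have "filter (\<lambda>i. (\<Prod>j\<leftarrow>filter (\<lambda>j. int_of j < int_of i) (idx z). 2) \<le> epar z) (idx z) =
          map (\<lambda>i. Atom (int i)) (filter (\<lambda>i. (\<Prod>j\<leftarrow>filter (\<lambda>j. int_of j < int i) (idx z). 2) \<le> epar z) (rev [0..<n]))"
        by (subst (2) idx_z) (simp add: filter_map comp_def)
      also have "filter (\<lambda>i. (\<Prod>j\<leftarrow>filter (\<lambda>j. int_of j < int i) (idx z). 2) \<le> epar z) (rev [0..<n]) = filter (\<lambda>i. 2 ^ i \<le> epar z) (rev [0..<n])"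
        using two by (intro filter_cong) auto
      finally show ?thesis by simp
    qed
    also have "\<dots> = card (set (filter (\<lambda>i. 2 ^ i \<le> epar z) (rev [0..<n])))"
      by (rule distinct_card[symmetric]) simp
    also have "set (filter (\<lambda>i. 2 ^ i \<le> epar z) (rev [0..<n])) = {i\<in>{..<n}. 2 ^ i \<le> epar z}" by auto
    finally show ?thesis by (simp add: lgpar_def L_def)
  qed
  show "0 \<le> lgpar z" by (simp add: L)
  have up: "E < 2 ^ L"
  proof (rule ccontr)
    assume "\<not> E < 2 ^ L"
    then have le: "2 ^ L \<le> E" by simp
    \<comment> \<open>This is where \<open>E \<le> n\<close> enters: the exponent \<open>L\<close>
      itself is among those that the program tests.\<close>
    have "L < n"
    proof -
      have "real L < 2 ^ L" by (rule of_nat_less_two_power)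
      then show ?thesis using le assms(2) by linarith
    qed
    have "{..L} \<subseteq> {i\<in>{..<n}. 2 ^ i \<le> epar z}"
    proof
      fix i assume i: "i \<in> {..L}"
      then have "(2::real) ^ i \<le> 2 ^ L" by (intro power_increasing) auto
      moreover have "real_of_int (2 ^ i) = 2 ^ i" by simp
      ultimately have "real_of_int (2 ^ i) \<le> of_int (epar z)"
        using le unfolding E_def by linarith
      then have "2 ^ i \<le> epar z" by (simp only: of_int_le_iff)
      then show "i \<in> {i\<in>{..<n}. 2 ^ i \<le> epar z}" using i \<open>L < n\<close> by simp
    qed
    then have "card {..L} \<le> L" unfolding L_def by (rule card_mono[rotated]) simp
    then show False by simp
  qed
  have ln2: "2/3 \<le> ln (2::real)" "ln (2::real) \<le> 1" using ln2_ge_two_thirds ln_2_less_1 by auto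
  have "ln E \<le> ln (2 ^ L)" using up assms(1) by (intro ln_mono) auto
  also have "\<dots> = L * ln 2" by (simp add: ln_realpow)
  also have "\<dots> \<le> real L * 1" using ln2 by (intro mult_left_mono) auto
  finally show "ln E \<le> of_int (lgpar z)" by (simp add: L)
  have lnE: "1 \<le> ln E"
    using ln_4_gt_1 ln_mono[of 4 E] assms(1) by linarith
  show "of_int (lgpar z) \<le> 3 * ln E"
  proof (cases "L = 0")
    case True
    then show ?thesis using lnE by (simp add: L)
  next
    case False
    have "2 ^ (L - 1) \<le> E"
    proof (rule ccontr)
      assume not: "\<not> 2 ^ (L - 1) \<le> E"
      have "{i\<in>{..<n}. 2 ^ i \<le> epar z} \<subseteq> {..<L - 1}"
      proof
        fix i assume "i \<in> {i\<in>{..<n}. 2 ^ i \<le> epar z}"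
        then have "real_of_int (2 ^ i) \<le> of_int (epar z)" by (simp only: of_int_le_iff) simp
        moreover have "real_of_int (2 ^ i) = 2 ^ i" by simp
        ultimately have "(2::real) ^ i < 2 ^ (L - 1)" using not unfolding E_def by linarith
        then have "i < L - 1" by (rule power_less_imp_less_exp[rotated]) simp
        then show "i \<in> {..<L - 1}" by simp
      qed
      then have "L \<le> card {..<L - 1}" unfolding L_def by (rule card_mono[rotated]) simp
      then show False using False by simp
    qed
    then have "ln (2 ^ (L - 1)) \<le> ln E" by (intro ln_mono) auto
    then have "real (L - 1) * ln 2 \<le> ln E" by (simp add: ln_realpow)
    moreover have "real (L - 1) * (2/3) \<le> real (L - 1) * ln 2" using ln2 by (intro mult_left_mono) auto
    ultimately have "real (L - 1) \<le> 3/2 * ln E" by simp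
    then show ?thesis using False lnE by (simp add: L of_nat_diff)
  qed
qed

definition good_output :: "nat set \<Rightarrow> schedule \<Rightarrow> bool" where
  "good_output J sch \<longleftrightarrow> J \<subseteq> {..<n} \<and>
    real (card ({..<n} - J)) \<le> 27 * (inverse (of_rat \<epsilon>) * ln (1 / of_rat \<epsilon>))\<^sup>2 \<and>
    ennreal (kertz_const - 2 * loss_const * of_rat \<epsilon>) * expected_max D J \<le> expected_reward D J (schedule_policy sch)"

lemma prog_correct:
  "\<exists>sch. prog z = map (\<lambda>(i, r). Node (Atom (int i)) (enc_rat r)) sch \<and> distinct (map fst sch) \<and>
    good_output (set (map fst sch)) sch"
proof (cases "epar z < 4")
  case True
  let ?e = "real_of_rat \<epsilon>"
  have "E < 4" using True by (simp add: E_def)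
  moreover have "E \<le> 3" using True by (simp add: E_def)
  ultimately have "1 / ?e < 4" using epar_bounds by linarith
  then have "1/4 < ?e" using \<epsilon>_pos by (simp add: field_simps)
  then have "20 * (1/4) < 2 * loss_const * ?e"
    using kertz_const_pos by (intro mult_le_less_imp_less) (auto simp: loss_const_def)
  then have neg: "ennreal (kertz_const - 2 * loss_const * ?e) = 0"
    using kertz_const_less_1 by (simp add: ennreal_neg)
  define sch where "sch = map (\<lambda>i. (i, 0 :: rat)) (rev [0..<n])"
  have "set (map fst sch) = {..<n}" by (auto simp: sch_def comp_def)
  moreover have "prog z = map (\<lambda>(i, r). Node (Atom (int i)) (enc_rat r)) sch"
    using True by (simp add: prog_def items_z sch_def comp_def it_def enc_rat_of_int[of 0, simplified])
  moreover have "distinct (map fst sch)" by (simp add: sch_def comp_def)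
  ultimately show ?thesis by (intro exI[of _ sch]) (simp add: good_output_def neg)
next
  case e4: False
  let ?e = "real_of_rat \<epsilon>"
  have E4: "4 \<le> E" using e4 by (simp add: E_def)
  have "4 \<le> 1 / ?e" using E4 epar_bounds(1) by linarith
  moreover have \<epsilon>0: "0 < ?e" using \<epsilon>_pos by simp
  ultimately have \<epsilon>4: "?e \<le> 1/4" by (simp add: field_simps)
  have ln\<epsilon>: "ln E \<le> ln (1 / ?e)" "1 < ln (1 / ?e)"
    using epar_bounds(1) E4 ln_4_gt_1 ln_mono[of E "1 / ?e"] ln_mono[of 4 E] by linarith+
  show ?thesis
  proof (cases "npar z < epar z")
    case True
    \<comment> \<open>There are fewer than 1/\<epsilon> variables, and 1/\<epsilon> is within the
      budget as both factors of the product are at least 1.\<close>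
    have "1 * 1 \<le> inverse ?e * ln (1 / ?e)"
      using ln\<epsilon>(2) \<open>4 \<le> 1 / ?e\<close> less_imp_le[OF \<epsilon>_pos] by (intro mult_mono) (auto simp: inverse_eq_divide)
    then have "(inverse ?e * ln (1 / ?e)) * 1 \<le> (inverse ?e * ln (1 / ?e)) * (inverse ?e * ln (1 / ?e))"
      by (intro mult_left_mono) auto
    moreover have "inverse ?e * 1 \<le> inverse ?e * ln (1 / ?e)"
      using ln\<epsilon>(2) \<epsilon>0 by (intro mult_left_mono) auto
    moreover have "real n \<le> inverse ?e"
      using True epar_bounds(1) by (simp add: npar_z E_def inverse_eq_divide)
    ultimately have "real n \<le> 27 * (inverse ?e * ln (1 / ?e))\<^sup>2"
      unfolding power2_eq_square using \<open>1 * 1 \<le> inverse ?e * ln (1 / ?e)\<close> by linarith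
    moreover have "expected_max D {} = 0" by (simp add: expected_max_def bot_ennreal)
    ultimately show ?thesis
      using True e4 by (intro exI[of _ "[]"]) (simp add: prog_def good_output_def)
  next
    case False
    have n: "0 < n" "E \<le> n" using False e4 by (auto simp: npar_z E_def)
    define e where "e = nat (epar z)"
    define L where "L = nat (lgpar z)"
    have eE: "real e = E" "epar z = int e" using e4 by (auto simp: e_def E_def)
    note lg = lgpar_bounds[OF E4 n(2)]
    have L: "ln (real e) \<le> L" "real L \<le> 3 * ln (1 / ?e)" "lgpar z = int L"
      using lg ln\<epsilon>(1) by (auto simp: L_def eE)
    have budget: "real (3 * (e * L)\<^sup>2) \<le> 27 * (inverse ?e * ln (1 / ?e))\<^sup>2"
      by (rule budget_bound[OF \<epsilon>0 \<epsilon>4 _ L(2)]) (simp add: eE epar_bounds(1))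
    have le: "ennreal (kertz_const - 2 * loss_const * ?e) \<le> ennreal (kertz_const - loss_const * (1 / E))"
      using coarse_eps[OF \<epsilon>0 \<epsilon>4, of e] epar_bounds(2) by (intro ennreal_leI) (simp add: eE)
    have good_iff: "it i \<in> set (goods z) \<longleftrightarrow> card {j\<in>{..<n}. q i < q j} \<le> 3 * (e * L)\<^sup>2 \<and>
        e * L \<le> card {j\<in>{..<n}. q j \<le> q i \<and> (real e - 1) * q i \<le> e * q j}" if "i < n" for i
    proof -
      have "int a \<le> 3 * (epar z * lgpar z)\<^sup>2 \<longleftrightarrow> a \<le> 3 * (e * L)\<^sup>2" for a
        unfolding eE(2) L(3) by (metis of_nat_le_iff of_nat_mult of_nat_numeral of_nat_power)
      moreover have "epar z * lgpar z \<le> int a \<longleftrightarrow> e * L \<le> a" for a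
        unfolding eE(2) L(3) by (metis of_nat_le_iff of_nat_mult)
      moreover have "it i \<in> set (items z)" using that by (simp add: items_z)
      ultimately show ?thesis
        unfolding goods_def set_filter length_filter_items by (simp add: qh_iff eE(1))
    qed
    have "items z \<noteq> []" using n by (simp add: items_z)
    from best_in[OF this, of "\<lambda>i. qh z i"] obtain i0 where i0: "i0 < n" "topit z = it i0"
      by (auto simp: topit_def items_z)
    have top: "q j \<le> q i0" if "j < n" for j
      using best_max[of "it j" "items z" "\<lambda>i. qh z i"] that i0(2)
      by (simp add: items_z topit_def qh_iff(2)[symmetric])
    have q0: "0 \<le> q j" if "j < n" for j using q_nonneg[OF that] E4 by simp
    have sorted: "sorted_wrt (>) (filter Q (rev [0..<n]))" for Q
      by (intro sorted_wrt_filter) (simp add: sorted_wrt_rev)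
    have sel: "program_selection laws \<epsilon> (filter Q (rev [0..<n]))" for Q
      by unfold_locales (use n(1) E4 sorted in \<open>auto simp: n_def[symmetric]\<close>)
    show ?thesis
    \<comment> \<open>The same alternatives as in \<open>prophet_removal\<close>, now with the
      computed quantiles and the schedule of the program as the policy.\<close>
    proof (cases "goods z = []")
      case False
      then have "dhd (goods z) \<in> set (goods z)" by (cases "goods z") (auto simp: dhd_def)
      moreover have "set (goods z) \<subseteq> it ` {..<n}" by (auto simp: goods_def items_z)
      ultimately obtain i where i: "i < n" "dhd (goods z) = it i" "it i \<in> set (goods z)" by auto
      note gi = good_iff[OF i(1), THEN iffD1, OF i(3)]
      define js where "js = filter (\<lambda>j. q j \<le> q i) (rev [0..<n])"
      interpret program_selection laws \<epsilon> js unfolding js_def by (rule sel)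
      have "keep z = map it js"
        using False by (simp add: keep_def i(2) items_z filter_map comp_def qh_iff js_def)
      then have "prog z = outp y"
        using e4 False \<open>\<not> npar z < epar z\<close> by (simp add: prog_def keepd_def y_def)
      moreover obtain sch where sch: "outp y = map enc_entry sch" "distinct (map fst sch)"
        "set (map fst sch) = set js" "ennreal (W n / (1 + 6 * (1 / E))) \<le> expected_reward D (set js) (schedule_policy sch)"
        using outp_correct by blast
      moreover have "good_output (set js) sch"
        unfolding good_output_def
      proof (intro conjI)
        show "set js \<subseteq> {..<n}" by (rule js_set)
        have "{..<n} - set js = {j\<in>{..<n}. q i < q j}" by (auto simp: js_def)
        then show "real (card ({..<n} - set js)) \<le> 27 * (inverse ?e * ln (1 / ?e))\<^sup>2"
          using gi budget by (auto intro: order_trans simp del: of_nat_mult of_nat_power)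
        have "ennreal (kertz_const - loss_const * (1 / E)) * expected_max D (set js) \<le> ennreal (W n / (1 + 6 * (1 / E)))"
        proof (rule guarantee_window[of "q i"])
          have "{j\<in>{..<n}. q j \<le> q i \<and> (real e - 1) * q i \<le> e * q j} = {j\<in>set js. (1 - 1 / E) * q i \<le> q j}"
            using E4 by (auto simp: js_def eE field_simps)
          then have "real e * L \<le> real (card {j\<in>set js. (1 - 1 / E) * q i \<le> q j})"
            using gi by (simp flip: of_nat_mult)
          then have "1 / E * (real e * L) \<le> 1 / E * card {j\<in>set js. (1 - 1 / E) * q i \<le> q j}"
            using E4 by (intro mult_left_mono) auto
          then show "ln (1 / (1 / E)) \<le> 1 / E * card {j\<in>set js. (1 - 1 / E) * q i \<le> q j}"
            using L(1) E4 by (simp add: eE)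
        qed (use q0 i in \<open>auto simp: js_def\<close>)
        then show "ennreal (kertz_const - 2 * loss_const * ?e) * expected_max D (set js) \<le> expected_reward D (set js) (schedule_policy sch)"
          using sch(4) mult_right_mono[OF le, of "expected_max D (set js)"] by (meson order_trans zero_le)
      qed
      ultimately show ?thesis by (auto simp: enc_entry_def)
    next
      case nogood: True
      define js where "js = filter (\<lambda>j. E ^ 3 * q j \<le> q i0) (rev [0..<n])"
      interpret program_selection laws \<epsilon> js unfolding js_def by (rule sel)
      have "keep z = map it js"
        using nogood by (simp add: keep_def i0(2) items_z filter_map comp_def qh_iff js_def)
      then have kd: "keepd z = y" by (simp add: keepd_def y_def)
      have few: "card {j\<in>{..<n}. q i0 < e ^ 3 * q j} \<le> 3 * (e * L)\<^sup>2"
      proof (rule few_large_quantiles)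
        show "card {j\<in>{..<n}. q j \<le> q i \<and> (real e - 1) * q i \<le> e * q j} < e * L"
          if "i \<in> {..<n}" "card {j\<in>{..<n}. q i < q j} \<le> 3 * (e * L)\<^sup>2" for i
          using good_iff[of i] that nogood by (auto simp: not_le)
      qed (use E4 eE L(1) top q0 i0 in auto)
      have rem: "{..<n} - set js = {j\<in>{..<n}. q i0 < e ^ 3 * q j}" by (auto simp: js_def eE)
      have cardjs: "real (card ({..<n} - set js)) \<le> 27 * (inverse ?e * ln (1 / ?e))\<^sup>2"
        unfolding rem using few budget by (auto intro: order_trans simp del: of_nat_mult of_nat_power)
      have qJ: "q j \<le> q i0 * (1 / E) ^ 3" if "j \<in> set js" for j
        using that E4 by (simp add: js_def field_simps)
      obtain sch where sch: "outp y = map enc_entry sch" "distinct (map fst sch)"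
        "set (map fst sch) = set js" "ennreal (W n / (1 + 6 * (1 / E))) \<le> expected_reward D (set js) (schedule_policy sch)"
        using outp_correct by blast
      have small_iff: "wnum y (Atom (npar z)) * (epar z)\<^sup>2 < qh z (topit z) * wden y (Atom (npar z)) \<longleftrightarrow> W n < q i0 * (1 / E)\<^sup>2"
      proof -
        let ?b = "real_of_int (wden y (Atom (int n)))"
        have b: "0 < ?b * V" using wden_pos[of n] V_pos by simp
        have "wnum y (Atom (npar z)) * (epar z)\<^sup>2 < qh z (topit z) * wden y (Atom (npar z)) \<longleftrightarrow>
            real_of_int (wnum y (Atom (int n)) * (epar z)\<^sup>2) < of_int (qh z (it i0) * wden y (Atom (int n)))"
          by (simp only: npar_z i0(2) of_int_less_iff)
        also have "\<dots> \<longleftrightarrow> W n * E\<^sup>2 * (?b * V) < q i0 * (?b * V)"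
          using wnum_eq[of n] V_pos by (simp add: E_def q_def mult_ac)
        also have "\<dots> \<longleftrightarrow> W n * E\<^sup>2 < q i0" using b by (rule mult_less_cancel_right_pos)
        also have "\<dots> \<longleftrightarrow> W n < q i0 * (1 / E)\<^sup>2" using E4 by (simp add: field_simps)
        finally show ?thesis .
      qed
      show ?thesis
      proof (cases "W n < q i0 * (1 / E)\<^sup>2")
        case False
        then have "prog z = outp y"
          using e4 nogood \<open>\<not> npar z < epar z\<close> small_iff by (simp add: prog_def kd)
        moreover have "good_output (set js) sch"
          unfolding good_output_def
        proof (intro conjI js_set cardjs)
          have "ennreal (kertz_const - loss_const * (1 / E)) * expected_max D (set js) \<le> ennreal (W n / (1 + 6 * (1 / E)))"
          proof (rule guarantee_rest[OF _ qJ])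
            show "q i0 * (1 / E) ^ 3 \<le> 1 / E * W n"
              using mult_left_mono[of "q i0 * (1 / E)\<^sup>2" "W n" "1 / E"] False E4
              by (simp add: power3_eq_cube power2_eq_square mult_ac)
          qed (use q0 i0 E4 in auto)
          then show "ennreal (kertz_const - 2 * loss_const * ?e) * expected_max D (set js) \<le> expected_reward D (set js) (schedule_policy sch)"
            using sch(4) mult_right_mono[OF le, of "expected_max D (set js)"] by (meson order_trans zero_le)
        qed
        ultimately show ?thesis using sch by (auto simp: enc_entry_def)
      next
        case True
        have "0 < q i0" using True W_nonneg[of n] q0[OF i0(1)] by (cases "q i0 = 0") auto
        have i0js: "i0 \<notin> set js"
        proof
          assume "i0 \<in> set js"
          then have "E ^ 3 * q i0 \<le> 1 * q i0" by (simp add: js_def)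
          moreover have "1 < E ^ 3" using E4 by (intro one_less_power) auto
          ultimately show False using \<open>0 < q i0\<close> by (simp add: mult_le_cancel_right)
        qed
        define sch' where "sch' = (i0, 0) # sch"
        have set': "set (map fst sch') = insert i0 (set js)" "distinct (map fst sch')"
          using sch i0js by (auto simp: sch'_def)
        have "prog z = Node (fs (it i0)) (Node (Atom 0) (Atom 1)) # outp y"
          using e4 nogood \<open>\<not> npar z < epar z\<close> small_iff True i0(2) by (simp add: prog_def kd)
        then have pr: "prog z = map enc_entry sch'"
          by (simp add: sch sch'_def enc_entry_def it_def enc_rat_of_int[of 0, simplified])
        have pol: "schedule_policy sch' = set_policy ((i0, {0..}) # map (\<lambda>(i, \<theta>). (i, {of_rat \<theta>..})) sch)"
          by (simp add: schedule_policy_eq sch'_def)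
        have fst_map: "map fst (map (\<lambda>(i, \<theta>). (i, {real_of_rat \<theta>..})) sch) = map fst sch"
          by (simp add: comp_def case_prod_beta)
        have "good_output (insert i0 (set js)) sch'"
          unfolding good_output_def
        proof (intro conjI)
          show "insert i0 (set js) \<subseteq> {..<n}" using js_set i0 by auto
          have "card ({..<n} - insert i0 (set js)) \<le> card ({..<n} - set js)" by (intro card_mono) auto
          then show "real (card ({..<n} - insert i0 (set js))) \<le> 27 * (inverse ?e * ln (1 / ?e))\<^sup>2"
            using cardjs by linarith
          have "ennreal (kertz_const - loss_const * (1 / E)) * expected_max D (insert i0 (set js)) \<le> (\<integral>\<^sup>+v. ennreal v \<partial>D i0)"
          proof (rule guarantee_single[OF i0js law_D[OF i0(1)] mean_D[OF i0(1)]])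
            show "quantile (1 / E) (D i0) (q i0)" using quantile_q[OF i0(1)] E4 by simp
          qed (use qJ True in auto)
          also have "\<dots> \<le> expected_reward D (insert i0 (set js)) (schedule_policy sch')"
            using expected_reward_ge_first[of i0 "map (\<lambda>(i, \<theta>). (i, {real_of_rat \<theta>..})) sch" D]
              sch(2,3) i0js law_D i0(1) js_less unfolding pol list.map fst_map by auto
          finally show "ennreal (kertz_const - 2 * loss_const * ?e) * expected_max D (insert i0 (set js)) \<le>
              expected_reward D (insert i0 (set js)) (schedule_policy sch')"
            using mult_right_mono[OF le, of "expected_max D (insert i0 (set js))"] by (meson order_trans zero_le)
        qed
        then show ?thesis using pr set' by (auto simp: enc_entry_def)
      qed
    qed
  qed
qed

end

theorem theorem8:
  shows "\<exists>C1 > (0::real). \<exists>C2 > (0::real).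
    (\<forall>(n::nat) (D :: nat \<Rightarrow> real measure) (\<epsilon>::real).
       (\<forall>i<n. nonneg_law (D i)) \<longrightarrow> 0 < \<epsilon> \<longrightarrow>
       (\<exists>J \<subseteq> {..<n}.
          real (card ({..<n} - J)) \<le> C1 * (inverse \<epsilon> * ln (1 / \<epsilon>))\<^sup>2 \<and>
          opt_free D J \<ge> ennreal (kertz_const - C2 * \<epsilon>) * expected_max D J)) \<and>
    (\<exists>alg :: fin_law list \<times> rat \<Rightarrow> schedule.
       poly_time_on {(laws, \<epsilon>). (\<forall>vps\<in>set laws. valid_fin_law vps) \<and> 0 < \<epsilon>}
         enc_instance enc_schedule alg \<and>
       (\<forall>(laws :: fin_law list) (\<epsilon>::rat).
          (\<forall>vps\<in>set laws. valid_fin_law vps) \<longrightarrow> 0 < \<epsilon> \<longrightarrow>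
          (let n = length laws;
               D = (\<lambda>i. law_of (laws ! i));
               e = real_of_rat \<epsilon>;
               sch = alg (laws, \<epsilon>);
               J = set (map fst sch)
           in distinct (map fst sch) \<and> J \<subseteq> {..<n} \<and>
              real (card ({..<n} - J)) \<le> C1 * (inverse e * ln (1 / e))\<^sup>2 \<and>
              expected_reward D J (schedule_policy sch)
                \<ge> ennreal (kertz_const - C2 * e) * expected_max D J)))"
proof (rule exI[of _ 27], rule conjI, simp, rule exI[of _ "2 * loss_const"], intro conjI)
  show "0 < 2 * loss_const" using kertz_const_pos by (simp add: loss_const_def add_pos_pos)
  show "\<forall>(n::nat) (D :: nat \<Rightarrow> real measure) (\<epsilon>::real).
       (\<forall>i<n. nonneg_law (D i)) \<longrightarrow> 0 < \<epsilon> \<longrightarrow>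
       (\<exists>J \<subseteq> {..<n}.
          real (card ({..<n} - J)) \<le> 27 * (inverse \<epsilon> * ln (1 / \<epsilon>))\<^sup>2 \<and>
          opt_free D J \<ge> ennreal (kertz_const - 2 * loss_const * \<epsilon>) * expected_max D J)"
    using prophet_removal by blast
  \<comment> \<open>The program works on encodings. The function on schedules that
    \<open>poly_time_on\<close> asks for is obtained by choosing, for every instance, a schedule
    that the output encodes.\<close>
  define ok where "ok laws \<epsilon> sch \<longleftrightarrow> of_list (prog (enc_instance (laws, \<epsilon>))) = enc_schedule sch \<and> distinct (map fst sch) \<and>
    program_instance.good_output laws \<epsilon> (set (map fst sch)) sch" for laws \<epsilon> sch
  have "\<exists>sch. ok laws \<epsilon> sch" if "\<forall>vps\<in>set laws. valid_fin_law vps" "0 < \<epsilon>" for laws \<epsilon>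
  proof -
    interpret program_instance laws \<epsilon> by standard (use that in auto)
    obtain sch where sch: "prog z = map (\<lambda>(i, r). Node (Atom (int i)) (enc_rat r)) sch" "distinct (map fst sch)"
      "good_output (set (map fst sch)) sch"
      using prog_correct by blast
    have "enc_schedule sch = of_list (map (enc_prod enc_nat enc_rat) sch)"
      unfolding enc_schedule_def by (rule enc_list_eq)
    then have "of_list (prog z) = enc_schedule sch"
      unfolding sch(1) enc_prod_def enc_nat_def by simp
    with sch show ?thesis by (auto simp: ok_def z_def)
  qed
  then obtain alg where alg: "\<And>laws \<epsilon>. \<forall>vps\<in>set laws. valid_fin_law vps \<Longrightarrow> 0 < \<epsilon> \<Longrightarrow> ok laws \<epsilon> (alg laws \<epsilon>)"
    by metis
  let ?alg = "\<lambda>(laws, \<epsilon>). alg laws \<epsilon>"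
  obtain c m d where c: "ptime_by c m d (\<lambda>z. of_list (prog z))"
    using ptime_prog unfolding ptime_def by blast
  have "poly_time_on {(laws, \<epsilon>). (\<forall>vps\<in>set laws. valid_fin_law vps) \<and> 0 < \<epsilon>} enc_instance enc_schedule ?alg"
    unfolding poly_time_on_def
  \<comment> \<open>\<open>[:2, 1:] ^ d\<close> is the polynomial (x + 2)^d, the form of the time
    bound in \<open>ptime_by\<close>.\<close>
  proof (intro exI[of _ c] exI[of _ "[:2, 1:] ^ d"] ballI)
    fix a assume a: "a \<in> {(laws, \<epsilon>). (\<forall>vps\<in>set laws. valid_fin_law vps) \<and> (0::rat) < \<epsilon>}"
    obtain t s where ts: "exec c ((\<lambda>_. Atom 0)(0 := enc_instance a)) t s" "s 0 = of_list (prog (enc_instance a))"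
      "t \<le> (bit_size (enc_instance a) + 2) ^ d"
      using c[unfolded ptime_by_def, rule_format, of "(\<lambda>_. Atom 0)(0 := enc_instance a)"] by auto
    have "s 0 = enc_schedule (?alg a)"
      using a alg[of "fst a" "snd a"] ts(2) by (auto simp: ok_def)
    moreover have "t \<le> poly ([:2, 1:] ^ d) (bit_size (enc_instance a))"
      using ts(3) by (simp add: poly_power add.commute)
    ultimately show "\<exists>t s. exec c ((\<lambda>_. Atom 0)(0 := enc_instance a)) t s \<and> s 0 = enc_schedule (?alg a) \<and>
        t \<le> poly ([:2, 1:] ^ d) (bit_size (enc_instance a))"
      using ts(1) by blast
  qed
  moreover have "\<forall>(laws :: fin_law list) (\<epsilon>::rat).
          (\<forall>vps\<in>set laws. valid_fin_law vps) \<longrightarrow> 0 < \<epsilon> \<longrightarrow>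
          (let n = length laws;
               D = (\<lambda>i. law_of (laws ! i));
               e = real_of_rat \<epsilon>;
               sch = ?alg (laws, \<epsilon>);
               J = set (map fst sch)
           in distinct (map fst sch) \<and> J \<subseteq> {..<n} \<and>
              real (card ({..<n} - J)) \<le> 27 * (inverse e * ln (1 / e))\<^sup>2 \<and>
              expected_reward D J (schedule_policy sch)
                \<ge> ennreal (kertz_const - 2 * loss_const * e) * expected_max D J)"
  proof (intro allI impI)
    fix laws :: "fin_law list" and \<epsilon> :: rat
    assume *: "\<forall>vps\<in>set laws. valid_fin_law vps" "0 < \<epsilon>"
    interpret program_instance laws \<epsilon> by standard (use * in auto)
    have D: "D = (\<lambda>i. law_of (laws ! i))" by (simp add: fun_eq_iff D_def)
    show "let n = length laws; D = (\<lambda>i. law_of (laws ! i)); e = real_of_rat \<epsilon>; sch = ?alg (laws, \<epsilon>); J = set (map fst sch)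
           in distinct (map fst sch) \<and> J \<subseteq> {..<n} \<and>
              real (card ({..<n} - J)) \<le> 27 * (inverse e * ln (1 / e))\<^sup>2 \<and>
              expected_reward D J (schedule_policy sch)
                \<ge> ennreal (kertz_const - 2 * loss_const * e) * expected_max D J"
      using alg[OF *] unfolding ok_def good_output_def n_def D by (simp add: Let_def)
  qed
  ultimately show "\<exists>alg :: fin_law list \<times> rat \<Rightarrow> schedule.
       poly_time_on {(laws, \<epsilon>). (\<forall>vps\<in>set laws. valid_fin_law vps) \<and> 0 < \<epsilon>}
         enc_instance enc_schedule alg \<and>
       (\<forall>(laws :: fin_law list) (\<epsilon>::rat).
          (\<forall>vps\<in>set laws. valid_fin_law vps) \<longrightarrow> 0 < \<epsilon> \<longrightarrow>
          (let n = length laws;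
               D = (\<lambda>i. law_of (laws ! i));
               e = real_of_rat \<epsilon>;
               sch = alg (laws, \<epsilon>);
               J = set (map fst sch)
           in distinct (map fst sch) \<and> J \<subseteq> {..<n} \<and>
              real (card ({..<n} - J)) \<le> 27 * (inverse e * ln (1 / e))\<^sup>2 \<and>
              expected_reward D J (schedule_policy sch)
                \<ge> ennreal (kertz_const - 2 * loss_const * e) * expected_max D J))"
    by blast
qed

end
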